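(* Let $n\ge1$ be an integer, and let $\mathbf g=(g_1,g_2,\dots)$ be a growth sequence, that is, a sequence of integers with $1=g_1<g_2<\cdots$, $g_r\mid g_{r+1}$ for all $r$, and such that $\gamma_r=g_{r+1}/g_r$ satisfies $\sum_{r=1}^\infty\gamma_r^{-2}<\infty$. Then the ensemble $\mathcal E\big(\big[\begin{smallmatrix} n\\ n\end{smallmatrix}\big],\mathbf g\big)$ contains uncountably many isomorphism classes of AF algebras.
   Context: $\mathcal M_m$ denotes the C*-algebra of $m\times m$ complex matrices. For $r\ge1$ put $\mathcal A_r=\mathcal M_{g_rn}\oplus\mathcal M_{g_rn}$. A unital *-homomorphism $\phi:\mathcal A_r\to\mathcal A_{r+1}$ is standard if $\phi(a_1,a_2)=(b_1,b_2)$ where each $b_j$ is block diagonal with diagonal blocks among $a_1,a_2$ listed in increasing order of subscript. It is uniquely determined by its $2\times2$ matrix of partial multiplicities $X=[x_{ji}]$, where $x_{ji}\in\mathbb Z_{\ge0}$ is the number of times $a_i$ occurs in $b_j$; the matrices that occur are exactly the nonnegative integer matrices both of whose row sums equal $\gamma_r$. The ensemble $\mathcal E\big(\big[\begin{smallmatrix} n\\ n\end{smallmatrix}\big],\mathbf g\big)$ is the set of all sequences $(\phi_1,\phi_2,\dots)$ with $\phi_r:\mathcal A_r\to\mathcal A_{r+1}$ a standard unital *-homomorphism for every $r$. Each such sequence is identified with the AF algebra that is the C*-algebraic direct limit of $\mathcal A_1\xrightarrow{\phi_1}\mathcal A_2\xrightarrow{\phi_2}\cdots$. Isomorphism means *-isomorphism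 of C*-algebras. *)

theory Defs
  imports
    "HOL-Analysis.L2_Norm"
    "HOL-Library.Countable_Set"
    "HOL-Library.FuncSet"
    "HOL-Algebra.Module"
    "Jordan_Normal_Form.Matrix"
    "Jordan_Normal_Form.Schur_Decomposition"
begin

section \<open>Complex star-algebras with a norm\<close>

record 'a star_algebra = "(complex, 'a) module" +
  star :: "'a \<Rightarrow> 'a"
  cnorm :: "'a \<Rightarrow> real"

definition star_hom :: "'a star_algebra \<Rightarrow> 'b star_algebra \<Rightarrow> ('a \<Rightarrow> 'b) \<Rightarrow> bool" where
  "star_hom A B h \<longleftrightarrow>
     h \<in> carrier A \<rightarrow> carrier B \<and>
     (\<forall>x\<in>carrier A. \<forall>y\<in>carrier A. h (x \<oplus>\<^bsub>A\<^esub> y) = h x \<oplus>\<^bsub>B\<^esub> h y) \<and>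
     (\<forall>x\<in>carrier A. \<forall>y\<in>carrier A. h (x \<otimes>\<^bsub>A\<^esub> y) = h x \<otimes>\<^bsub>B\<^esub> h y) \<and>
     (\<forall>c. \<forall>x\<in>carrier A. h (c \<odot>\<^bsub>A\<^esub> x) = c \<odot>\<^bsub>B\<^esub> h x) \<and>
     (\<forall>x\<in>carrier A. h (star A x) = star B (h x))"

definition unital_star_hom :: "'a star_algebra \<Rightarrow> 'b star_algebra \<Rightarrow> ('a \<Rightarrow> 'b) \<Rightarrow> bool" where
  "unital_star_hom A B h \<longleftrightarrow> star_hom A B h \<and> h \<one>\<^bsub>A\<^esub> = \<one>\<^bsub>B\<^esub>"

text \<open>Preservation of the norm is not demanded: between C*-algebras a bijective
  star-homomorphism is automatically isometric.\<close>

definition star_isomorphic :: "'a star_algebra \<Rightarrow> 'b star_algebra \<Rightarrow> bool" where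
  "star_isomorphic A B \<longleftrightarrow> (\<exists>h. star_hom A B h \<and> bij_betw h (carrier A) (carrier B))"

section \<open>Matrix algebras and direct sums\<close>

definition vec_l2_norm :: "complex vec \<Rightarrow> real" where
  "vec_l2_norm v = L2_set (\<lambda>i. cmod (v $ i)) {..<dim_vec v}"

definition mat_op_norm :: "complex mat \<Rightarrow> real" where
  "mat_op_norm a =
     (SUP v\<in>{v \<in> carrier_vec (dim_col a). vec_l2_norm v \<le> 1}. vec_l2_norm (a *\<^sub>v v))"

definition matrix_algebra :: "nat \<Rightarrow> complex mat star_algebra" where
  "matrix_algebra m = \<lparr>
     carrier = carrier_mat m m,
     monoid.mult = (*),
     one = 1\<^sub>m m,
     zero = 0\<^sub>m m m,
     add = (+),
     module.smult = (\<cdot>\<^sub>m),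
     star = mat_adjoint,
     cnorm = mat_op_norm\<rparr>"

definition direct_sum ::
  "'a star_algebra \<Rightarrow> 'b star_algebra \<Rightarrow> ('a \<times> 'b) star_algebra" where
  "direct_sum A B = \<lparr>
     carrier = carrier A \<times> carrier B,
     monoid.mult = (\<lambda>(a, b) (a', b'). (a \<otimes>\<^bsub>A\<^esub> a', b \<otimes>\<^bsub>B\<^esub> b')),
     one = (\<one>\<^bsub>A\<^esub>, \<one>\<^bsub>B\<^esub>),
     zero = (\<zero>\<^bsub>A\<^esub>, \<zero>\<^bsub>B\<^esub>),
     add = (\<lambda>(a, b) (a', b'). (a \<oplus>\<^bsub>A\<^esub> a', b \<oplus>\<^bsub>B\<^esub> b')),
     module.smult = (\<lambda>c (a, b). (c \<odot>\<^bsub>A\<^esub> a, c \<odot>\<^bsub>B\<^esub> b)),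
     star = (\<lambda>(a, b). (star A a, star B b)),
     cnorm = (\<lambda>(a, b). max (cnorm A a) (cnorm B b))\<rparr>"

section \<open>The C*-algebraic direct limit\<close>

text \<open>
  The limit of a sequence of C*-algebras \<open>A 0 \<rightarrow> A 1 \<rightarrow> \<dots>\<close> with connecting star-homomorphisms
  \<open>\<phi> r\<close> is realised in the usual way inside the C*-algebra of bounded sequences modulo null
  sequences.  An element \<open>x\<close> of \<open>A s\<close> is sent to the class of any sequence that follows the
  connecting maps from \<open>x\<close> at stage \<open>s\<close> onwards; the images of the \<open>A s\<close> thus are the classes of
  the eventually coherent sequences, and the limit is the norm closure of their union.
  Since the quotient norm of the class of \<open>a\<close> is the limit superior of the norms of the \<open>a r\<close>,
  membership in that closure is the approximation condition in \<open>limit_seqs\<close>.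
\<close>

definition bounded_seqs :: "(nat \<Rightarrow> 'a star_algebra) \<Rightarrow> (nat \<Rightarrow> 'a) set" where
  "bounded_seqs A =
     {a. (\<forall>r. a r \<in> carrier (A r)) \<and> bdd_above (range (\<lambda>r. cnorm (A r) (a r)))}"

definition coherent_seqs ::
  "(nat \<Rightarrow> 'a star_algebra) \<Rightarrow> (nat \<Rightarrow> 'a \<Rightarrow> 'a) \<Rightarrow> (nat \<Rightarrow> 'a) set" where
  "coherent_seqs A \<phi> =
     {a \<in> bounded_seqs A. eventually (\<lambda>r. a (Suc r) = \<phi> r (a r)) sequentially}"

definition limit_seqs ::
  "(nat \<Rightarrow> 'a star_algebra) \<Rightarrow> (nat \<Rightarrow> 'a \<Rightarrow> 'a) \<Rightarrow> (nat \<Rightarrow> 'a) set" where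
  "limit_seqs A \<phi> =
     {a \<in> bounded_seqs A. \<forall>\<epsilon>>0. \<exists>c\<in>coherent_seqs A \<phi>.
        eventually (\<lambda>r. cnorm (A r) (a r \<ominus>\<^bsub>A r\<^esub> c r) < \<epsilon>) sequentially}"

definition limit_rel ::
  "(nat \<Rightarrow> 'a star_algebra) \<Rightarrow> (nat \<Rightarrow> 'a \<Rightarrow> 'a) \<Rightarrow> ((nat \<Rightarrow> 'a) \<times> (nat \<Rightarrow> 'a)) set" where
  "limit_rel A \<phi> =
     {(a, b). a \<in> limit_seqs A \<phi> \<and> b \<in> limit_seqs A \<phi> \<and>
        (\<lambda>r. cnorm (A r) (a r \<ominus>\<^bsub>A r\<^esub> b r)) \<longlonglongrightarrow> 0}"

text \<open>
  The operations are those of sequences, lifted to equivalence classes.  For a sequence in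
  \<open>limit_seqs A \<phi>\<close> the norms converge, because star-homomorphisms of C*-algebras are
  contractive, so the limit superior in the quotient norm is a limit.
\<close>

definition direct_limit ::
  "(nat \<Rightarrow> 'a star_algebra) \<Rightarrow> (nat \<Rightarrow> 'a \<Rightarrow> 'a) \<Rightarrow> (nat \<Rightarrow> 'a) set star_algebra" where
  "direct_limit A \<phi> = \<lparr>
     carrier = limit_seqs A \<phi> // limit_rel A \<phi>,
     monoid.mult = (\<lambda>X Y. \<Union>a\<in>X. \<Union>b\<in>Y. limit_rel A \<phi> `` {\<lambda>r. a r \<otimes>\<^bsub>A r\<^esub> b r}),
     one = limit_rel A \<phi> `` {\<lambda>r. \<one>\<^bsub>A r\<^esub>},
     zero = limit_rel A \<phi> `` {\<lambda>r. \<zero>\<^bsub>A r\<^esub>},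
     add = (\<lambda>X Y. \<Union>a\<in>X. \<Union>b\<in>Y. limit_rel A \<phi> `` {\<lambda>r. a r \<oplus>\<^bsub>A r\<^esub> b r}),
     module.smult = (\<lambda>c X. \<Union>a\<in>X. limit_rel A \<phi> `` {\<lambda>r. c \<odot>\<^bsub>A r\<^esub> a r}),
     star = (\<lambda>X. \<Union>a\<in>X. limit_rel A \<phi> `` {\<lambda>r. star (A r) (a r)}),
     cnorm = (\<lambda>X. the_elem ((\<lambda>a. lim (\<lambda>r. cnorm (A r) (a r))) ` X))\<rparr>"

section \<open>Growth sequences and ensembles\<close>

text \<open>Sequences are indexed from 0: \<open>g r\<close>, \<open>growth_ratio g r\<close> and \<open>stage n g r\<close> stand for
  $g_{r+1}$, $\gamma_{r+1}$ and $\mathcal A_{r+1}$.\<close>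

definition growth_ratio :: "(nat \<Rightarrow> nat) \<Rightarrow> nat \<Rightarrow> nat" where
  "growth_ratio g r = g (Suc r) div g r"

definition growth_sequence :: "(nat \<Rightarrow> nat) \<Rightarrow> bool" where
  "growth_sequence g \<longleftrightarrow>
     g 0 = 1 \<and> strict_mono g \<and> (\<forall>r. g r dvd g (Suc r)) \<and>
     summable (\<lambda>r. 1 / (real (growth_ratio g r))\<^sup>2)"

definition stage :: "nat \<Rightarrow> (nat \<Rightarrow> nat) \<Rightarrow> nat \<Rightarrow> (complex mat \<times> complex mat) star_algebra" where
  "stage n g r = direct_sum (matrix_algebra (g r * n)) (matrix_algebra (g r * n))"

text \<open>\<open>x j i\<close> is the number of times \<open>a\<^sub>i\<close> occurs in the \<open>j\<close>-th component of the image.  Maps are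
  taken to be undefined off the domain, so that equality of maps is equality on the domain.\<close>

definition standard_block :: "(nat \<Rightarrow> nat) \<Rightarrow> complex mat \<Rightarrow> complex mat \<Rightarrow> complex mat" where
  "standard_block k a\<^sub>1 a\<^sub>2 = diag_block_mat (replicate (k 1) a\<^sub>1 @ replicate (k 2) a\<^sub>2)"

definition standard_hom ::
  "nat \<Rightarrow> (nat \<Rightarrow> nat) \<Rightarrow> nat \<Rightarrow> (complex mat \<times> complex mat \<Rightarrow> complex mat \<times> complex mat) \<Rightarrow> bool"
  where
  "standard_hom n g r f \<longleftrightarrow>
     f \<in> extensional (carrier (stage n g r)) \<and>
     unital_star_hom (stage n g r) (stage n g (Suc r)) f \<and>
     (\<exists>x :: nat \<Rightarrow> nat \<Rightarrow> nat. \<forall>(a\<^sub>1, a\<^sub>2)\<in>carrier (stage n g r).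
        f (a\<^sub>1, a\<^sub>2) = (standard_block (x 1) a\<^sub>1 a\<^sub>2, standard_block (x 2) a\<^sub>1 a\<^sub>2))"

definition ensemble ::
  "nat \<Rightarrow> (nat \<Rightarrow> nat) \<Rightarrow> (nat \<Rightarrow> complex mat \<times> complex mat \<Rightarrow> complex mat \<times> complex mat) set"
  where
  "ensemble n g = {\<phi>. \<forall>r. standard_hom n g r (\<phi> r)}"

definition AF_algebra ::
  "nat \<Rightarrow> (nat \<Rightarrow> nat) \<Rightarrow> (nat \<Rightarrow> complex mat \<times> complex mat \<Rightarrow> complex mat \<times> complex mat) \<Rightarrow>
     (nat \<Rightarrow> complex mat \<times> complex mat) set star_algebra" where
  "AF_algebra n g \<phi> = direct_limit (stage n g) \<phi>"

definition iso_rel ::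
  "nat \<Rightarrow> (nat \<Rightarrow> nat) \<Rightarrow> ((nat \<Rightarrow> complex mat \<times> complex mat \<Rightarrow> complex mat \<times> complex mat) \<times>
     (nat \<Rightarrow> complex mat \<times> complex mat \<Rightarrow> complex mat \<times> complex mat)) set" where
  "iso_rel n g =
     {(\<phi>, \<psi>). \<phi> \<in> ensemble n g \<and> \<psi> \<in> ensemble n g \<and>
        star_isomorphic (AF_algebra n g \<phi>) (AF_algebra n g \<psi>)}"

end

theory Submission
  imports Defs
begin

text \<open>
  The uncountably many algebras come from triangular multiplicity matrices with rows
  \<open>(\<gamma> r, 0)\<close> and \<open>(\<gamma> r - m r, m r)\<close>.  In the limit \<open>A\<close> the sequences that vanish in the first
  summand form an ideal \<open>J\<close>, the limit of the second summands with embeddings of multiplicity \<open>m r\<close>,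
  so that \<open>K\<^sub>0(J)\<close> is the group of rationals whose denominators divide some product
  \<open>m 0 * \<dots> * m t\<close>.  Summability of \<open>1 / (\<gamma> r)\<^sup>2\<close> makes \<open>\<gamma> r\<close> tend to infinity.  Therefore, for any set
  \<open>S\<close> of primes, one can choose \<open>m r \<in> S \<union> {1}\<close> with \<open>2 * m r \<le> \<gamma> r\<close> such that each member of \<open>S\<close>
  occurs infinitely often (\<open>multiplicity_choice\<close>).  Then \<open>K\<^sub>0(J)\<close> is divisible by a prime \<open>p\<close> if
  and only if \<open>p \<in> S\<close>, and it remains to read this off from \<open>A\<close>.

  For this the ideal has to be recognised inside \<open>A\<close>.  By \<open>2 * m r \<le> \<gamma> r\<close> the relative size of an
  idempotent of \<open>J\<close> tends to zero along the stages, whereas an idempotent outside \<open>J\<close> keeps a fixed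
  positive proportion of the first summand.  So the idempotents of \<open>J\<close> are those of which arbitrarily
  many orthogonal copies fit into \<open>A\<close>.  This leads to the invariant \<open>divisible_infinitesimal A p\<close>:
  there is a nonzero idempotent \<open>e\<close> of that kind which, for every \<open>k\<close>, is a sum of \<open>p ^ k\<close>
  orthogonal idempotents equivalent to one another.  It only mentions addition and multiplication, and
  it holds if and only if \<open>p \<in> S\<close> (\<open>divisible_infinitesimal_iff\<close>).  Since there are uncountably
  many sets of primes, there are uncountably many isomorphism classes.

  For \<open>p \<in> S\<close> the idempotent is the unit of the second summand of the first stage, and everything
  takes place among diagonal projections of a finite stage (\<open>divisible_infinitesimal_if_in\<close>).  The
  converse (\<open>in_if_divisible_infinitesimal\<close>) needs integers attached to an arbitrary idempotent of the
  limit.  Such an element is represented by a sequence of matrices that are idempotent only up to an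
  error that tends to zero.  Instead of replacing them by exact projections, the rank is extended to
  near idempotents: \<open>near_rank h\<close> is the largest dimension of a subspace of vectors that \<open>h\<close> moves
  by less than half of their norm.  It is invariant under approximate equivalence
  (\<open>near_rank_eq_if_equivalent\<close>), additive on approximately orthogonal sums
  (\<open>near_rank_subadditive\<close>, \<open>near_rank_superadditive\<close>) and hence additive over diagonal blocks
  (\<open>near_rank_blocks\<close>).  At late stages the ranks of the two components of an idempotent therefore
  follow the multiplicity matrix, and the condition on copies makes the first component vanish, while
  the divisibility condition fails for the second component if \<open>p \<notin> S\<close>.
\<close>

section \<open>The Euclidean norm on vectors and the operator norm on matrices\<close>

lemma vec_l2_norm_nonneg [simp]: "0 \<le> vec_l2_norm v"
  by (simp add: vec_l2_norm_def L2_set_nonneg)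

lemma vec_l2_norm_zero [simp]: "vec_l2_norm (0\<^sub>v k) = 0"
  unfolding vec_l2_norm_def by (rule trans[OF L2_set_cong[where g = "\<lambda>_. 0"]]) (auto simp: L2_set_def)

lemma vec_l2_norm_power2: "v \<in> carrier_vec k \<Longrightarrow> (vec_l2_norm v)\<^sup>2 = (\<Sum>i<k. (cmod (v $ i))\<^sup>2)"
  unfolding vec_l2_norm_def L2_set_def by (auto simp: sum_nonneg)

lemma vec_l2_norm_eq_0_iff:
  assumes "v \<in> carrier_vec k"
  shows "vec_l2_norm v = 0 \<longleftrightarrow> v = 0\<^sub>v k"
proof
  assume "vec_l2_norm v = 0"
  then show "v = 0\<^sub>v k"
    using assms unfolding vec_l2_norm_def by (intro eq_vecI) (auto simp: L2_set_eq_0_iff)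
qed auto

lemma vec_l2_norm_pos: "v \<in> carrier_vec k \<Longrightarrow> v \<noteq> 0\<^sub>v k \<Longrightarrow> 0 < vec_l2_norm v"
  using vec_l2_norm_eq_0_iff[of v k] vec_l2_norm_nonneg[of v] by linarith

lemma vec_l2_norm_triangle:
  assumes "v \<in> carrier_vec k" "w \<in> carrier_vec k"
  shows "vec_l2_norm (v + w) \<le> vec_l2_norm v + vec_l2_norm w"
proof -
  have "vec_l2_norm (v + w) = L2_set (\<lambda>i. cmod (v $ i + w $ i)) {..<k}"
    using assms unfolding vec_l2_norm_def by (intro L2_set_cong) auto
  also have "\<dots> \<le> L2_set (\<lambda>i. cmod (v $ i) + cmod (w $ i)) {..<k}"
    by (intro L2_set_mono) (auto intro: norm_triangle_ineq)
  also have "\<dots> \<le> vec_l2_norm v + vec_l2_norm w"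
    using assms L2_set_triangle_ineq[of "\<lambda>i. cmod (v $ i)" "\<lambda>i. cmod (w $ i)" "{..<k}"]
    unfolding vec_l2_norm_def by auto
  finally show ?thesis .
qed

lemma vec_l2_norm_smult: "vec_l2_norm (c \<cdot>\<^sub>v v) = cmod c * vec_l2_norm v"
proof -
  have "vec_l2_norm (c \<cdot>\<^sub>v v) = L2_set (\<lambda>i. cmod c * cmod (v $ i)) {..<dim_vec v}"
    unfolding vec_l2_norm_def by (intro L2_set_cong) (auto simp: norm_mult)
  then show ?thesis by (simp add: L2_set_right_distrib vec_l2_norm_def)
qed

lemma vec_l2_norm_minus_commute:
  assumes "v \<in> carrier_vec k" "w \<in> carrier_vec k"
  shows "vec_l2_norm (v - w) = vec_l2_norm (w - v)"
  using assms unfolding vec_l2_norm_def by (intro L2_set_cong) (auto simp: norm_minus_commute)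

lemma vec_l2_norm_diff_triangle:
  assumes "u \<in> carrier_vec k" "v \<in> carrier_vec k" "w \<in> carrier_vec k"
  shows "vec_l2_norm (u - w) \<le> vec_l2_norm (u - v) + vec_l2_norm (v - w)"
proof -
  have "u - w = (u - v) + (v - w)" using assms by auto
  then show ?thesis using vec_l2_norm_triangle[of "u - v" k "v - w"] assms by auto
qed

lemma vec_l2_norm_le_diff:
  assumes "u \<in> carrier_vec k" "v \<in> carrier_vec k"
  shows "vec_l2_norm u \<le> vec_l2_norm v + vec_l2_norm (u - v)"
  proof -
  have "u = v + (u - v)" using assms by auto
  then show ?thesis using vec_l2_norm_triangle[of v k "u - v"] assms by auto
qed

lemma sum_lessThan_add:
  fixes f :: "nat \<Rightarrow> 'b::comm_monoid_add"
  shows "(\<Sum>i<a + b. f i) = (\<Sum>i<a. f i) + (\<Sum>i<b. f (a + i))"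
  by (induction b) (auto simp: ac_simps)

lemma vec_l2_norm_append:
  "(vec_l2_norm (v @\<^sub>v w))\<^sup>2 = (vec_l2_norm v)\<^sup>2 + (vec_l2_norm w)\<^sup>2"
proof -
  have "(vec_l2_norm (v @\<^sub>v w))\<^sup>2 = (\<Sum>i<dim_vec v + dim_vec w. (cmod ((v @\<^sub>v w) $ i))\<^sup>2)"
    by (intro vec_l2_norm_power2) auto
  also have "\<dots> = (\<Sum>i<dim_vec v. (cmod (v $ i))\<^sup>2) + (\<Sum>i<dim_vec w. (cmod (w $ i))\<^sup>2)"
    by (subst sum_lessThan_add) auto
  finally show ?thesis using vec_l2_norm_power2[of v "dim_vec v"] vec_l2_norm_power2[of w "dim_vec w"] by simp
qed

text \<open>The supremum in the definition of the operator norm is finite, with the sum of the absolute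
  values of all entries as a crude bound.\<close>

lemma mult_mat_vec_l2_norm_bounded:
  assumes A: "A \<in> carrier_mat r c"
  shows "\<exists>B\<ge>0. \<forall>v\<in>carrier_vec c. vec_l2_norm (A *\<^sub>v v) \<le> B * vec_l2_norm v"
proof (intro exI conjI ballI)
  let ?B = "\<Sum>i<r. \<Sum>j<c. cmod (A $$ (i, j))"
  show "?B \<ge> 0" by (intro sum_nonneg) auto
  fix v :: "complex vec" assume v: "v \<in> carrier_vec c"
  have le: "cmod (v $ j) \<le> vec_l2_norm v" if "j < c" for j
    using v that member_le_L2_set[of "{..<c}" j "\<lambda>i. cmod (v $ i)"] unfolding vec_l2_norm_def by auto
  have "vec_l2_norm (A *\<^sub>v v) = L2_set (\<lambda>i. cmod ((A *\<^sub>v v) $ i)) {..<r}"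
    using A unfolding vec_l2_norm_def by auto
  also have "\<dots> \<le> (\<Sum>i<r. cmod ((A *\<^sub>v v) $ i))" by (rule L2_set_le_sum) auto
  also have "\<dots> \<le> (\<Sum>i<r. (\<Sum>j<c. cmod (A $$ (i, j))) * vec_l2_norm v)"
  proof (intro sum_mono)
    fix i assume i: "i \<in> {..<r}"
    have "cmod ((A *\<^sub>v v) $ i) = cmod (\<Sum>j<c. A $$ (i, j) * v $ j)"
      using A v i by (auto simp: scalar_prod_def lessThan_atLeast0 intro!: arg_cong[of _ _ cmod] sum.cong)
    also have "\<dots> \<le> (\<Sum>j<c. cmod (A $$ (i, j)) * vec_l2_norm v)"
      by (intro sum_norm_le) (auto simp: norm_mult intro!: mult_left_mono le)
    finally show "cmod ((A *\<^sub>v v) $ i) \<le> (\<Sum>j<c. cmod (A $$ (i, j))) * vec_l2_norm v"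
      by (simp add: sum_distrib_right)
  qed
  finally show "vec_l2_norm (A *\<^sub>v v) \<le> ?B * vec_l2_norm v" by (simp add: sum_distrib_right)
qed

lemma mat_op_norm_bdd:
  assumes A: "A \<in> carrier_mat r c"
  shows "bdd_above ((\<lambda>v. vec_l2_norm (A *\<^sub>v v)) ` {v \<in> carrier_vec (dim_col A). vec_l2_norm v \<le> 1})"
proof -
  obtain B where B: "B \<ge> 0" "\<And>v. v \<in> carrier_vec c \<Longrightarrow> vec_l2_norm (A *\<^sub>v v) \<le> B * vec_l2_norm v"
    using mult_mat_vec_l2_norm_bounded[OF A] by blast
  show ?thesis
  proof (rule bdd_aboveI2[where M = B])
    fix v assume "v \<in> {v \<in> carrier_vec (dim_col A). vec_l2_norm v \<le> 1}"
    then show "vec_l2_norm (A *\<^sub>v v) \<le> B"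
      using B(2)[of v] A mult_left_mono[of "vec_l2_norm v" 1 B] B(1) by auto
  qed
qed

lemma mat_op_norm_mult_vec_le:
  assumes A: "A \<in> carrier_mat r c" and v: "v \<in> carrier_vec c"
  shows "vec_l2_norm (A *\<^sub>v v) \<le> mat_op_norm A * vec_l2_norm v"
proof (cases "v = 0\<^sub>v c")
  case True
  have "A *\<^sub>v 0\<^sub>v c = 0\<^sub>v r" using A by auto
  then show ?thesis using True by simp
next
  case False
  let ?n = "vec_l2_norm v"
  have n: "?n > 0" using vec_l2_norm_pos[OF v False] .
  let ?w = "complex_of_real (inverse ?n) \<cdot>\<^sub>v v"
  have nw: "vec_l2_norm ?w = 1" using n by (simp add: vec_l2_norm_smult norm_inverse)
  have "vec_l2_norm (A *\<^sub>v ?w) \<le> mat_op_norm A"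
    unfolding mat_op_norm_def using A v nw by (intro cSUP_upper mat_op_norm_bdd[OF A]) auto
  moreover have "vec_l2_norm (A *\<^sub>v ?w) = inverse ?n * vec_l2_norm (A *\<^sub>v v)"
    using n by (simp add: mult_mat_vec[OF A v] vec_l2_norm_smult norm_inverse)
  ultimately have "inverse ?n * vec_l2_norm (A *\<^sub>v v) \<le> mat_op_norm A" by simp
  then show ?thesis using n by (simp add: field_simps)
qed

lemma mat_op_norm_leI:
  assumes A: "A \<in> carrier_mat r c" and B: "B \<ge> 0"
    and le: "\<And>v. v \<in> carrier_vec c \<Longrightarrow> vec_l2_norm (A *\<^sub>v v) \<le> B * vec_l2_norm v"
  shows "mat_op_norm A \<le> B"
  unfolding mat_op_norm_def
proof (rule cSUP_least)
  show "{v \<in> carrier_vec (dim_col A). vec_l2_norm v \<le> 1} \<noteq> {}"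
    by (auto intro!: exI[of _ "0\<^sub>v (dim_col A)"])
  fix v assume "v \<in> {v \<in> carrier_vec (dim_col A). vec_l2_norm v \<le> 1}"
  then show "vec_l2_norm (A *\<^sub>v v) \<le> B"
    using le[of v] A mult_left_mono[of "vec_l2_norm v" 1 B] B by auto
qed

lemma mat_op_norm_nonneg:
  assumes A: "A \<in> carrier_mat r c"
  shows "0 \<le> mat_op_norm A"
proof -
  have "vec_l2_norm (A *\<^sub>v 0\<^sub>v c) \<le> mat_op_norm A"
    unfolding mat_op_norm_def using A by (intro cSUP_upper mat_op_norm_bdd[OF A]) auto
  then show ?thesis using vec_l2_norm_nonneg[of "A *\<^sub>v 0\<^sub>v c"] by linarith
qed

lemma zero_mult_mat_vec: "v \<in> carrier_vec c \<Longrightarrow> 0\<^sub>m r c *\<^sub>v v = (0\<^sub>v r :: complex vec)"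
  by (intro eq_vecI) auto

lemma mat_op_norm_zero [simp]: "mat_op_norm (0\<^sub>m r c) = 0"
  by (intro antisym mat_op_norm_nonneg[of _ r c] mat_op_norm_leI[of _ r c])
     (auto simp: zero_mult_mat_vec)

lemma mat_op_norm_triangle:
  assumes A: "A \<in> carrier_mat r c" and B: "B \<in> carrier_mat r c"
  shows "mat_op_norm (A + B) \<le> mat_op_norm A + mat_op_norm B"
proof (rule mat_op_norm_leI[of _ r c])
  fix v :: "complex vec" assume v: "v \<in> carrier_vec c"
  have "vec_l2_norm ((A + B) *\<^sub>v v) \<le> vec_l2_norm (A *\<^sub>v v) + vec_l2_norm (B *\<^sub>v v)"
    using vec_l2_norm_triangle[of "A *\<^sub>v v" r "B *\<^sub>v v"] A B v by (simp add: add_mult_distrib_mat_vec)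
  then show "vec_l2_norm ((A + B) *\<^sub>v v) \<le> (mat_op_norm A + mat_op_norm B) * vec_l2_norm v"
    using mat_op_norm_mult_vec_le[OF A v] mat_op_norm_mult_vec_le[OF B v] by (simp add: distrib_right)
qed (use A B mat_op_norm_nonneg in auto)

lemma mat_op_norm_mult:
  assumes A: "A \<in> carrier_mat r m" and B: "B \<in> carrier_mat m c"
  shows "mat_op_norm (A * B) \<le> mat_op_norm A * mat_op_norm B"
proof (rule mat_op_norm_leI[of _ r c])
  fix v :: "complex vec" assume v: "v \<in> carrier_vec c"
  have "vec_l2_norm ((A * B) *\<^sub>v v) \<le> mat_op_norm A * vec_l2_norm (B *\<^sub>v v)"
    using mat_op_norm_mult_vec_le[OF A, of "B *\<^sub>v v"] A B v by auto
  also have "\<dots> \<le> mat_op_norm A * (mat_op_norm B * vec_l2_norm v)"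
    using mat_op_norm_mult_vec_le[OF B v] mat_op_norm_nonneg[OF A] by (intro mult_left_mono) auto
  finally show "vec_l2_norm ((A * B) *\<^sub>v v) \<le> mat_op_norm A * mat_op_norm B * vec_l2_norm v"
    by simp
qed (use A B mat_op_norm_nonneg in auto)

lemma mat_op_norm_uminus:
  assumes A: "A \<in> carrier_mat r c"
  shows "mat_op_norm (- A) = mat_op_norm A"
proof -
  have *: "mat_op_norm (- A) \<le> mat_op_norm A" if A: "A \<in> carrier_mat r c" for A
  proof (rule mat_op_norm_leI[of _ r c])
    fix v :: "complex vec" assume v: "v \<in> carrier_vec c"
    have "(- A) *\<^sub>v v = (-1) \<cdot>\<^sub>v (A *\<^sub>v v)" using A v by (intro eq_vecI) (auto simp: scalar_prod_def sum_negf)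
    then show "vec_l2_norm ((- A) *\<^sub>v v) \<le> mat_op_norm A * vec_l2_norm v"
      using mat_op_norm_mult_vec_le[OF A v] by (simp add: vec_l2_norm_smult)
  qed (use that mat_op_norm_nonneg in auto)
  have "A = - (- A)" by auto
  then show ?thesis using *[OF A] *[of "- A"] A by (metis antisym uminus_carrier_mat)
qed

section \<open>The rank of an approximate idempotent\<close>

text \<open>For a projection \<open>h\<close> and \<open>c < 1\<close> the largest \<open>d\<close> with this property is the rank of \<open>h\<close>: a
  subspace of vectors \<open>x\<close> with \<open>\<parallel>h x - x\<parallel> < c \<parallel>x\<parallel>\<close> meets the kernel of \<open>h\<close> only in \<open>0\<close>.  The
  condition survives small perturbations of \<open>h\<close>, which the rank itself does not.  The strict
  inequality also makes \<open>A\<close> injective.\<close>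

definition almost_fixed_dim :: "complex mat \<Rightarrow> real \<Rightarrow> nat \<Rightarrow> bool" where
  "almost_fixed_dim h c d \<longleftrightarrow>
     (\<exists>A\<in>carrier_mat (dim_row h) d. \<forall>v\<in>carrier_vec d. v \<noteq> 0\<^sub>v d \<longrightarrow>
        vec_l2_norm (h *\<^sub>v (A *\<^sub>v v) - A *\<^sub>v v) < c * vec_l2_norm (A *\<^sub>v v))"

definition near_rank :: "complex mat \<Rightarrow> nat" where
  "near_rank h = Max {d. almost_fixed_dim h (1/2) d}"

text \<open>The bound on \<open>h * h - h\<close> has to shrink with the norm bound \<open>C\<close>, because the estimates below
  amplify an error by a multiple of \<open>C\<^sup>2\<close>; the factor 64 leaves enough room for all of them.\<close>

definition near_idempotent :: "real \<Rightarrow> nat \<Rightarrow> complex mat \<Rightarrow> bool" where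
  "near_idempotent C k h \<longleftrightarrow>
     h \<in> carrier_mat k k \<and> mat_op_norm h \<le> C \<and> mat_op_norm (h * h - h) < 1 / (64 * C\<^sup>2)"

text \<open>Zero rows turn the matrix into a square one with vanishing determinant.\<close>

lemma wide_matrix_kernel:
  assumes M: "M \<in> carrier_mat r d" and "r < d"
  shows "\<exists>v\<in>carrier_vec d. v \<noteq> 0\<^sub>v d \<and> M *\<^sub>v v = (0\<^sub>v r :: complex vec)"
proof -
  let ?M = "mat d d (\<lambda>(i, j). if i < r then M $$ (i, j) else 0)"
  have sq: "?M \<in> carrier_mat d d" by simp
  have "?M = mat\<^sub>r d d (\<lambda>i. if i = r then 0\<^sub>v d else row ?M i)"
    by (intro eq_matI) auto
  then have "det ?M = 0"
    using det_row_0[OF \<open>r < d\<close>, of "row ?M"] by fastforce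
  then obtain v where v: "v \<in> carrier_vec d" "v \<noteq> 0\<^sub>v d" "?M *\<^sub>v v = 0\<^sub>v d"
    using det_0_iff_vec_prod_zero[OF sq] by blast
  have "M *\<^sub>v v = 0\<^sub>v r"
  proof (rule eq_vecI)
    fix i assume i: "i < dim_vec (0\<^sub>v r :: complex vec)"
    have "(M *\<^sub>v v) $ i = (?M *\<^sub>v v) $ i"
      using i M v(1) \<open>r < d\<close> by (auto simp: scalar_prod_def intro!: sum.cong)
    then show "(M *\<^sub>v v) $ i = 0\<^sub>v r $ i" using i v(3) \<open>r < d\<close> by simp
  qed (use M in auto)
  then show ?thesis using v by blast
qed

lemma almost_fixed_dim_le:
  assumes "almost_fixed_dim h c d"
  shows "d \<le> dim_row h"
proof (rule ccontr)
  assume "\<not> d \<le> dim_row h"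
  obtain A where A: "A \<in> carrier_mat (dim_row h) d"
    and lt: "\<And>v. v \<in> carrier_vec d \<Longrightarrow> v \<noteq> 0\<^sub>v d \<Longrightarrow>
      vec_l2_norm (h *\<^sub>v (A *\<^sub>v v) - A *\<^sub>v v) < c * vec_l2_norm (A *\<^sub>v v)"
    using assms unfolding almost_fixed_dim_def by blast
  obtain v where v: "v \<in> carrier_vec d" "v \<noteq> 0\<^sub>v d" "A *\<^sub>v v = 0\<^sub>v (dim_row h)"
    using wide_matrix_kernel[OF A] \<open>\<not> d \<le> dim_row h\<close> by auto
  have "0 < c * vec_l2_norm (A *\<^sub>v v)" using lt[OF v(1,2)] vec_l2_norm_nonneg le_less_trans by blast
  then show False using v(3) by simp
qed

lemma finite_almost_fixed_dim: "finite {d. almost_fixed_dim h c d}"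
  by (rule finite_subset[of _ "{..dim_row h}"]) (auto dest: almost_fixed_dim_le)

lemma almost_fixed_dim_0: "almost_fixed_dim h c 0"
  unfolding almost_fixed_dim_def by (intro bexI[of _ "0\<^sub>m (dim_row h) 0"]) auto

lemma almost_fixed_dim_near_rank: "almost_fixed_dim h (1/2) (near_rank h)"
proof -
  have "{d. almost_fixed_dim h (1/2) d} \<noteq> {}" using almost_fixed_dim_0 by auto
  then show ?thesis using Max_in[OF finite_almost_fixed_dim[of h "1/2"]] unfolding near_rank_def by simp
qed

lemma near_rank_ge: "almost_fixed_dim h (1/2) d \<Longrightarrow> d \<le> near_rank h"
  unfolding near_rank_def by (rule Max_ge[OF finite_almost_fixed_dim]) simp

lemma near_rank_le_dim: "near_rank h \<le> dim_row h"
  by (rule almost_fixed_dim_le[OF almost_fixed_dim_near_rank])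

lemma near_rank_geI:
  assumes "h \<in> carrier_mat k k" "A \<in> carrier_mat k d"
    and "\<And>v. v \<in> carrier_vec d \<Longrightarrow> v \<noteq> 0\<^sub>v d \<Longrightarrow>
      vec_l2_norm (h *\<^sub>v (A *\<^sub>v v) - A *\<^sub>v v) < 1/2 * vec_l2_norm (A *\<^sub>v v)"
  shows "d \<le> near_rank h"
proof (rule near_rank_ge)
  have "dim_row h = k" using assms(1) by auto
  then show "almost_fixed_dim h (1/2) d"
    unfolding almost_fixed_dim_def using assms(2,3) by (intro bexI[of _ A]) auto
qed

lemma mat_diff_mult_vec_le:
  assumes "M \<in> carrier_mat r c" "M' \<in> carrier_mat r c" "u \<in> carrier_vec c"
    and "mat_op_norm (M - M') \<le> b"
  shows "vec_l2_norm (M *\<^sub>v u - M' *\<^sub>v u) \<le> b * vec_l2_norm u"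
proof -
  have "vec_l2_norm (M *\<^sub>v u - M' *\<^sub>v u) = vec_l2_norm ((M - M') *\<^sub>v u)"
    using assms by (simp add: minus_mult_distrib_mat_vec)
  also have "\<dots> \<le> mat_op_norm (M - M') * vec_l2_norm u"
    using assms by (intro mat_op_norm_mult_vec_le[of _ r c]) auto
  also have "\<dots> \<le> b * vec_l2_norm u" using assms by (intro mult_right_mono) auto
  finally show ?thesis .
qed

lemma mat_op_norm_mult_vec_le':
  assumes "M \<in> carrier_mat r c" "u \<in> carrier_vec c" "mat_op_norm M \<le> b"
  shows "vec_l2_norm (M *\<^sub>v u) \<le> b * vec_l2_norm u"
  using mat_op_norm_mult_vec_le[OF assms(1,2)] mult_right_mono[OF assms(3), of "vec_l2_norm u"]
  by auto

lemma vec_l2_norm_pos_if_bound: "vec_l2_norm v < b * vec_l2_norm u \<Longrightarrow> 0 < vec_l2_norm u"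
proof (rule ccontr)
  assume *: "vec_l2_norm v < b * vec_l2_norm u" "\<not> 0 < vec_l2_norm u"
  then have "vec_l2_norm u = 0" using vec_l2_norm_nonneg[of u] by linarith
  then show False using * vec_l2_norm_nonneg[of v] by simp
qed

text \<open>Applying \<open>h\<close> to a subspace that \<open>h\<close> moves by at most half of the norm gives a subspace of the same
  dimension on which \<open>h\<close> is almost the identity, since \<open>h (h x) - h x\<close> is tiny.  Hence the threshold
  1/2 in the definition of the rank is immaterial for near idempotents.\<close>

lemma near_rank_sharp:
  assumes h: "near_idempotent C k h" and C: "C \<ge> 1"
  obtains A where "A \<in> carrier_mat k (near_rank h)"
    and "\<And>v. v \<in> carrier_vec (near_rank h) \<Longrightarrow> v \<noteq> 0\<^sub>v (near_rank h) \<Longrightarrow>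
      vec_l2_norm (h *\<^sub>v (A *\<^sub>v v) - A *\<^sub>v v) < 1 / (32 * C\<^sup>2) * vec_l2_norm (A *\<^sub>v v)"
proof -
  let ?d = "near_rank h"
  note hc = h[unfolded near_idempotent_def]
  have k: "dim_row h = k" using hc by auto
  obtain A where A: "A \<in> carrier_mat k ?d"
    and lt: "\<And>v. v \<in> carrier_vec ?d \<Longrightarrow> v \<noteq> 0\<^sub>v ?d \<Longrightarrow>
      vec_l2_norm (h *\<^sub>v (A *\<^sub>v v) - A *\<^sub>v v) < 1/2 * vec_l2_norm (A *\<^sub>v v)"
    using almost_fixed_dim_near_rank[of h] unfolding almost_fixed_dim_def k by blast
  show ?thesis
  proof (rule that[of "h * A"])
    show "h * A \<in> carrier_mat k ?d" using hc A by auto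
    fix v :: "complex vec" assume v: "v \<in> carrier_vec ?d" "v \<noteq> 0\<^sub>v ?d"
    let ?u = "A *\<^sub>v v"
    have u: "?u \<in> carrier_vec k" using A v by auto
    have hu: "h *\<^sub>v ?u \<in> carrier_vec k" using hc u by auto
    have eq: "h * A *\<^sub>v v = h *\<^sub>v ?u" using hc A v by (auto simp: assoc_mult_mat_vec)
    have "vec_l2_norm ?u \<le> vec_l2_norm (h *\<^sub>v ?u) + vec_l2_norm (?u - h *\<^sub>v ?u)"
      using vec_l2_norm_le_diff[OF u hu] .
    then have big: "vec_l2_norm ?u < 2 * vec_l2_norm (h *\<^sub>v ?u)"
      using lt[OF v] vec_l2_norm_minus_commute[OF u hu] by linarith
    have "vec_l2_norm (h * h *\<^sub>v ?u - h *\<^sub>v ?u) \<le> 1 / (64 * C\<^sup>2) * vec_l2_norm ?u"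
      using hc u by (intro mat_diff_mult_vec_le[of _ k k]) auto
    also have "\<dots> < 1 / (64 * C\<^sup>2) * (2 * vec_l2_norm (h *\<^sub>v ?u))"
      using big C by (intro mult_strict_left_mono) auto
    finally show "vec_l2_norm (h *\<^sub>v (h * A *\<^sub>v v) - h * A *\<^sub>v v)
        < 1 / (32 * C\<^sup>2) * vec_l2_norm (h * A *\<^sub>v v)"
      using hc u by (simp add: eq assoc_mult_mat_vec[of h k k h k])
  qed
qed

text \<open>If \<open>x y\<close> and \<open>y x\<close> are close to \<open>e\<close> and \<open>f\<close>, then \<open>y\<close> carries the almost fixed vectors of \<open>e\<close>
  injectively to almost fixed vectors of \<open>f\<close>.\<close>

lemma near_rank_le_if_equivalent:
  assumes e: "near_idempotent C k e" and C: "C \<ge> 1" and f: "f \<in> carrier_mat l l"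
    and x: "x \<in> carrier_mat k l" "mat_op_norm x \<le> C"
    and y: "y \<in> carrier_mat l k" "mat_op_norm y \<le> C"
    and xy: "mat_op_norm (x * y - e) < 1 / (64 * C\<^sup>2)"
    and yx: "mat_op_norm (y * x - f) < 1 / (64 * C\<^sup>2)"
  shows "near_rank e \<le> near_rank f"
proof -
  let ?N = vec_l2_norm
  define \<epsilon> where "\<epsilon> = 1 / (64 * C\<^sup>2)"
  have C2: "C\<^sup>2 \<ge> 1" using C by simp
  have \<epsilon>0: "\<epsilon> > 0" "\<epsilon> * C\<^sup>2 = 1 / 64" using C unfolding \<epsilon>_def by auto
  moreover have "\<epsilon> * 1 \<le> \<epsilon> * C\<^sup>2" using C2 \<epsilon>0(1) by (intro mult_left_mono) auto
  ultimately have \<epsilon>: "\<epsilon> > 0" "\<epsilon> * C\<^sup>2 = 1 / 64" "\<epsilon> \<le> 1 / 64" by linarith+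
  note ec = e[unfolded near_idempotent_def]
  obtain A where A: "A \<in> carrier_mat k (near_rank e)"
    and lt: "\<And>v. v \<in> carrier_vec (near_rank e) \<Longrightarrow> v \<noteq> 0\<^sub>v (near_rank e) \<Longrightarrow>
      ?N (e *\<^sub>v (A *\<^sub>v v) - A *\<^sub>v v) < 1 / (32 * C\<^sup>2) * ?N (A *\<^sub>v v)"
    using near_rank_sharp[OF e C] by blast
  show ?thesis
  proof (rule near_rank_geI[OF f, of "y * A"])
    show "y * A \<in> carrier_mat l (near_rank e)" using y A by auto
    fix v :: "complex vec" assume v: "v \<in> carrier_vec (near_rank e)" "v \<noteq> 0\<^sub>v (near_rank e)"
    define u where "u = A *\<^sub>v v"
    define w where "w = y *\<^sub>v u"
    have u: "u \<in> carrier_vec k" using A v by (auto simp: u_def)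
    have w: "w \<in> carrier_vec l" using y u by (auto simp: w_def)
    have yA: "y * A *\<^sub>v v = w" using y A v by (auto simp: u_def w_def assoc_mult_mat_vec)
    have ltu: "?N (e *\<^sub>v u - u) < 2 * \<epsilon> * ?N u" using lt[OF v] by (simp add: u_def \<epsilon>_def)
    then have upos: "?N u > 0" by (rule vec_l2_norm_pos_if_bound)
    have "?N (x * y *\<^sub>v u - e *\<^sub>v u) \<le> \<epsilon> * ?N u"
      using ec x y xy u by (intro mat_diff_mult_vec_le[of _ k k]) (auto simp: \<epsilon>_def)
    then have xw_u: "?N (x *\<^sub>v w - u) \<le> 3 * \<epsilon> * ?N u"
      using vec_l2_norm_diff_triangle[of "x *\<^sub>v w" k "e *\<^sub>v u" u] ltu x y u w ec
      by (auto simp: w_def assoc_mult_mat_vec[of x k l y k])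
    have "?N (x *\<^sub>v w) \<le> C * ?N w" using x w by (intro mat_op_norm_mult_vec_le') auto
    moreover have "?N u \<le> ?N (x *\<^sub>v w) + ?N (x *\<^sub>v w - u)"
      using vec_l2_norm_le_diff[of u k "x *\<^sub>v w"] vec_l2_norm_minus_commute[of u k "x *\<^sub>v w"] u x w by auto
    moreover have "3 * \<epsilon> * ?N u \<le> 1/2 * ?N u" using \<epsilon> upos by (intro mult_right_mono) auto
    ultimately have uw: "?N u \<le> 2 * C * ?N w" using xw_u by linarith
    have "?N (y *\<^sub>v (x *\<^sub>v w) - y *\<^sub>v u) = ?N (y *\<^sub>v (x *\<^sub>v w - u))"
      using x y u w by (simp add: mult_minus_distrib_mat_vec[of y l k])
    also have "\<dots> \<le> C * ?N (x *\<^sub>v w - u)" using x y u w by (intro mat_op_norm_mult_vec_le') auto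
    also have "\<dots> \<le> C * (3 * \<epsilon> * (2 * C * ?N w))"
      using xw_u uw C \<epsilon> by (intro mult_left_mono order_trans[OF xw_u]) auto
    also have "\<dots> = 6 * (\<epsilon> * C\<^sup>2) * ?N w" by (simp add: power2_eq_square)
    finally have 1: "?N (y *\<^sub>v (x *\<^sub>v w) - w) \<le> 6 / 64 * ?N w" by (simp add: \<epsilon>(2) w_def)
    have "?N (y * x *\<^sub>v w - f *\<^sub>v w) \<le> \<epsilon> * ?N w"
      using f x y yx w by (intro mat_diff_mult_vec_le[of _ l l]) (auto simp: \<epsilon>_def)
    also have "\<dots> \<le> 1/64 * ?N w" using \<epsilon> by (intro mult_right_mono) auto
    finally have 2: "?N (f *\<^sub>v w - y *\<^sub>v (x *\<^sub>v w)) \<le> 1/64 * ?N w"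
      using vec_l2_norm_minus_commute[of "f *\<^sub>v w" l "y *\<^sub>v (x *\<^sub>v w)"] f x y w
      by (auto simp: assoc_mult_mat_vec[of y l k x l])
    have "?N w > 0"
      using uw upos by (intro vec_l2_norm_pos_if_bound[of "0\<^sub>v 1" "2 * C"]) simp
    moreover have "?N (f *\<^sub>v w - w) \<le> 7/64 * ?N w"
      using vec_l2_norm_diff_triangle[of "f *\<^sub>v w" l "y *\<^sub>v (x *\<^sub>v w)" w] 1 2 f x y w by auto
    ultimately show "?N (f *\<^sub>v (y * A *\<^sub>v v) - y * A *\<^sub>v v) < 1/2 * ?N (y * A *\<^sub>v v)"
      unfolding yA by linarith
  qed
qed

lemma near_rank_eq_if_equivalent:
  assumes "near_idempotent C k e" "near_idempotent C l f" and C: "C \<ge> 1"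
    and x: "x \<in> carrier_mat k l" "mat_op_norm x \<le> C"
    and y: "y \<in> carrier_mat l k" "mat_op_norm y \<le> C"
    and "mat_op_norm (x * y - e) < 1 / (64 * C\<^sup>2)"
    and "mat_op_norm (y * x - f) < 1 / (64 * C\<^sup>2)"
  shows "near_rank e = near_rank f"
  using assms near_rank_le_if_equivalent[of C k e f l x y] near_rank_le_if_equivalent[of C l f e k y x]
  by (auto simp: near_idempotent_def)

text \<open>The matrix with the columns of \<open>A\<close> followed by those of \<open>B\<close>: the lower blocks have height 0.\<close>

definition hcat :: "complex mat \<Rightarrow> complex mat \<Rightarrow> complex mat" where
  "hcat A B = four_block_mat A B (0\<^sub>m 0 (dim_col A)) (0\<^sub>m 0 (dim_col B))"

lemma hcat_carrier: "A \<in> carrier_mat k a \<Longrightarrow> B \<in> carrier_mat k b \<Longrightarrow> hcat A B \<in> carrier_mat k (a + b)"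
  unfolding hcat_def by auto

lemma hcat_mult_vec:
  assumes A: "A \<in> carrier_mat k a" and B: "B \<in> carrier_mat k b"
    and v: "v \<in> carrier_vec a" and w: "w \<in> carrier_vec b"
  shows "hcat A B *\<^sub>v (v @\<^sub>v w) = A *\<^sub>v v + B *\<^sub>v w"
proof -
  have "hcat A B *\<^sub>v (v @\<^sub>v w)
      = (A *\<^sub>v v + B *\<^sub>v w) @\<^sub>v (0\<^sub>m 0 a *\<^sub>v v + 0\<^sub>m 0 b *\<^sub>v w)"
    using A B unfolding hcat_def
    by (simp add: four_block_mat_mult_vec[OF A B _ _ v w, of "0\<^sub>m 0 a" 0 "0\<^sub>m 0 b"])
  then show ?thesis by (intro eq_vecI) (use A B v w in auto)
qed

lemma split_vec:
  assumes "u \<in> carrier_vec (a + b)" and "u \<noteq> 0\<^sub>v (a + b)"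
  obtains v w where "v \<in> carrier_vec a" "w \<in> carrier_vec b" "u = v @\<^sub>v w" "v \<noteq> 0\<^sub>v a \<or> w \<noteq> 0\<^sub>v b"
proof (rule that[of "vec_first u a" "vec_last u b"])
  show eq: "u = vec_first u a @\<^sub>v vec_last u b" using assms(1) by simp
  have "0\<^sub>v a @\<^sub>v 0\<^sub>v b = 0\<^sub>v (a + b)" by (intro eq_vecI) auto
  then show "vec_first u a \<noteq> 0\<^sub>v a \<or> vec_last u b \<noteq> 0\<^sub>v b" using eq assms(2) by metis
qed auto

lemma vec_l2_norm_le_if_orthogonal:
  assumes x: "x \<in> carrier_vec k" and M: "M \<in> carrier_mat k a" and v: "v \<in> carrier_vec a"
    and orth: "mat a k (\<lambda>(j, i). cnj (M $$ (i, j))) *\<^sub>v x = 0\<^sub>v a"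
  shows "vec_l2_norm x \<le> vec_l2_norm (x - M *\<^sub>v v)"
proof -
  let ?w = "M *\<^sub>v v"
  have w: "?w \<in> carrier_vec k" using M v by auto
  have col: "(\<Sum>i<k. cnj (M $$ (i, j)) * x $ i) = 0" if "j < a" for j
  proof -
    have "(mat a k (\<lambda>(j, i). cnj (M $$ (i, j))) *\<^sub>v x) $ j = (\<Sum>i<k. cnj (M $$ (i, j)) * x $ i)"
      using that x by (auto simp: scalar_prod_def lessThan_atLeast0 intro!: sum.cong)
    then show ?thesis using orth that by simp
  qed
  have "(\<Sum>i<k. x $ i * cnj (?w $ i)) = (\<Sum>i<k. \<Sum>j<a. cnj (v $ j) * (cnj (M $$ (i, j)) * x $ i))"
    using M v by (auto simp: scalar_prod_def lessThan_atLeast0 sum_distrib_left sum_distrib_right ac_simps intro!: sum.cong)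
  also have "\<dots> = (\<Sum>j<a. cnj (v $ j) * (\<Sum>i<k. cnj (M $$ (i, j)) * x $ i))"
    by (subst sum.swap) (simp add: sum_distrib_left)
  also have "\<dots> = 0" using col by simp
  finally have 0: "(\<Sum>i<k. Re (x $ i * cnj (?w $ i))) = 0" by (metis Re_sum zero_complex.sel(1))
  have "(vec_l2_norm (x - ?w))\<^sup>2 = (\<Sum>i<k. (cmod (x $ i - ?w $ i))\<^sup>2)"
    using x w M by (subst vec_l2_norm_power2[of _ k]) (auto intro!: sum.cong)
  also have "\<dots> = (\<Sum>i<k. (cmod (x $ i))\<^sup>2 + (cmod (?w $ i))\<^sup>2 - 2 * Re (x $ i * cnj (?w $ i)))"
    by (intro sum.cong refl) (simp only: cmod_power2, simp add: power2_eq_square algebra_simps)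
  also have "\<dots> = (vec_l2_norm x)\<^sup>2 + (vec_l2_norm ?w)\<^sup>2"
    using 0 x w by (simp add: sum.distrib sum_subtractf vec_l2_norm_power2 flip: sum_distrib_left)
  finally have "(vec_l2_norm x)\<^sup>2 \<le> (vec_l2_norm (x - ?w))\<^sup>2" by simp
  then show ?thesis by (rule power2_le_imp_le) simp
qed

lemma vec_identities:
  fixes a b c d :: "complex vec"
  assumes "a \<in> carrier_vec k" "b \<in> carrier_vec k" "c \<in> carrier_vec k" "d \<in> carrier_vec k"
  shows vec_combination_diff: "(a + t \<cdot>\<^sub>v c) - (b + t \<cdot>\<^sub>v d) = (a - b) + t \<cdot>\<^sub>v (c - d)"
    and vec_add_0_smult: "a + 0 \<cdot>\<^sub>v b = a"
    and vec_add_diff_cancel: "(a + b) - b = a"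
    and vec_add_diff_add: "(a + b) - (c + d) = (a - c) + (b - d)"
    and vec_smult_diff_inverse: "t \<noteq> 0 \<Longrightarrow> a + t \<cdot>\<^sub>v b = t \<cdot>\<^sub>v (b - (- inverse t) \<cdot>\<^sub>v a)"
  using assms by (auto intro!: eq_vecI simp: algebra_simps)

lemma vec_regroup:
  fixes a b c d p q :: "complex vec"
  assumes "a \<in> carrier_vec k" "b \<in> carrier_vec k" "c \<in> carrier_vec k" "d \<in> carrier_vec k"
    "p \<in> carrier_vec k" "q \<in> carrier_vec k"
  shows "((a + b) + (c + d)) - (p + q) = ((a - p) + c) + ((d - q) + b)"
  using assms by (intro eq_vecI) auto

text \<open>The range of a near idempotent \<open>e\<close> lies near any almost fixed subspace of maximal dimension:
  otherwise \<open>e x\<close> could be adjoined to that subspace, and the rank would be larger.\<close>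

lemma near_rank_space_close:
  assumes e: "near_idempotent C k e" and C: "C \<ge> 1"
    and A: "A \<in> carrier_mat k (near_rank e)"
    and lt: "\<And>v. v \<in> carrier_vec (near_rank e) \<Longrightarrow> v \<noteq> 0\<^sub>v (near_rank e) \<Longrightarrow>
      vec_l2_norm (e *\<^sub>v (A *\<^sub>v v) - A *\<^sub>v v) < 1 / (32 * C\<^sup>2) * vec_l2_norm (A *\<^sub>v v)"
    and x: "x \<in> carrier_vec k"
  shows "\<exists>v\<in>carrier_vec (near_rank e). vec_l2_norm (e *\<^sub>v x - A *\<^sub>v v) \<le> 1/4 * vec_l2_norm x"
proof (rule ccontr)
  let ?N = vec_l2_norm and ?d = "near_rank e"
  assume "\<not> ?thesis"
  then have far: "1/4 * ?N x < ?N (e *\<^sub>v x - A *\<^sub>v v)" if "v \<in> carrier_vec ?d" for v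
    using that by force
  note ec = e[unfolded near_idempotent_def]
  have ex: "e *\<^sub>v x \<in> carrier_vec k" using ec x by auto
  \<comment> \<open>The column that enlarges the almost fixed subspace.\<close>
  let ?X = "mat k 1 (\<lambda>(i, j). (e *\<^sub>v x) $ i)"
  have X: "?X \<in> carrier_mat k 1" by simp
  have CC: "1 / C\<^sup>2 \<le> 1" "C / C\<^sup>2 \<le> 1" "C > 0"
    using C mult_mono[of 1 C 1 C] by (auto simp: power2_eq_square divide_le_eq)
  have "?d + 1 \<le> near_rank e"
  proof (rule near_rank_geI)
    show "e \<in> carrier_mat k k" using ec by auto
    show "hcat A ?X \<in> carrier_mat k (?d + 1)" using A by (intro hcat_carrier) auto
    fix y :: "complex vec" assume "y \<in> carrier_vec (?d + 1)" "y \<noteq> 0\<^sub>v (?d + 1)"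
    then obtain v w where vw: "v \<in> carrier_vec ?d" "w \<in> carrier_vec 1" "y = v @\<^sub>v w"
      "v \<noteq> 0\<^sub>v ?d \<or> w \<noteq> 0\<^sub>v 1" by (rule split_vec)
    define t where "t = w $ 0"
    define u where "u = A *\<^sub>v v + t \<cdot>\<^sub>v (e *\<^sub>v x)"
    have Xw: "?X *\<^sub>v w = t \<cdot>\<^sub>v (e *\<^sub>v x)"
      using vw(2) ec by (intro eq_vecI) (auto simp: t_def scalar_prod_def)
    have yu: "hcat A ?X *\<^sub>v y = u"
      unfolding vw(3) u_def hcat_mult_vec[OF A X vw(1,2)] Xw ..
    have Av: "A *\<^sub>v v \<in> carrier_vec k" using A vw by auto
    have u: "u \<in> carrier_vec k" using Av ex by (auto simp: u_def)
    have eAv: "?N (e *\<^sub>v (A *\<^sub>v v) - A *\<^sub>v v) \<le> 1 / (32 * C\<^sup>2) * ?N (A *\<^sub>v v)"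
    proof (cases "v = 0\<^sub>v ?d")
      case True
      have "A *\<^sub>v v = 0\<^sub>v k" using A True by auto
      moreover have "e *\<^sub>v 0\<^sub>v k = 0\<^sub>v k" using ec by auto
      ultimately show ?thesis by simp
    qed (use lt[OF vw(1)] in auto)
    have "?N (e *\<^sub>v u - u) < 1/2 * ?N u"
    proof (cases "t = 0")
      case True
      then have "w = 0\<^sub>v 1" using vw(2) by (intro eq_vecI) (auto simp: t_def)
      then have v0: "v \<noteq> 0\<^sub>v ?d" using vw(4) by auto
      have "u = A *\<^sub>v v" using vec_add_0_smult[OF Av ex Av Av] unfolding u_def True .
      then have *: "?N (e *\<^sub>v u - u) < 1 / (32 * C\<^sup>2) * ?N u" using lt[OF vw(1) v0] by simp
      also have "\<dots> \<le> 1/2 * ?N u" using CC by (intro mult_right_mono) auto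
      finally show ?thesis .
    next
      case False
      have "A *\<^sub>v ((- inverse t) \<cdot>\<^sub>v v) = (- inverse t) \<cdot>\<^sub>v (A *\<^sub>v v)"
        using A vw(1) by (rule mult_mat_vec)
      then have ut: "u = t \<cdot>\<^sub>v (e *\<^sub>v x - A *\<^sub>v ((- inverse t) \<cdot>\<^sub>v v))"
        unfolding u_def using vec_smult_diff_inverse[OF Av ex Av Av False] by simp
      have "cmod t * (1/4 * ?N x) < ?N u"
        unfolding ut vec_l2_norm_smult using far[of "(- inverse t) \<cdot>\<^sub>v v"] False vw(1)
        by (intro mult_strict_left_mono) auto
      then have tx: "cmod t * ?N x < 4 * ?N u" by simp
      have "0 \<le> cmod t * ?N x" by simp
      then have upos: "0 < ?N u" using tx by linarith
      have "?N (e *\<^sub>v x) \<le> C * ?N x" using ec x by (intro mat_op_norm_mult_vec_le'[of _ k k]) auto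
      then have "cmod t * ?N (e *\<^sub>v x) \<le> C * (cmod t * ?N x)"
        using mult_left_mono[of _ _ "cmod t"] by (fastforce simp: ac_simps)
      also have "\<dots> \<le> C * (4 * ?N u)" using tx C by (intro mult_left_mono) auto
      finally have tex: "?N (t \<cdot>\<^sub>v (e *\<^sub>v x)) \<le> 4 * C * ?N u" by (simp add: vec_l2_norm_smult)
      have "A *\<^sub>v v = u - t \<cdot>\<^sub>v (e *\<^sub>v x)"
        unfolding u_def using vec_add_diff_cancel[OF Av, of "t \<cdot>\<^sub>v (e *\<^sub>v x)"] ex Av by simp
      then have "?N (A *\<^sub>v v) \<le> ?N u + ?N (t \<cdot>\<^sub>v (e *\<^sub>v x))"
        using vec_l2_norm_diff_triangle[of u k "0\<^sub>v k" "t \<cdot>\<^sub>v (e *\<^sub>v x)"] u ex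
          vec_l2_norm_minus_commute[of "0\<^sub>v k" k "t \<cdot>\<^sub>v (e *\<^sub>v x)"] by simp
      moreover have "1 * ?N u \<le> C * ?N u" using C by (intro mult_right_mono) auto
      ultimately have "?N (A *\<^sub>v v) \<le> 5 * C * ?N u" using tex by simp
      then have "1 / (32 * C\<^sup>2) * ?N (A *\<^sub>v v) \<le> 1 / (32 * C\<^sup>2) * (5 * C * ?N u)"
        by (intro mult_left_mono) auto
      also have "\<dots> = 5 / 32 * (C / C\<^sup>2 * ?N u)" by simp
      also have "\<dots> \<le> 5 / 32 * (1 * ?N u)" using CC by (intro mult_left_mono mult_right_mono) auto
      finally have 1: "?N (e *\<^sub>v (A *\<^sub>v v) - A *\<^sub>v v) \<le> 5 / 32 * ?N u" using eAv by simp
      have "?N (e * e *\<^sub>v x - e *\<^sub>v x) \<le> 1 / (64 * C\<^sup>2) * ?N x"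
        using ec x by (intro mat_diff_mult_vec_le[of _ k k]) auto
      also have "\<dots> \<le> 1/64 * ?N x" using CC by (intro mult_right_mono) auto
      finally have "?N (e *\<^sub>v (e *\<^sub>v x) - e *\<^sub>v x) \<le> 1/64 * ?N x"
        using ec x by (simp add: assoc_mult_mat_vec[of e k k e k])
      then have "cmod t * ?N (e *\<^sub>v (e *\<^sub>v x) - e *\<^sub>v x) \<le> cmod t * (1/64 * ?N x)"
        by (intro mult_left_mono) auto
      then have 2: "?N (t \<cdot>\<^sub>v (e *\<^sub>v (e *\<^sub>v x) - e *\<^sub>v x)) \<le> 1/16 * ?N u"
        using tx by (simp add: vec_l2_norm_smult)
      have eex: "e *\<^sub>v (e *\<^sub>v x) \<in> carrier_vec k" "e *\<^sub>v (A *\<^sub>v v) \<in> carrier_vec k" using ec ex Av by auto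
      have "e *\<^sub>v u = e *\<^sub>v (A *\<^sub>v v) + t \<cdot>\<^sub>v (e *\<^sub>v (e *\<^sub>v x))"
        unfolding u_def using ec Av ex
        by (simp add: mult_add_distrib_mat_vec[of e k k] mult_mat_vec[of e k k])
      then have "e *\<^sub>v u - u
          = (e *\<^sub>v (A *\<^sub>v v) - A *\<^sub>v v) + t \<cdot>\<^sub>v (e *\<^sub>v (e *\<^sub>v x) - e *\<^sub>v x)"
        unfolding u_def using eex Av ex by (simp add: vec_combination_diff[of _ k])
      then have "?N (e *\<^sub>v u - u) \<le> 5/32 * ?N u + 1/16 * ?N u"
        using 1 2 eex Av ex vec_l2_norm_triangle[of "e *\<^sub>v (A *\<^sub>v v) - A *\<^sub>v v" k
            "t \<cdot>\<^sub>v (e *\<^sub>v (e *\<^sub>v x) - e *\<^sub>v x)"] by auto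
      then show ?thesis using upos by linarith
    qed
    then show "?N (e *\<^sub>v (hcat A ?X *\<^sub>v y) - hcat A ?X *\<^sub>v y) < 1/2 * ?N (hcat A ?X *\<^sub>v y)"
      unfolding yu .
  qed
  then show False by simp
qed

text \<open>The case of the zero subspace in the preceding lemma.\<close>

lemma near_rank_0_norm_le:
  assumes e: "near_idempotent C k e" and C: "C \<ge> 1" and 0: "near_rank e = 0"
  shows "mat_op_norm e \<le> 1/4"
proof (rule mat_op_norm_leI[of _ k k])
  fix x :: "complex vec" assume x: "x \<in> carrier_vec k"
  obtain v where v: "v \<in> carrier_vec 0"
    "vec_l2_norm (e *\<^sub>v x - 0\<^sub>m k 0 *\<^sub>v v) \<le> 1/4 * vec_l2_norm x"
  proof -
    have "\<And>v :: complex vec. v \<in> carrier_vec 0 \<Longrightarrow> v = 0\<^sub>v 0" by auto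
    then show ?thesis using near_rank_space_close[OF e C _ _ x, of "0\<^sub>m k 0"] that zero_carrier_mat[of k 0]
      unfolding 0 by blast
  qed
  moreover have "e *\<^sub>v x - 0\<^sub>m k 0 *\<^sub>v v = e *\<^sub>v x"
    using v(1) e x unfolding near_idempotent_def by (intro eq_vecI) (auto simp: zero_mult_mat_vec[of _ 0 k])
  ultimately show "vec_l2_norm (e *\<^sub>v x) \<le> 1/4 * vec_l2_norm x" by simp
qed (use e near_idempotent_def in auto)

text \<open>If the almost fixed space of \<open>e + f\<close> were too large, it would contain a vector \<open>x \<noteq> 0\<close> orthogonal
  to the almost fixed spaces of \<open>e\<close> and \<open>f\<close>.  But \<open>x\<close> is close to \<open>e x + f x\<close>, hence to the sum of these
  two spaces.\<close>

lemma near_rank_subadditive: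
  assumes e: "near_idempotent C k e" and f: "near_idempotent C k f" and C: "C \<ge> 1"
  shows "near_rank (e + f) \<le> near_rank e + near_rank f"
proof (rule ccontr)
  let ?N = vec_l2_norm and ?a = "near_rank e" and ?b = "near_rank f" and ?d = "near_rank (e + f)"
  assume less: "\<not> ?d \<le> ?a + ?b"
  have ec: "e \<in> carrier_mat k k" and fc: "f \<in> carrier_mat k k" using e f by (auto simp: near_idempotent_def)
  obtain A where A: "A \<in> carrier_mat k ?a"
    and A': "\<And>v. v \<in> carrier_vec ?a \<Longrightarrow> v \<noteq> 0\<^sub>v ?a \<Longrightarrow>
      ?N (e *\<^sub>v (A *\<^sub>v v) - A *\<^sub>v v) < 1 / (32 * C\<^sup>2) * ?N (A *\<^sub>v v)"
    using near_rank_sharp[OF e C] by blast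
  obtain B where B: "B \<in> carrier_mat k ?b"
    and B': "\<And>v. v \<in> carrier_vec ?b \<Longrightarrow> v \<noteq> 0\<^sub>v ?b \<Longrightarrow>
      ?N (f *\<^sub>v (B *\<^sub>v v) - B *\<^sub>v v) < 1 / (32 * C\<^sup>2) * ?N (B *\<^sub>v v)"
    using near_rank_sharp[OF f C] by blast
  have efk: "dim_row (e + f) = k" using fc by auto
  obtain D where D: "D \<in> carrier_mat k ?d"
    and D': "\<And>v. v \<in> carrier_vec ?d \<Longrightarrow> v \<noteq> 0\<^sub>v ?d \<Longrightarrow>
      ?N ((e + f) *\<^sub>v (D *\<^sub>v v) - D *\<^sub>v v) < 1/2 * ?N (D *\<^sub>v v)"
    using almost_fixed_dim_near_rank[of "e + f"] unfolding almost_fixed_dim_def efk by blast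
  let ?W = "hcat A B"
  have W: "?W \<in> carrier_mat k (?a + ?b)" using hcat_carrier[OF A B] .
  \<comment> \<open>The adjoint of \<open>?W\<close>, whose kernel is the orthogonal complement of both almost fixed spaces.\<close>
  let ?W' = "mat (?a + ?b) k (\<lambda>(j, i). cnj (?W $$ (i, j)))"
  have "?W' * D \<in> carrier_mat (?a + ?b) ?d" using D by (intro mult_carrier_mat[of _ _ k]) auto
  then obtain z where z: "z \<in> carrier_vec ?d" "z \<noteq> 0\<^sub>v ?d" "(?W' * D) *\<^sub>v z = 0\<^sub>v (?a + ?b)"
    using wide_matrix_kernel[of "?W' * D" "?a + ?b" ?d] less by (meson not_le)
  define x where "x = D *\<^sub>v z"
  have x: "x \<in> carrier_vec k" using D z by (auto simp: x_def)
  have orth: "?W' *\<^sub>v x = 0\<^sub>v (?a + ?b)"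
    using z D assoc_mult_mat_vec[of ?W' "?a + ?b" k D ?d z] by (simp add: x_def)
  obtain v where v: "v \<in> carrier_vec ?a" "?N (e *\<^sub>v x - A *\<^sub>v v) \<le> 1/4 * ?N x"
    using near_rank_space_close[OF e C A A' x] by blast
  obtain w where w: "w \<in> carrier_vec ?b" "?N (f *\<^sub>v x - B *\<^sub>v w) \<le> 1/4 * ?N x"
    using near_rank_space_close[OF f C B B' x] by blast
  have car: "e *\<^sub>v x \<in> carrier_vec k" "f *\<^sub>v x \<in> carrier_vec k" "A *\<^sub>v v \<in> carrier_vec k" "B *\<^sub>v w \<in> carrier_vec k"
    using ec fc A B v w x by auto
  have "?N x \<le> ?N (x - ?W *\<^sub>v (v @\<^sub>v w))"
    using v w by (intro vec_l2_norm_le_if_orthogonal[OF x W _ orth]) auto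
  also have "\<dots> = ?N (x - (A *\<^sub>v v + B *\<^sub>v w))" using hcat_mult_vec[OF A B v(1) w(1)] by simp
  also have "\<dots> \<le> ?N (x - (e + f) *\<^sub>v x) + ?N ((e + f) *\<^sub>v x - (A *\<^sub>v v + B *\<^sub>v w))"
    using x car ec fc by (intro vec_l2_norm_diff_triangle[of _ k]) (auto simp: add_mult_distrib_mat_vec)
  also have "?N (x - (e + f) *\<^sub>v x) < 1/2 * ?N x"
    using D'[OF z(1,2)] vec_l2_norm_minus_commute[of x k "(e + f) *\<^sub>v x"] x car ec fc
    by (simp add: x_def add_mult_distrib_mat_vec)
  also have "(e + f) *\<^sub>v x - (A *\<^sub>v v + B *\<^sub>v w) = (e *\<^sub>v x - A *\<^sub>v v) + (f *\<^sub>v x - B *\<^sub>v w)"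
    unfolding add_mult_distrib_mat_vec[OF ec fc x] using car by (simp add: vec_add_diff_add[of _ k])
  also have "?N \<dots> \<le> ?N (e *\<^sub>v x - A *\<^sub>v v) + ?N (f *\<^sub>v x - B *\<^sub>v w)"
    using car by (intro vec_l2_norm_triangle[of _ k]) auto
  finally show False using v(2) w(2) by simp
qed

text \<open>When \<open>e f\<close> and \<open>f e\<close> are small, the almost fixed spaces of \<open>e\<close> and \<open>f\<close> are nearly independent, and
  \<open>e + f\<close> almost fixes their sum.\<close>

lemma near_rank_superadditive:
  assumes e: "near_idempotent C k e" and f: "near_idempotent C k f" and C: "C \<ge> 1"
    and ef: "mat_op_norm (e * f) < 1 / (64 * C\<^sup>2)" and fe: "mat_op_norm (f * e) < 1 / (64 * C\<^sup>2)"
  shows "near_rank e + near_rank f \<le> near_rank (e + f)"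
proof -
  let ?N = vec_l2_norm and ?a = "near_rank e" and ?b = "near_rank f"
  define \<epsilon> where "\<epsilon> = 1 / (64 * C\<^sup>2)"
  have ec: "e \<in> carrier_mat k k" and fc: "f \<in> carrier_mat k k" using e f by (auto simp: near_idempotent_def)
  obtain A where A: "A \<in> carrier_mat k ?a"
    and A': "\<And>v. v \<in> carrier_vec ?a \<Longrightarrow> v \<noteq> 0\<^sub>v ?a \<Longrightarrow>
      ?N (e *\<^sub>v (A *\<^sub>v v) - A *\<^sub>v v) < 1 / (32 * C\<^sup>2) * ?N (A *\<^sub>v v)"
    using near_rank_sharp[OF e C] by blast
  obtain B where B: "B \<in> carrier_mat k ?b"
    and B': "\<And>v. v \<in> carrier_vec ?b \<Longrightarrow> v \<noteq> 0\<^sub>v ?b \<Longrightarrow>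
      ?N (f *\<^sub>v (B *\<^sub>v v) - B *\<^sub>v v) < 1 / (32 * C\<^sup>2) * ?N (B *\<^sub>v v)"
    using near_rank_sharp[OF f C] by blast
  have \<epsilon>: "\<epsilon> > 0" "C * \<epsilon> \<le> 1/64" "\<epsilon> \<le> C * \<epsilon>" "C * (C * \<epsilon>) = 1/64"
    using C by (auto simp: \<epsilon>_def power2_eq_square field_simps)
  \<comment> \<open>One of the two idempotents nearly annihilates the vectors that are almost fixed by the other.\<close>
  have cross: "?N (f *\<^sub>v x) \<le> 3 * (C * \<epsilon>) * ?N x"
    if "?N (e *\<^sub>v x - x) \<le> 2 * \<epsilon> * ?N x" "x \<in> carrier_vec k"
      "near_idempotent C k e" "near_idempotent C k f" "mat_op_norm (f * e) < \<epsilon>" for e f x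
  proof -
    have c: "e \<in> carrier_mat k k" "f \<in> carrier_mat k k" "mat_op_norm f \<le> C"
      using that by (auto simp: near_idempotent_def)
    have ex: "e *\<^sub>v x \<in> carrier_vec k" using c that by auto
    have "?N (f *\<^sub>v (e *\<^sub>v x)) = ?N ((f * e) *\<^sub>v x)" using c that by simp
    also have "\<dots> \<le> \<epsilon> * ?N x" using c that by (intro mat_op_norm_mult_vec_le'[of _ k k]) auto
    also have "\<dots> \<le> C * \<epsilon> * ?N x" using \<epsilon> by (intro mult_right_mono) auto
    finally have 1: "?N (f *\<^sub>v (e *\<^sub>v x)) \<le> C * \<epsilon> * ?N x" .
    have "?N (f *\<^sub>v x - f *\<^sub>v (e *\<^sub>v x)) = ?N (f *\<^sub>v (x - e *\<^sub>v x))"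
      using c that ex by (simp add: mult_minus_distrib_mat_vec[of f k k])
    also have "\<dots> \<le> C * ?N (x - e *\<^sub>v x)"
      using c that ex by (intro mat_op_norm_mult_vec_le'[of _ k k]) auto
    also have "\<dots> \<le> C * (2 * \<epsilon> * ?N x)"
      using that(1) vec_l2_norm_minus_commute[OF that(2) ex] C by (intro mult_left_mono) auto
    finally have 2: "?N (f *\<^sub>v x - f *\<^sub>v (e *\<^sub>v x)) \<le> C * (2 * \<epsilon> * ?N x)" .
    show ?thesis
      using 1 2 vec_l2_norm_le_diff[of "f *\<^sub>v x" k "f *\<^sub>v (e *\<^sub>v x)"] c that ex by (auto simp: algebra_simps)
  qed
  show ?thesis
  proof (rule near_rank_geI[of _ k "hcat A B"])
    show "e + f \<in> carrier_mat k k" using ec fc by auto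
    show "hcat A B \<in> carrier_mat k (?a + ?b)" using hcat_carrier[OF A B] .
    fix y :: "complex vec" assume "y \<in> carrier_vec (?a + ?b)" "y \<noteq> 0\<^sub>v (?a + ?b)"
    then obtain v w where vw: "v \<in> carrier_vec ?a" "w \<in> carrier_vec ?b" "y = v @\<^sub>v w"
      "v \<noteq> 0\<^sub>v ?a \<or> w \<noteq> 0\<^sub>v ?b" by (rule split_vec)
    define p where "p = A *\<^sub>v v"
    define q where "q = B *\<^sub>v w"
    have pq: "p \<in> carrier_vec k" "q \<in> carrier_vec k" using A B vw by (auto simp: p_def q_def)
    have yu: "hcat A B *\<^sub>v y = p + q" unfolding vw(3) hcat_mult_vec[OF A B vw(1,2)] p_def q_def ..
    have p: "?N (e *\<^sub>v p - p) \<le> 2 * \<epsilon> * ?N p"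
    proof (cases "v = 0\<^sub>v ?a")
      case True
      have "p = 0\<^sub>v k" using A True by (auto simp: p_def)
      moreover have "e *\<^sub>v 0\<^sub>v k = 0\<^sub>v k" using ec by auto
      ultimately show ?thesis by simp
    qed (use A'[OF vw(1)] in \<open>auto simp: p_def \<epsilon>_def\<close>)
    have q: "?N (f *\<^sub>v q - q) \<le> 2 * \<epsilon> * ?N q"
    proof (cases "w = 0\<^sub>v ?b")
      case True
      have "q = 0\<^sub>v k" using B True by (auto simp: q_def)
      moreover have "f *\<^sub>v 0\<^sub>v k = 0\<^sub>v k" using fc by auto
      ultimately show ?thesis by simp
    qed (use B'[OF vw(2)] in \<open>auto simp: q_def \<epsilon>_def\<close>)
    have pos: "0 < ?N p + ?N q"
    proof (cases "v = 0\<^sub>v ?a")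
      case True
      then have "0 < ?N q" using B'[OF vw(2)] vw(4) unfolding q_def by (blast intro: vec_l2_norm_pos_if_bound)
      then show ?thesis using vec_l2_norm_nonneg[of p] by linarith
    next
      case False
      then have "0 < ?N p" using A'[OF vw(1)] unfolding p_def by (blast intro: vec_l2_norm_pos_if_bound)
      then show ?thesis using vec_l2_norm_nonneg[of q] by linarith
    qed
    have fp: "?N (f *\<^sub>v p) \<le> 3 * (C * \<epsilon>) * ?N p" using cross[OF p pq(1) e f] fe by (simp add: \<epsilon>_def)
    have eq: "?N (e *\<^sub>v q) \<le> 3 * (C * \<epsilon>) * ?N q" using cross[OF q pq(2) f e] ef by (simp add: \<epsilon>_def)
    have car: "e *\<^sub>v p \<in> carrier_vec k" "f *\<^sub>v p \<in> carrier_vec k" "e *\<^sub>v q \<in> carrier_vec k" "f *\<^sub>v q \<in> carrier_vec k"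
      using ec fc pq by auto
    let ?s = "?N p + ?N q"
    have le2: "2 * \<epsilon> * t \<le> 2 * (C * \<epsilon>) * t" if "t \<ge> 0" for t :: real
      using \<epsilon> that by (intro mult_right_mono) auto
    have "e *\<^sub>v p = e *\<^sub>v (p + q) - e *\<^sub>v q"
      using ec pq car by (simp add: mult_add_distrib_mat_vec[of e k k] vec_add_diff_cancel[of _ k])
    then have "?N (e *\<^sub>v p) \<le> ?N (e *\<^sub>v (p + q)) + ?N (e *\<^sub>v q)"
      using vec_l2_norm_diff_triangle[of "e *\<^sub>v (p + q)" k "0\<^sub>v k" "e *\<^sub>v q"] ec pq car
        vec_l2_norm_minus_commute[of "0\<^sub>v k" k "e *\<^sub>v q"] by simp
    moreover have "?N (e *\<^sub>v (p + q)) \<le> C * ?N (p + q)"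
      using e pq by (intro mat_op_norm_mult_vec_le'[of _ k k]) (auto simp: near_idempotent_def)
    moreover have "?N p \<le> ?N (e *\<^sub>v p) + ?N (e *\<^sub>v p - p)"
      using vec_l2_norm_le_diff[of p k "e *\<^sub>v p"] vec_l2_norm_minus_commute[of p k "e *\<^sub>v p"] car pq by simp
    ultimately have np: "?N p \<le> C * ?N (p + q) + 3 * (C * \<epsilon>) * ?N q + 2 * (C * \<epsilon>) * ?N p"
      using eq p le2[of "?N p"] by simp
    have "f *\<^sub>v q = f *\<^sub>v (q + p) - f *\<^sub>v p"
      using fc pq car by (simp add: mult_add_distrib_mat_vec[of f k k] vec_add_diff_cancel[of _ k])
    then have "f *\<^sub>v q = f *\<^sub>v (p + q) - f *\<^sub>v p" using comm_add_vec[OF pq] by simp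
    then have "?N (f *\<^sub>v q) \<le> ?N (f *\<^sub>v (p + q)) + ?N (f *\<^sub>v p)"
      using vec_l2_norm_diff_triangle[of "f *\<^sub>v (p + q)" k "0\<^sub>v k" "f *\<^sub>v p"] fc pq car
        vec_l2_norm_minus_commute[of "0\<^sub>v k" k "f *\<^sub>v p"] by simp
    moreover have "?N (f *\<^sub>v (p + q)) \<le> C * ?N (p + q)"
      using f pq by (intro mat_op_norm_mult_vec_le'[of _ k k]) (auto simp: near_idempotent_def)
    moreover have "?N q \<le> ?N (f *\<^sub>v q) + ?N (f *\<^sub>v q - q)"
      using vec_l2_norm_le_diff[of q k "f *\<^sub>v q"] vec_l2_norm_minus_commute[of q k "f *\<^sub>v q"] car pq by simp
    ultimately have nq: "?N q \<le> C * ?N (p + q) + 3 * (C * \<epsilon>) * ?N p + 2 * (C * \<epsilon>) * ?N q"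
      using fp q le2[of "?N q"] by simp
    have "?s \<le> 2 * C * ?N (p + q) + 5 * (C * \<epsilon>) * ?s" using np nq by (simp add: algebra_simps)
    moreover have "5 * (C * \<epsilon>) * ?s \<le> 1/2 * ?s" using \<epsilon> pos by (intro mult_right_mono) auto
    ultimately have s: "?s \<le> 4 * C * ?N (p + q)" by argo
    have "(e + f) *\<^sub>v (p + q) - (p + q)
        = ((e *\<^sub>v p - p) + f *\<^sub>v p) + ((f *\<^sub>v q - q) + e *\<^sub>v q)"
      unfolding add_mult_distrib_mat_vec[OF ec fc add_carrier_vec[OF pq]]
        mult_add_distrib_mat_vec[OF ec pq] mult_add_distrib_mat_vec[OF fc pq]
      using car pq by (intro vec_regroup) auto
    also have "?N \<dots> \<le> (?N (e *\<^sub>v p - p) + ?N (f *\<^sub>v p)) + (?N (f *\<^sub>v q - q) + ?N (e *\<^sub>v q))"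
      using car pq by (intro order_trans[OF vec_l2_norm_triangle[of _ k]] add_mono vec_l2_norm_triangle[of _ k]) auto
    also have "\<dots> \<le> 5 * (C * \<epsilon>) * ?s"
      using p q fp eq le2[of "?N p"] le2[of "?N q"] by (simp add: algebra_simps)
    also have "\<dots> \<le> 5 * (C * \<epsilon>) * (4 * C * ?N (p + q))" using s C \<epsilon> by (intro mult_left_mono) auto
    also have "\<dots> = 20 * (C * (C * \<epsilon>)) * ?N (p + q)" by simp
    also have "\<dots> = 20/64 * ?N (p + q)" unfolding \<epsilon>(4) by simp
    finally have le: "?N ((e + f) *\<^sub>v (p + q) - (p + q)) \<le> 20/64 * ?N (p + q)" .
    have "0 < 4 * C * ?N (p + q)" using s pos by linarith
    then have "0 < ?N (p + q)" using C by (simp add: zero_less_mult_iff)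
    then show "?N ((e + f) *\<^sub>v (hcat A B *\<^sub>v y) - hcat A B *\<^sub>v y) < 1/2 * ?N (hcat A B *\<^sub>v y)"
      unfolding yu using le by linarith
  qed
qed

section \<open>Block diagonal matrices\<close>

definition block2 :: "complex mat \<Rightarrow> complex mat \<Rightarrow> complex mat" where
  "block2 A B = four_block_mat A (0\<^sub>m (dim_row A) (dim_col B)) (0\<^sub>m (dim_row B) (dim_col A)) B"

lemma diag_block_mat_Cons: "diag_block_mat (A # As) = block2 A (diag_block_mat As)"
  by (simp add: block2_def Let_def)

lemma block2_carrier [simp, intro]:
  "A \<in> carrier_mat k k \<Longrightarrow> B \<in> carrier_mat l l \<Longrightarrow> block2 A B \<in> carrier_mat (k + l) (k + l)"
  unfolding block2_def by auto

lemma block2_mult: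
  assumes "A \<in> carrier_mat k k" "A' \<in> carrier_mat k k" "B \<in> carrier_mat l l" "B' \<in> carrier_mat l l"
  shows "block2 A B * block2 A' B' = block2 (A * A') (B * B')"
  using assms unfolding block2_def
  by (subst mult_four_block_mat[of _ k k _ l _ l _ _ k _ l]) auto

lemma block2_add:
  assumes "A \<in> carrier_mat k k" "A' \<in> carrier_mat k k" "B \<in> carrier_mat l l" "B' \<in> carrier_mat l l"
  shows "block2 A B + block2 A' B' = block2 (A + A') (B + B')"
  using assms unfolding block2_def by (intro eq_matI) auto

lemma block2_diff:
  assumes "A \<in> carrier_mat k k" "A' \<in> carrier_mat k k" "B \<in> carrier_mat l l" "B' \<in> carrier_mat l l"
  shows "block2 A B - block2 A' B' = block2 (A - A') (B - B')"
  using assms unfolding block2_def by (intro eq_matI) auto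

lemma block2_smult:
  assumes "A \<in> carrier_mat k k" "B \<in> carrier_mat l l"
  shows "c \<cdot>\<^sub>m block2 A B = block2 (c \<cdot>\<^sub>m A) (c \<cdot>\<^sub>m B)"
  using assms unfolding block2_def by (intro eq_matI) auto

lemma block2_zero: "block2 (0\<^sub>m k k) (0\<^sub>m l l) = 0\<^sub>m (k + l) (k + l)"
  unfolding block2_def by (intro eq_matI) auto

lemma block2_one: "block2 (1\<^sub>m k) (1\<^sub>m l) = 1\<^sub>m (k + l)"
  unfolding block2_def by (intro eq_matI) auto

lemma mat_adjoint_carrier [simp]: "A \<in> carrier_mat r c \<Longrightarrow> mat_adjoint A \<in> carrier_mat c r"
  unfolding mat_adjoint_def carrier_mat_def by auto

lemma mat_adjoint_index:
  "A \<in> carrier_mat r c \<Longrightarrow> i < c \<Longrightarrow> j < r \<Longrightarrow> mat_adjoint A $$ (i, j) = cnj (A $$ (j, i))"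
  unfolding mat_adjoint_def by (auto simp: mat_of_rows_def conjugate_complex_def)

lemma block2_adjoint:
  assumes "A \<in> carrier_mat k k" "B \<in> carrier_mat l l"
  shows "mat_adjoint (block2 A B) = block2 (mat_adjoint A) (mat_adjoint B)"
proof (rule eq_matI)
  fix i j
  assume ij: "i < dim_row (block2 (mat_adjoint A) (mat_adjoint B))"
    "j < dim_col (block2 (mat_adjoint A) (mat_adjoint B))"
  have car: "mat_adjoint A \<in> carrier_mat k k" "mat_adjoint B \<in> carrier_mat l l"
    using assms by auto
  have dims: "dim_row A = k" "dim_col A = k" "dim_row B = l" "dim_col B = l"
    "dim_row (mat_adjoint A) = k" "dim_col (mat_adjoint A) = k"
    "dim_row (mat_adjoint B) = l" "dim_col (mat_adjoint B) = l"
    using assms carrier_matD[OF car(1)] carrier_matD[OF car(2)] by auto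
  have "block2 (mat_adjoint A) (mat_adjoint B) \<in> carrier_mat (k + l) (k + l)" using car by auto
  then have ij': "i < k + l" "j < k + l" using ij by auto
  have "mat_adjoint (block2 A B) $$ (i, j) = cnj (block2 A B $$ (j, i))"
    using assms ij' by (intro mat_adjoint_index[of _ "k + l" "k + l"]) auto
  then show "mat_adjoint (block2 A B) $$ (i, j) = block2 (mat_adjoint A) (mat_adjoint B) $$ (i, j)"
    using ij' assms by (auto simp: block2_def dims mat_adjoint_index[of A k k] mat_adjoint_index[of B l l])
next
  have 1: "mat_adjoint (block2 A B) \<in> carrier_mat (k + l) (k + l)"
    "block2 (mat_adjoint A) (mat_adjoint B) \<in> carrier_mat (k + l) (k + l)" using assms by auto
  show "dim_row (mat_adjoint (block2 A B)) = dim_row (block2 (mat_adjoint A) (mat_adjoint B))"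
    "dim_col (mat_adjoint (block2 A B)) = dim_col (block2 (mat_adjoint A) (mat_adjoint B))"
    using 1 by (metis carrier_matD(1), metis carrier_matD(2))
qed

lemma block2_mult_vec:
  assumes "A \<in> carrier_mat k k" "B \<in> carrier_mat l l" "v \<in> carrier_vec k" "w \<in> carrier_vec l"
  shows "block2 A B *\<^sub>v (v @\<^sub>v w) = (A *\<^sub>v v) @\<^sub>v (B *\<^sub>v w)"
  using assms mult_mat_vec_split[of A k B l v w] by (simp add: block2_def)

lemma block2_norm_le:
  assumes A: "A \<in> carrier_mat k k" "mat_op_norm A \<le> b" and B: "B \<in> carrier_mat l l" "mat_op_norm B \<le> b"
  shows "mat_op_norm (block2 A B) \<le> b"
proof (rule mat_op_norm_leI[of _ "k + l" "k + l"])
  show b: "0 \<le> b" using A mat_op_norm_nonneg[OF A(1)] by simp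
  fix u :: "complex vec" assume "u \<in> carrier_vec (k + l)"
  then obtain v w where vw: "v \<in> carrier_vec k" "w \<in> carrier_vec l" "u = v @\<^sub>v w"
    using vec_first_last_append[of u k l] by (metis vec_first_carrier vec_last_carrier)
  have "(vec_l2_norm (A *\<^sub>v v))\<^sup>2 \<le> (b * vec_l2_norm v)\<^sup>2"
    using A vw by (intro power_mono mat_op_norm_mult_vec_le'[of _ k k]) auto
  moreover have "(vec_l2_norm (B *\<^sub>v w))\<^sup>2 \<le> (b * vec_l2_norm w)\<^sup>2"
    using B vw by (intro power_mono mat_op_norm_mult_vec_le'[of _ l l]) auto
  ultimately have "(vec_l2_norm (block2 A B *\<^sub>v u))\<^sup>2 \<le> (b * vec_l2_norm u)\<^sup>2"
    unfolding vw(3) block2_mult_vec[OF A(1) B(1) vw(1,2)]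
    by (simp add: vec_l2_norm_append power_mult_distrib algebra_simps)
  then show "vec_l2_norm (block2 A B *\<^sub>v u) \<le> b * vec_l2_norm u"
    by (rule power2_le_imp_le) (simp add: b)
qed (use A B in auto)

lemma near_idempotent_block2:
  assumes "near_idempotent C k a" "near_idempotent C l b"
  shows "near_idempotent C (k + l) (block2 a b)"
proof -
  note ab = assms[unfolded near_idempotent_def]
  have a: "a * a - a \<in> carrier_mat k k" and b: "b * b - b \<in> carrier_mat l l" using ab by auto
  have "block2 a b * block2 a b - block2 a b = block2 (a * a - a) (b * b - b)"
    using ab block2_diff[of "a * a" k a "b * b" l b] by (simp add: block2_mult[of _ k _ _ l])
  moreover have "mat_op_norm \<dots> \<le> max (mat_op_norm (a * a - a)) (mat_op_norm (b * b - b))"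
    by (rule block2_norm_le[OF a _ b]) auto
  ultimately show ?thesis
    unfolding near_idempotent_def using ab block2_norm_le[of a k C b l] by auto
qed

lemma vec_minus_append:
  assumes "a \<in> carrier_vec k" "c \<in> carrier_vec k" "b \<in> carrier_vec l" "d \<in> carrier_vec l"
  shows "(a @\<^sub>v b) - (c @\<^sub>v d) = (a - c) @\<^sub>v (b - d :: complex vec)"
  using assms by (intro eq_vecI) auto

lemma vec_l2_norm_0_diff: "w \<in> carrier_vec l \<Longrightarrow> vec_l2_norm (0\<^sub>v l - w) = vec_l2_norm w"
  using vec_l2_norm_minus_commute[of "0\<^sub>v l" l w] by simp

lemma vec_l2_norm_append_zero:
  "vec_l2_norm (v @\<^sub>v 0\<^sub>v l) = vec_l2_norm v" "vec_l2_norm (0\<^sub>v l @\<^sub>v v) = vec_l2_norm v"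
  by (rule power2_eq_imp_eq; simp add: vec_l2_norm_append)+

lemma rows_mult_vec:
  assumes D: "D \<in> carrier_mat (k + l) d" and v: "v \<in> carrier_vec d"
  shows "D *\<^sub>v v = (mat k d (\<lambda>(i, j). D $$ (i, j)) *\<^sub>v v) @\<^sub>v (mat l d (\<lambda>(i, j). D $$ (k + i, j)) *\<^sub>v v)"
  using assms by (intro eq_vecI) (auto simp: scalar_prod_def intro!: sum.cong)

text \<open>Squared, the coordinates \<open>w\<close> outside the block add \<open>\<parallel>w\<parallel>\<^sup>2\<close> to the left-hand side of the
  defining inequality, but only a quarter of it to the right-hand side; so they can be dropped.\<close>

lemma near_rank_block2_zero:
  assumes a: "a \<in> carrier_mat k k"
  shows "near_rank (block2 a (0\<^sub>m l l)) = near_rank a" and "near_rank (block2 (0\<^sub>m l l) a) = near_rank a"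
proof -
  let ?N = vec_l2_norm
  let ?Z = "0\<^sub>m l l :: complex mat"
  have Z: "?Z \<in> carrier_mat l l" by simp
  have bc: "block2 a ?Z \<in> carrier_mat (k + l) (k + l)" "block2 ?Z a \<in> carrier_mat (l + k) (l + k)"
    using a by auto
  \<comment> \<open>The part \<open>r\<close> outside the block can be cancelled since \<open>1/2 < 1\<close>.\<close>
  have sq: "p < 1/2 * q" if "p\<^sup>2 + r\<^sup>2 < (1/2)\<^sup>2 * (q\<^sup>2 + r\<^sup>2)" "p \<ge> 0" "q \<ge> 0" for p q r :: real
  proof -
    have "(1/2)\<^sup>2 * r\<^sup>2 \<le> 1 * r\<^sup>2" by (intro mult_right_mono) (auto simp: power2_eq_square)
    then have "p\<^sup>2 < (1/2)\<^sup>2 * q\<^sup>2" using that(1) unfolding distrib_left by linarith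
    then have "p\<^sup>2 < (1/2 * q)\<^sup>2" unfolding power_mult_distrib .
    then show ?thesis using that by (intro power2_less_imp_less[of p]) auto
  qed
  obtain A where A: "A \<in> carrier_mat k (near_rank a)"
    and lt: "\<And>v. v \<in> carrier_vec (near_rank a) \<Longrightarrow> v \<noteq> 0\<^sub>v (near_rank a) \<Longrightarrow>
      ?N (a *\<^sub>v (A *\<^sub>v v) - A *\<^sub>v v) < 1/2 * ?N (A *\<^sub>v v)"
    using almost_fixed_dim_near_rank[of a] a unfolding almost_fixed_dim_def by auto
  let ?d = "near_rank (block2 a ?Z)" and ?d' = "near_rank (block2 ?Z a)"
  obtain D where D: "D \<in> carrier_mat (k + l) ?d"
    and D': "\<And>v. v \<in> carrier_vec ?d \<Longrightarrow> v \<noteq> 0\<^sub>v ?d \<Longrightarrow>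
      ?N (block2 a ?Z *\<^sub>v (D *\<^sub>v v) - D *\<^sub>v v) < 1/2 * ?N (D *\<^sub>v v)"
    using almost_fixed_dim_near_rank[of "block2 a ?Z"] bc(1) unfolding almost_fixed_dim_def
    by (metis carrier_matD(1))
  obtain E where E: "E \<in> carrier_mat (l + k) ?d'"
    and E': "\<And>v. v \<in> carrier_vec ?d' \<Longrightarrow> v \<noteq> 0\<^sub>v ?d' \<Longrightarrow>
      ?N (block2 ?Z a *\<^sub>v (E *\<^sub>v v) - E *\<^sub>v v) < 1/2 * ?N (E *\<^sub>v v)"
    using almost_fixed_dim_near_rank[of "block2 ?Z a"] bc(2) unfolding almost_fixed_dim_def
    by (metis carrier_matD(1))
  have "near_rank a \<le> ?d"
  proof (rule near_rank_geI[OF bc(1)])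
    let ?B = "mat (k + l) (near_rank a) (\<lambda>(i, j). if i < k then A $$ (i, j) else 0)"
    show "?B \<in> carrier_mat (k + l) (near_rank a)" by simp
    fix v :: "complex vec" assume v: "v \<in> carrier_vec (near_rank a)" "v \<noteq> 0\<^sub>v (near_rank a)"
    have B: "?B *\<^sub>v v = (A *\<^sub>v v) @\<^sub>v 0\<^sub>v l"
      using v A by (intro eq_vecI) (auto simp: scalar_prod_def intro!: sum.cong)
    have Av: "A *\<^sub>v v \<in> carrier_vec k" using A v by auto
    have eq: "block2 a ?Z *\<^sub>v (?B *\<^sub>v v) - ?B *\<^sub>v v = (a *\<^sub>v (A *\<^sub>v v) - A *\<^sub>v v) @\<^sub>v (0\<^sub>v l - 0\<^sub>v l)"
      unfolding B block2_mult_vec[OF a Z Av zero_carrier_vec] zero_mult_mat_vec[OF zero_carrier_vec]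
      using a Av by (intro vec_minus_append[of _ k _ _ l] vec_minus_append[of _ l _ _ k]) auto
    show "?N (block2 a ?Z *\<^sub>v (?B *\<^sub>v v) - ?B *\<^sub>v v) < 1/2 * ?N (?B *\<^sub>v v)"
      unfolding eq unfolding B using lt[OF v] by (simp add: vec_l2_norm_append_zero)
  qed
  moreover have "?d \<le> near_rank a"
  proof (rule near_rank_geI[OF a])
    let ?A = "mat k ?d (\<lambda>(i, j). D $$ (i, j))" and ?B = "mat l ?d (\<lambda>(i, j). D $$ (k + i, j))"
    show "?A \<in> carrier_mat k ?d" by simp
    fix v :: "complex vec" assume v: "v \<in> carrier_vec ?d" "v \<noteq> 0\<^sub>v ?d"
    let ?p = "?A *\<^sub>v v" and ?q = "?B *\<^sub>v v"
    have c: "?p \<in> carrier_vec k" "?q \<in> carrier_vec l" by (auto intro!: carrier_vecI)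
    have Dv: "D *\<^sub>v v = ?p @\<^sub>v ?q" using rows_mult_vec[OF D v(1)] .
    have eq: "block2 a ?Z *\<^sub>v (D *\<^sub>v v) - D *\<^sub>v v = (a *\<^sub>v ?p - ?p) @\<^sub>v (0\<^sub>v l - ?q)"
      unfolding Dv block2_mult_vec[OF a Z c] zero_mult_mat_vec[OF c(2)]
      using a c by (intro vec_minus_append[of _ k _ _ l] vec_minus_append[of _ l _ _ k]) auto
    have "(?N ((a *\<^sub>v ?p - ?p) @\<^sub>v (0\<^sub>v l - ?q)))\<^sup>2 < (1/2 * ?N (?p @\<^sub>v ?q))\<^sup>2"
      using D'[OF v] unfolding eq unfolding Dv by (intro power_strict_mono) auto
    then have "(?N (a *\<^sub>v ?p - ?p))\<^sup>2 + (?N ?q)\<^sup>2 < (1/2)\<^sup>2 * ((?N ?p)\<^sup>2 + (?N ?q)\<^sup>2)"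
      unfolding power_mult_distrib vec_l2_norm_append vec_l2_norm_0_diff[OF c(2)] .
    then show "?N (a *\<^sub>v ?p - ?p) < 1/2 * ?N ?p" by (rule sq) auto
  qed
  ultimately show "?d = near_rank a" by simp
  have "near_rank a \<le> ?d'"
  proof (rule near_rank_geI[OF bc(2)])
    let ?B = "mat (l + k) (near_rank a) (\<lambda>(i, j). if i < l then 0 else A $$ (i - l, j))"
    show "?B \<in> carrier_mat (l + k) (near_rank a)" by simp
    fix v :: "complex vec" assume v: "v \<in> carrier_vec (near_rank a)" "v \<noteq> 0\<^sub>v (near_rank a)"
    have B: "?B *\<^sub>v v = 0\<^sub>v l @\<^sub>v (A *\<^sub>v v)"
      using v A by (intro eq_vecI) (auto simp: scalar_prod_def intro!: sum.cong)
    have Av: "A *\<^sub>v v \<in> carrier_vec k" using A v by auto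
    have eq: "block2 ?Z a *\<^sub>v (?B *\<^sub>v v) - ?B *\<^sub>v v = (0\<^sub>v l - 0\<^sub>v l) @\<^sub>v (a *\<^sub>v (A *\<^sub>v v) - A *\<^sub>v v)"
      unfolding B block2_mult_vec[OF Z a zero_carrier_vec Av] zero_mult_mat_vec[OF zero_carrier_vec]
      using a Av by (intro vec_minus_append[of _ k _ _ l] vec_minus_append[of _ l _ _ k]) auto
    show "?N (block2 ?Z a *\<^sub>v (?B *\<^sub>v v) - ?B *\<^sub>v v) < 1/2 * ?N (?B *\<^sub>v v)"
      unfolding eq unfolding B using lt[OF v] by (simp add: vec_l2_norm_append_zero)
  qed
  moreover have "?d' \<le> near_rank a"
  proof (rule near_rank_geI[OF a])
    let ?B = "mat l ?d' (\<lambda>(i, j). E $$ (i, j))" and ?A = "mat k ?d' (\<lambda>(i, j). E $$ (l + i, j))"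
    show "?A \<in> carrier_mat k ?d'" by simp
    fix v :: "complex vec" assume v: "v \<in> carrier_vec ?d'" "v \<noteq> 0\<^sub>v ?d'"
    let ?p = "?A *\<^sub>v v" and ?q = "?B *\<^sub>v v"
    have c: "?p \<in> carrier_vec k" "?q \<in> carrier_vec l" by (auto intro!: carrier_vecI)
    have Ev: "E *\<^sub>v v = ?q @\<^sub>v ?p" using rows_mult_vec[OF E v(1)] .
    have eq: "block2 ?Z a *\<^sub>v (E *\<^sub>v v) - E *\<^sub>v v = (0\<^sub>v l - ?q) @\<^sub>v (a *\<^sub>v ?p - ?p)"
      unfolding Ev block2_mult_vec[OF Z a c(2,1)] zero_mult_mat_vec[OF c(2)]
      using a c by (intro vec_minus_append[of _ k _ _ l] vec_minus_append[of _ l _ _ k]) auto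
    have "(?N ((0\<^sub>v l - ?q) @\<^sub>v (a *\<^sub>v ?p - ?p)))\<^sup>2 < (1/2 * ?N (?q @\<^sub>v ?p))\<^sup>2"
      using E'[OF v] unfolding eq unfolding Ev by (intro power_strict_mono) auto
    then have "(?N ?q)\<^sup>2 + (?N (a *\<^sub>v ?p - ?p))\<^sup>2 < (1/2)\<^sup>2 * ((?N ?q)\<^sup>2 + (?N ?p)\<^sup>2)"
      unfolding power_mult_distrib vec_l2_norm_append vec_l2_norm_0_diff[OF c(2)] .
    then have "(?N (a *\<^sub>v ?p - ?p))\<^sup>2 + (?N ?q)\<^sup>2 < (1/2)\<^sup>2 * ((?N ?p)\<^sup>2 + (?N ?q)\<^sup>2)"
      by (simp only: add.commute)
    then show "?N (a *\<^sub>v ?p - ?p) < 1/2 * ?N ?p" by (rule sq) auto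
  qed
  ultimately show "?d' = near_rank a" by simp
qed

lemma near_idempotent_zero: "C \<ge> 1 \<Longrightarrow> near_idempotent C k (0\<^sub>m k k)"
  by (auto simp: near_idempotent_def minus_r_inv_mat[of _ k k])

text \<open>Both inequalities between the rank of a sum and the sum of the ranks apply, as the two summands
  annihilate each other.  Hypotheses and constants are the same for the blocks and for the whole
  matrix, so the equation can be iterated over any number of blocks.\<close>

lemma near_rank_block2:
  assumes a: "near_idempotent C k a" and b: "near_idempotent C l b" and C: "C \<ge> 1"
  shows "near_rank (block2 a b) = near_rank a + near_rank b"
proof -
  have c: "a \<in> carrier_mat k k" "b \<in> carrier_mat l l" using a b by (auto simp: near_idempotent_def)
  let ?a = "block2 a (0\<^sub>m l l)" and ?b = "block2 (0\<^sub>m k k) b"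
  have sum: "block2 a b = ?a + ?b" using c by (simp add: block2_add[of _ k _ _ l])
  have ni: "near_idempotent C (k + l) ?a" "near_idempotent C (k + l) ?b"
    using a b C by (auto intro!: near_idempotent_block2 near_idempotent_zero)
  have "?a * ?b = 0\<^sub>m (k + l) (k + l)" "?b * ?a = 0\<^sub>m (k + l) (k + l)"
    using c by (simp_all add: block2_mult[of _ k _ _ l] block2_zero)
  then have "near_rank (?a + ?b) = near_rank ?a + near_rank ?b"
    using C by (intro antisym near_rank_subadditive[OF ni C] near_rank_superadditive[OF ni C]) auto
  then show ?thesis using near_rank_block2_zero[OF c(1), of l] near_rank_block2_zero[OF c(2), of k] sum by simp
qed

subsection \<open>Blocks spelled by a word\<close>

context
  fixes F :: "'i \<Rightarrow> complex mat" and k :: nat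
  assumes F: "\<And>i. F i \<in> carrier_mat k k"
begin

lemma blocks_carrier: "diag_block_mat (map F w) \<in> carrier_mat (length w * k) (length w * k)"
  using F by (induction w) (auto simp: diag_block_mat_Cons simp del: diag_block_mat.simps(2))

lemma blocks_smult: "diag_block_mat (map (\<lambda>i. c \<cdot>\<^sub>m F i) w) = c \<cdot>\<^sub>m diag_block_mat (map F w)"
proof (induction w)
  case Nil
  show ?case by (intro eq_matI) auto
next
  case (Cons i w)
  then show ?case using block2_smult[OF F blocks_carrier, of c i w]
    by (simp add: diag_block_mat_Cons del: diag_block_mat.simps(2))
qed

lemma blocks_adjoint: "diag_block_mat (map (\<lambda>i. mat_adjoint (F i)) w) = mat_adjoint (diag_block_mat (map F w))"
proof (induction w)
  case Nil
  show ?case by (intro eq_matI) (auto simp: mat_adjoint_def)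
next
  case (Cons i w)
  then show ?case using block2_adjoint[OF F blocks_carrier, of i w] by (simp add: diag_block_mat_Cons del: diag_block_mat.simps(2))
qed

lemma blocks_norm_le:
  assumes "\<And>i. i \<in> set w \<Longrightarrow> mat_op_norm (F i) \<le> b" "b \<ge> 0"
  shows "mat_op_norm (diag_block_mat (map F w)) \<le> b"
  using assms(1)
proof (induction w)
  case (Cons i w)
  then show ?case using block2_norm_le[OF F _ blocks_carrier, of i b w]
    by (simp add: diag_block_mat_Cons del: diag_block_mat.simps(2))
qed (use assms in auto)

lemma near_idempotent_blocks:
  assumes "\<And>i. i \<in> set w \<Longrightarrow> near_idempotent C k (F i)" "C \<ge> 1"
  shows "near_idempotent C (length w * k) (diag_block_mat (map F w))"
  using assms(1)
proof (induction w)
  case (Cons i w)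
  then show ?case using near_idempotent_block2[of C k "F i" "length w * k" "diag_block_mat (map F w)"]
    by (simp add: diag_block_mat_Cons del: diag_block_mat.simps(2))
qed (use near_idempotent_zero[OF assms(2), of 0] in auto)

lemma near_rank_blocks:
  assumes "\<And>i. i \<in> set w \<Longrightarrow> near_idempotent C k (F i)" and C: "C \<ge> 1"
  shows "near_rank (diag_block_mat (map F w)) = (\<Sum>i\<leftarrow>w. near_rank (F i))"
  using assms(1)
proof (induction w)
  case Nil
  show ?case using near_rank_le_dim[of "0\<^sub>m 0 0"] by simp
next
  case (Cons i w)
  then have "near_idempotent C (length w * k) (diag_block_mat (map F w))"
    by (intro near_idempotent_blocks C) auto
  then show ?case using Cons near_rank_block2[of C k "F i" "length w * k" "diag_block_mat (map F w)"] C
    by (simp add: diag_block_mat_Cons del: diag_block_mat.simps(2))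
qed

end

lemma blocks_mult:
  fixes F G :: "'i \<Rightarrow> complex mat"
  assumes "\<And>i. F i \<in> carrier_mat k k" "\<And>i. G i \<in> carrier_mat k k"
  shows "diag_block_mat (map (\<lambda>i. F i * G i) w) = diag_block_mat (map F w) * diag_block_mat (map G w)"
proof (induction w)
  case (Cons i w)
  then show ?case
    using block2_mult[OF assms blocks_carrier[of F k w] blocks_carrier[of G k w], of i i] assms
    by (simp add: diag_block_mat_Cons del: diag_block_mat.simps(2))
qed (auto intro!: eq_matI)

lemma blocks_add:
  fixes F G :: "'i \<Rightarrow> complex mat"
  assumes "\<And>i. F i \<in> carrier_mat k k" "\<And>i. G i \<in> carrier_mat k k"
  shows "diag_block_mat (map (\<lambda>i. F i + G i) w) = diag_block_mat (map F w) + diag_block_mat (map G w)"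
proof (induction w)
  case (Cons i w)
  then show ?case
    using block2_add[OF assms blocks_carrier[of F k w] blocks_carrier[of G k w], of i i] assms
    by (simp add: diag_block_mat_Cons del: diag_block_mat.simps(2))
qed (auto intro!: eq_matI)

lemma blocks_one: "diag_block_mat (map (\<lambda>i. 1\<^sub>m k :: complex mat) w) = 1\<^sub>m (length w * k)"
  by (induction w) (auto simp: diag_block_mat_Cons block2_one intro!: eq_matI simp del: diag_block_mat.simps(2))

lemma blocks_zero: "diag_block_mat (map (\<lambda>i. 0\<^sub>m k k :: complex mat) w) = 0\<^sub>m (length w * k) (length w * k)"
  by (induction w) (auto simp: diag_block_mat_Cons block2_zero intro!: eq_matI simp del: diag_block_mat.simps(2))

section \<open>Multiples of idempotents in a ring\<close>

definition idempotent_elt :: "('a, 'b) ring_scheme \<Rightarrow> 'a \<Rightarrow> bool" where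
  "idempotent_elt R e \<longleftrightarrow> e \<in> carrier R \<and> e \<otimes>\<^bsub>R\<^esub> e = e"

definition equivalent_elts :: "('a, 'b) ring_scheme \<Rightarrow> 'a \<Rightarrow> 'a \<Rightarrow> bool" where
  "equivalent_elts R e f \<longleftrightarrow> (\<exists>x\<in>carrier R. \<exists>y\<in>carrier R. x \<otimes>\<^bsub>R\<^esub> y = e \<and> y \<otimes>\<^bsub>R\<^esub> x = f)"

text \<open>\<open>multiple R f n e\<close> means that \<open>e\<close> is a sum of \<open>n\<close> mutually orthogonal idempotents, all
  Murray--von Neumann equivalent to \<open>f\<close>; this gives \<open>[e] = n [f]\<close> in \<open>K\<^sub>0\<close>.\<close>

inductive multiple :: "('a, 'b) ring_scheme \<Rightarrow> 'a \<Rightarrow> nat \<Rightarrow> 'a \<Rightarrow> bool" for R f where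
  one: "idempotent_elt R f \<Longrightarrow> idempotent_elt R e \<Longrightarrow> equivalent_elts R e f \<Longrightarrow> multiple R f 1 e"
| add: "multiple R f n e \<Longrightarrow> idempotent_elt R e' \<Longrightarrow> equivalent_elts R e' f \<Longrightarrow>
    e' \<otimes>\<^bsub>R\<^esub> e = \<zero>\<^bsub>R\<^esub> \<Longrightarrow> e \<otimes>\<^bsub>R\<^esub> e' = \<zero>\<^bsub>R\<^esub> \<Longrightarrow>
    idempotent_elt R (e' \<oplus>\<^bsub>R\<^esub> e) \<Longrightarrow> multiple R f (Suc n) (e' \<oplus>\<^bsub>R\<^esub> e)"

text \<open>Some nonzero idempotent \<open>e\<close> is infinitesimal, in the sense that arbitrarily many orthogonal copies
  of it fit into \<open>R\<close>, and its class in \<open>K\<^sub>0\<close> is divisible by every power of \<open>p\<close>.  Only the ring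
  structure enters, so this is an isomorphism invariant.\<close>

definition divisible_infinitesimal :: "('a, 'b) ring_scheme \<Rightarrow> nat \<Rightarrow> bool" where
  "divisible_infinitesimal R p \<longleftrightarrow>
     (\<exists>e. idempotent_elt R e \<and> e \<noteq> \<zero>\<^bsub>R\<^esub> \<and> (\<forall>n\<ge>1. \<exists>d. multiple R e n d) \<and>
        (\<forall>k. \<exists>f. multiple R f (p ^ k) e))"

lemma multiple_idempotent: "multiple R f n e \<Longrightarrow> idempotent_elt R e \<and> idempotent_elt R f"
  by (induction rule: multiple.induct) auto

lemma multiple_map:
  assumes "multiple R f n e"
    and car: "\<And>x. x \<in> carrier R \<Longrightarrow> h x \<in> carrier S"
    and add: "\<And>x y. x \<in> carrier R \<Longrightarrow> y \<in> carrier R \<Longrightarrow> h (x \<oplus>\<^bsub>R\<^esub> y) = h x \<oplus>\<^bsub>S\<^esub> h y"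
    and mult: "\<And>x y. x \<in> carrier R \<Longrightarrow> y \<in> carrier R \<Longrightarrow> h (x \<otimes>\<^bsub>R\<^esub> y) = h x \<otimes>\<^bsub>S\<^esub> h y"
    and zero: "h \<zero>\<^bsub>R\<^esub> = \<zero>\<^bsub>S\<^esub>"
  shows "multiple S (h f) n (h e)"
proof -
  have id: "idempotent_elt S (h x)" if "idempotent_elt R x" for x
    using that car mult[of x x] by (auto simp: idempotent_elt_def)
  have eq: "equivalent_elts S (h x) (h y)" if "equivalent_elts R x y" for x y
    using that unfolding equivalent_elts_def by (metis car mult)
  show ?thesis using assms(1)
  proof (induction rule: multiple.induct)
    case (one e)
    then show ?case by (intro multiple.one id eq)
  next
    case (add n e e')
    have c: "e \<in> carrier R" "e' \<in> carrier R"
      using add multiple_idempotent[OF add(1)] by (auto simp: idempotent_elt_def)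
    have "multiple S (h f) (Suc n) (h e' \<oplus>\<^bsub>S\<^esub> h e)"
    proof (rule multiple.add)
      show "h e' \<otimes>\<^bsub>S\<^esub> h e = \<zero>\<^bsub>S\<^esub>" "h e \<otimes>\<^bsub>S\<^esub> h e' = \<zero>\<^bsub>S\<^esub>"
        using add c mult[of e e'] mult[of e' e] zero by auto
      show "idempotent_elt S (h e' \<oplus>\<^bsub>S\<^esub> h e)" using id[OF add(6)] assms(3)[OF c(2,1)] by simp
    qed (use add id eq in auto)
    then show ?case using assms(3)[OF c(2,1)] by simp
  qed
qed

lemma divisible_infinitesimal_iso:
  assumes "divisible_infinitesimal R p"
    and bij: "inj_on h (carrier R)"
    and car: "\<And>x. x \<in> carrier R \<Longrightarrow> h x \<in> carrier S"
    and add: "\<And>x y. x \<in> carrier R \<Longrightarrow> y \<in> carrier R \<Longrightarrow> h (x \<oplus>\<^bsub>R\<^esub> y) = h x \<oplus>\<^bsub>S\<^esub> h y"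
    and mult: "\<And>x y. x \<in> carrier R \<Longrightarrow> y \<in> carrier R \<Longrightarrow> h (x \<otimes>\<^bsub>R\<^esub> y) = h x \<otimes>\<^bsub>S\<^esub> h y"
    and zero: "h \<zero>\<^bsub>R\<^esub> = \<zero>\<^bsub>S\<^esub>" "\<zero>\<^bsub>R\<^esub> \<in> carrier R"
  shows "divisible_infinitesimal S p"
proof -
  obtain e where e: "idempotent_elt R e" "e \<noteq> \<zero>\<^bsub>R\<^esub>" "\<forall>n\<ge>1. \<exists>d. multiple R e n d" "\<forall>k. \<exists>f. multiple R f (p ^ k) e"
    using assms(1) unfolding divisible_infinitesimal_def by blast
  have map: "multiple S (h f) n (h e)" if "multiple R f n e" for f n e
    using multiple_map[OF that car add mult zero(1)] by blast
  have "idempotent_elt S (h e)" using e(1) car mult[of e e] by (auto simp: idempotent_elt_def)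
  moreover have "h e \<noteq> \<zero>\<^bsub>S\<^esub>"
    using e(1,2) bij zero inj_onD[OF bij, of e "\<zero>\<^bsub>R\<^esub>"] by (auto simp: idempotent_elt_def)
  moreover have "\<forall>n\<ge>1. \<exists>d. multiple S (h e) n d" "\<forall>k. \<exists>f. multiple S f (p ^ k) (h e)"
    using e(3,4) map by blast+
  ultimately show ?thesis unfolding divisible_infinitesimal_def by blast
qed

section \<open>Computing in a direct limit\<close>

locale normed_ring_system =
  fixes A :: "nat \<Rightarrow> 'a star_algebra" and \<phi> :: "nat \<Rightarrow> 'a \<Rightarrow> 'a"
  assumes ring: "ring (A r)"
    and norm_nonneg: "x \<in> carrier (A r) \<Longrightarrow> 0 \<le> cnorm (A r) x"
    and norm_zero: "cnorm (A r) \<zero>\<^bsub>A r\<^esub> = 0"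
    and norm_uminus: "x \<in> carrier (A r) \<Longrightarrow> cnorm (A r) (\<ominus>\<^bsub>A r\<^esub> x) = cnorm (A r) x"
    and norm_add: "x \<in> carrier (A r) \<Longrightarrow> y \<in> carrier (A r) \<Longrightarrow>
      cnorm (A r) (x \<oplus>\<^bsub>A r\<^esub> y) \<le> cnorm (A r) x + cnorm (A r) y"
    and norm_mult: "x \<in> carrier (A r) \<Longrightarrow> y \<in> carrier (A r) \<Longrightarrow>
      cnorm (A r) (x \<otimes>\<^bsub>A r\<^esub> y) \<le> cnorm (A r) x * cnorm (A r) y"
    and hom_carrier: "x \<in> carrier (A r) \<Longrightarrow> \<phi> r x \<in> carrier (A (Suc r))"
    and hom_add: "x \<in> carrier (A r) \<Longrightarrow> y \<in> carrier (A r) \<Longrightarrow>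
      \<phi> r (x \<oplus>\<^bsub>A r\<^esub> y) = \<phi> r x \<oplus>\<^bsub>A (Suc r)\<^esub> \<phi> r y"
    and hom_mult: "x \<in> carrier (A r) \<Longrightarrow> y \<in> carrier (A r) \<Longrightarrow>
      \<phi> r (x \<otimes>\<^bsub>A r\<^esub> y) = \<phi> r x \<otimes>\<^bsub>A (Suc r)\<^esub> \<phi> r y"
    and hom_norm: "x \<in> carrier (A r) \<Longrightarrow> cnorm (A (Suc r)) (\<phi> r x) \<le> cnorm (A r) x"
begin

abbreviation gap :: "nat \<Rightarrow> 'a \<Rightarrow> 'a \<Rightarrow> real" where
  "gap r x y \<equiv> cnorm (A r) (x \<ominus>\<^bsub>A r\<^esub> y)"

abbreviation limit_class :: "(nat \<Rightarrow> 'a) \<Rightarrow> (nat \<Rightarrow> 'a) set" where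
  "limit_class a \<equiv> limit_rel A \<phi> `` {a}"

abbreviation add_seq :: "(nat \<Rightarrow> 'a) \<Rightarrow> (nat \<Rightarrow> 'a) \<Rightarrow> nat \<Rightarrow> 'a" where
  "add_seq a b \<equiv> (\<lambda>r. a r \<oplus>\<^bsub>A r\<^esub> b r)"

abbreviation mult_seq :: "(nat \<Rightarrow> 'a) \<Rightarrow> (nat \<Rightarrow> 'a) \<Rightarrow> nat \<Rightarrow> 'a" where
  "mult_seq a b \<equiv> (\<lambda>r. a r \<otimes>\<^bsub>A r\<^esub> b r)"

abbreviation zero_seq :: "nat \<Rightarrow> 'a" where
  "zero_seq \<equiv> (\<lambda>r. \<zero>\<^bsub>A r\<^esub>)"

lemma closed [simp, intro]:
  "x \<in> carrier (A r) \<Longrightarrow> y \<in> carrier (A r) \<Longrightarrow> x \<oplus>\<^bsub>A r\<^esub> y \<in> carrier (A r)"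
  "x \<in> carrier (A r) \<Longrightarrow> y \<in> carrier (A r) \<Longrightarrow> x \<otimes>\<^bsub>A r\<^esub> y \<in> carrier (A r)"
  "x \<in> carrier (A r) \<Longrightarrow> y \<in> carrier (A r) \<Longrightarrow> x \<ominus>\<^bsub>A r\<^esub> y \<in> carrier (A r)"
  "x \<in> carrier (A r) \<Longrightarrow> \<ominus>\<^bsub>A r\<^esub> x \<in> carrier (A r)"
  "\<zero>\<^bsub>A r\<^esub> \<in> carrier (A r)"
proof -
  interpret ring "A r" by (rule ring)
  show "x \<in> carrier (A r) \<Longrightarrow> y \<in> carrier (A r) \<Longrightarrow> x \<oplus>\<^bsub>A r\<^esub> y \<in> carrier (A r)"
  "x \<in> carrier (A r) \<Longrightarrow> y \<in> carrier (A r) \<Longrightarrow> x \<otimes>\<^bsub>A r\<^esub> y \<in> carrier (A r)"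
  "x \<in> carrier (A r) \<Longrightarrow> y \<in> carrier (A r) \<Longrightarrow> x \<ominus>\<^bsub>A r\<^esub> y \<in> carrier (A r)"
  "x \<in> carrier (A r) \<Longrightarrow> \<ominus>\<^bsub>A r\<^esub> x \<in> carrier (A r)"
  "\<zero>\<^bsub>A r\<^esub> \<in> carrier (A r)" by auto
qed

lemma gap_refl: "x \<in> carrier (A r) \<Longrightarrow> gap r x x = 0"
proof -
  interpret ring "A r" by (rule ring)
  show "x \<in> carrier (A r) \<Longrightarrow> gap r x x = 0" using norm_zero by (simp add: r_neg minus_eq)
qed

lemma gap_sym:
  assumes "x \<in> carrier (A r)" "y \<in> carrier (A r)"
  shows "gap r x y = gap r y x"
proof -
  interpret ring "A r" by (rule ring)
  have "y \<ominus>\<^bsub>A r\<^esub> x = \<ominus>\<^bsub>A r\<^esub> (x \<ominus>\<^bsub>A r\<^esub> y)" using assms by algebra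
  then show ?thesis using norm_uminus[of "x \<ominus>\<^bsub>A r\<^esub> y" r] assms by simp
qed

lemma gap_triangle:
  assumes "x \<in> carrier (A r)" "y \<in> carrier (A r)" "z \<in> carrier (A r)"
  shows "gap r x z \<le> gap r x y + gap r y z"
proof -
  interpret ring "A r" by (rule ring)
  have "x \<ominus>\<^bsub>A r\<^esub> z = (x \<ominus>\<^bsub>A r\<^esub> y) \<oplus>\<^bsub>A r\<^esub> (y \<ominus>\<^bsub>A r\<^esub> z)" using assms by algebra
  then show ?thesis using norm_add[of "x \<ominus>\<^bsub>A r\<^esub> y" r "y \<ominus>\<^bsub>A r\<^esub> z"] assms by simp
qed

lemma norm_le_gap:
  assumes "x \<in> carrier (A r)" "y \<in> carrier (A r)"
  shows "cnorm (A r) x \<le> cnorm (A r) y + gap r x y"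
proof -
  interpret ring "A r" by (rule ring)
  have "x = y \<oplus>\<^bsub>A r\<^esub> (x \<ominus>\<^bsub>A r\<^esub> y)" using assms by algebra
  then show ?thesis using norm_add[of y r "x \<ominus>\<^bsub>A r\<^esub> y"] assms by simp
qed

lemma gap_add:
  assumes "x \<in> carrier (A r)" "y \<in> carrier (A r)" "x' \<in> carrier (A r)" "y' \<in> carrier (A r)"
  shows "gap r (x \<oplus>\<^bsub>A r\<^esub> y) (x' \<oplus>\<^bsub>A r\<^esub> y') \<le> gap r x x' + gap r y y'"
proof -
  interpret ring "A r" by (rule ring)
  have "(x \<oplus>\<^bsub>A r\<^esub> y) \<ominus>\<^bsub>A r\<^esub> (x' \<oplus>\<^bsub>A r\<^esub> y') = (x \<ominus>\<^bsub>A r\<^esub> x') \<oplus>\<^bsub>A r\<^esub> (y \<ominus>\<^bsub>A r\<^esub> y')"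
    using assms by algebra
  then show ?thesis using norm_add[of "x \<ominus>\<^bsub>A r\<^esub> x'" r "y \<ominus>\<^bsub>A r\<^esub> y'"] assms by simp
qed

lemma gap_mult:
  assumes "x \<in> carrier (A r)" "y \<in> carrier (A r)" "x' \<in> carrier (A r)" "y' \<in> carrier (A r)"
  shows "gap r (x \<otimes>\<^bsub>A r\<^esub> y) (x' \<otimes>\<^bsub>A r\<^esub> y') \<le> cnorm (A r) x * gap r y y' + gap r x x' * cnorm (A r) y'"
proof -
  interpret ring "A r" by (rule ring)
  have "(x \<otimes>\<^bsub>A r\<^esub> y) \<ominus>\<^bsub>A r\<^esub> (x' \<otimes>\<^bsub>A r\<^esub> y')
      = (x \<otimes>\<^bsub>A r\<^esub> (y \<ominus>\<^bsub>A r\<^esub> y')) \<oplus>\<^bsub>A r\<^esub> ((x \<ominus>\<^bsub>A r\<^esub> x') \<otimes>\<^bsub>A r\<^esub> y')"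
    using assms by algebra
  then have "gap r (x \<otimes>\<^bsub>A r\<^esub> y) (x' \<otimes>\<^bsub>A r\<^esub> y') \<le>
      cnorm (A r) (x \<otimes>\<^bsub>A r\<^esub> (y \<ominus>\<^bsub>A r\<^esub> y')) + cnorm (A r) ((x \<ominus>\<^bsub>A r\<^esub> x') \<otimes>\<^bsub>A r\<^esub> y')"
    using norm_add assms by simp
  also have "\<dots> \<le> cnorm (A r) x * gap r y y' + gap r x x' * cnorm (A r) y'"
    using assms by (intro add_mono norm_mult) auto
  finally show ?thesis .
qed

lemma gap_hom:
  assumes "x \<in> carrier (A r)" "y \<in> carrier (A r)"
  shows "gap (Suc r) (\<phi> r x) (\<phi> r y) \<le> gap r x y"
proof -
  interpret R: ring "A r" by (rule ring)
  interpret S: ring "A (Suc r)" by (rule ring)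
  have "\<phi> r x = \<phi> r ((x \<ominus>\<^bsub>A r\<^esub> y) \<oplus>\<^bsub>A r\<^esub> y)" using assms by (intro arg_cong[of _ _ "\<phi> r"]) algebra
  also have "\<dots> = \<phi> r (x \<ominus>\<^bsub>A r\<^esub> y) \<oplus>\<^bsub>A (Suc r)\<^esub> \<phi> r y" using assms by (intro hom_add) auto
  finally have eq: "\<phi> r x = \<phi> r (x \<ominus>\<^bsub>A r\<^esub> y) \<oplus>\<^bsub>A (Suc r)\<^esub> \<phi> r y" .
  have "\<phi> r (x \<ominus>\<^bsub>A r\<^esub> y) \<in> carrier (A (Suc r))" "\<phi> r y \<in> carrier (A (Suc r))"
    using assms by (auto intro: hom_carrier)
  then have "\<phi> r x \<ominus>\<^bsub>A (Suc r)\<^esub> \<phi> r y = \<phi> r (x \<ominus>\<^bsub>A r\<^esub> y)" unfolding eq by algebra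
  then show ?thesis using hom_norm[of "x \<ominus>\<^bsub>A r\<^esub> y" r] assms by simp
qed

lemma hom_zero: "\<phi> r \<zero>\<^bsub>A r\<^esub> = \<zero>\<^bsub>A (Suc r)\<^esub>"
proof -
  interpret R: ring "A r" by (rule ring)
  interpret S: ring "A (Suc r)" by (rule ring)
  have "\<phi> r \<zero>\<^bsub>A r\<^esub> \<oplus>\<^bsub>A (Suc r)\<^esub> \<phi> r \<zero>\<^bsub>A r\<^esub> = \<phi> r \<zero>\<^bsub>A r\<^esub>"
    using hom_add[of "\<zero>\<^bsub>A r\<^esub>" r "\<zero>\<^bsub>A r\<^esub>"] by simp
  then show ?thesis using hom_carrier[of "\<zero>\<^bsub>A r\<^esub>" r] by (simp add: S.add.l_cancel_one')
qed

subsection \<open>Bounded, coherent and limit sequences\<close>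

lemma bounded_seqs_iff:
  "a \<in> bounded_seqs A \<longleftrightarrow> (\<forall>r. a r \<in> carrier (A r)) \<and> (\<exists>M\<ge>1. \<forall>r. cnorm (A r) (a r) \<le> M)"
proof
  assume "a \<in> bounded_seqs A"
  then obtain M where "\<forall>r. a r \<in> carrier (A r)" "\<forall>r. cnorm (A r) (a r) \<le> M"
    unfolding bounded_seqs_def bdd_above_def by blast
  then show "(\<forall>r. a r \<in> carrier (A r)) \<and> (\<exists>M\<ge>1. \<forall>r. cnorm (A r) (a r) \<le> M)"
    by (intro conjI exI[of _ "max 1 M"]) (auto intro: order_trans[of _ M])
qed (auto simp: bounded_seqs_def bdd_above_def)

lemma bounded_seqs_closed:
  assumes "a \<in> bounded_seqs A" "b \<in> bounded_seqs A"
  shows "add_seq a b \<in> bounded_seqs A" "mult_seq a b \<in> bounded_seqs A"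
proof -
  obtain M N where M: "M \<ge> 1" "\<And>r. cnorm (A r) (a r) \<le> M" and N: "N \<ge> 1" "\<And>r. cnorm (A r) (b r) \<le> N"
    and c: "\<And>r. a r \<in> carrier (A r)" "\<And>r. b r \<in> carrier (A r)"
    using assms unfolding bounded_seqs_iff by blast
  have "cnorm (A r) (a r \<oplus>\<^bsub>A r\<^esub> b r) \<le> M + N" for r
    using norm_add[OF c(1) c(2), of r] M(2)[of r] N(2)[of r] by linarith
  then show "add_seq a b \<in> bounded_seqs A"
    unfolding bounded_seqs_iff using c M N by (intro conjI exI[of _ "M + N"]) auto
  have "cnorm (A r) (a r \<otimes>\<^bsub>A r\<^esub> b r) \<le> M * N" for r
  proof -
    have "cnorm (A r) (a r \<otimes>\<^bsub>A r\<^esub> b r) \<le> cnorm (A r) (a r) * cnorm (A r) (b r)"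
      using norm_mult c by simp
    also have "\<dots> \<le> M * N" using M N norm_nonneg c by (intro mult_mono) auto
    finally show ?thesis .
  qed
  moreover have "1 * 1 \<le> M * N" using M N by (intro mult_mono) auto
  ultimately show "mult_seq a b \<in> bounded_seqs A"
    unfolding bounded_seqs_iff using c by (intro conjI exI[of _ "M * N"]) auto
qed

lemma coherent_seqs_closed:
  assumes "a \<in> coherent_seqs A \<phi>" "b \<in> coherent_seqs A \<phi>"
  shows "add_seq a b \<in> coherent_seqs A \<phi>" "mult_seq a b \<in> coherent_seqs A \<phi>"
proof -
  have c: "\<And>r. a r \<in> carrier (A r)" "\<And>r. b r \<in> carrier (A r)"
    using assms by (auto simp: coherent_seqs_def bounded_seqs_def)
  have ev: "eventually (\<lambda>r. a (Suc r) = \<phi> r (a r) \<and> b (Suc r) = \<phi> r (b r)) sequentially"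
    using assms by (auto simp: coherent_seqs_def eventually_conj_iff)
  show "add_seq a b \<in> coherent_seqs A \<phi>"
    using bounded_seqs_closed(1)[of a b] assms eventually_mono[OF ev] hom_add c
    by (auto simp: coherent_seqs_def elim!: eventually_mono)
  show "mult_seq a b \<in> coherent_seqs A \<phi>"
    using bounded_seqs_closed(2)[of a b] assms eventually_mono[OF ev] hom_mult c
    by (auto simp: coherent_seqs_def elim!: eventually_mono)
qed

lemma coherent_imp_limit: "a \<in> coherent_seqs A \<phi> \<Longrightarrow> a \<in> limit_seqs A \<phi>"
  unfolding limit_seqs_def coherent_seqs_def
  by (auto simp: bounded_seqs_iff gap_refl intro!: bexI[of _ a])

lemma limit_carrier: "a \<in> limit_seqs A \<phi> \<Longrightarrow> a r \<in> carrier (A r)"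
  by (auto simp: limit_seqs_def bounded_seqs_def)

lemma limit_bounded: "a \<in> limit_seqs A \<phi> \<Longrightarrow> \<exists>M\<ge>1. \<forall>r. cnorm (A r) (a r) \<le> M"
  by (auto simp: limit_seqs_def bounded_seqs_iff)

lemma zero_seq_limit: "zero_seq \<in> limit_seqs A \<phi>"
  by (intro coherent_imp_limit) (auto simp: coherent_seqs_def bounded_seqs_iff norm_zero hom_zero)

lemma limit_seqs_closed:
  assumes a: "a \<in> limit_seqs A \<phi>" and b: "b \<in> limit_seqs A \<phi>"
  shows "add_seq a b \<in> limit_seqs A \<phi>" "mult_seq a b \<in> limit_seqs A \<phi>"
proof -
  have bd: "a \<in> bounded_seqs A" "b \<in> bounded_seqs A" using assms by (auto simp: limit_seqs_def)
  obtain M where M: "M \<ge> 1" "\<And>r. cnorm (A r) (a r) \<le> M" using limit_bounded[OF a] by blast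
  obtain N where N: "N \<ge> 1" "\<And>r. cnorm (A r) (b r) \<le> N" using limit_bounded[OF b] by blast
  have approx: "\<exists>c\<in>coherent_seqs A \<phi>. eventually (\<lambda>r. gap r (x r) (c r) < \<epsilon>) sequentially"
    if "x \<in> limit_seqs A \<phi>" "\<epsilon> > 0" for x \<epsilon>
    using that by (auto simp: limit_seqs_def)
  note car = limit_carrier[OF a] limit_carrier[OF b]
  have ccar: "c r \<in> carrier (A r)" if "c \<in> coherent_seqs A \<phi>" for c r
    using limit_carrier[OF coherent_imp_limit[OF that]] .
  have "\<exists>c\<in>coherent_seqs A \<phi>. eventually (\<lambda>r. gap r (add_seq a b r) (c r) < \<epsilon>) sequentially"
    if "\<epsilon> > 0" for \<epsilon>
  proof -
    obtain c where c: "c \<in> coherent_seqs A \<phi>" "eventually (\<lambda>r. gap r (a r) (c r) < \<epsilon> / 2) sequentially"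
      using approx[OF a, of "\<epsilon> / 2"] \<open>\<epsilon> > 0\<close> by auto
    obtain d where d: "d \<in> coherent_seqs A \<phi>" "eventually (\<lambda>r. gap r (b r) (d r) < \<epsilon> / 2) sequentially"
      using approx[OF b, of "\<epsilon> / 2"] \<open>\<epsilon> > 0\<close> by auto
    show ?thesis
    proof (rule bexI[OF _ coherent_seqs_closed(1)[OF c(1) d(1)]])
      show "eventually (\<lambda>r. gap r (add_seq a b r) (add_seq c d r) < \<epsilon>) sequentially"
        using c(2) d(2)
      proof eventually_elim
        case (elim r)
        then show ?case using gap_add[OF car(1) car(2) ccar[OF c(1)] ccar[OF d(1)], of r] by linarith
      qed
    qed
  qed
  then show "add_seq a b \<in> limit_seqs A \<phi>"
    using bounded_seqs_closed[OF bd] unfolding limit_seqs_def by auto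
  have "\<exists>c\<in>coherent_seqs A \<phi>. eventually (\<lambda>r. gap r (mult_seq a b r) (c r) < \<epsilon>) sequentially"
    if "\<epsilon> > 0" for \<epsilon>
  proof -
    \<comment> \<open>The bound by 1 keeps the approximants of \<open>b\<close> bounded by \<open>N + 1\<close>.\<close>
    define \<delta> where "\<delta> = min 1 (\<epsilon> / (2 * (M + N + 1)))"
    have \<delta>: "\<delta> > 0" "\<delta> \<le> 1" using \<open>\<epsilon> > 0\<close> M N by (auto simp: \<delta>_def)
    have "\<delta> * (2 * (M + N + 1)) \<le> \<epsilon> / (2 * (M + N + 1)) * (2 * (M + N + 1))"
      using M N by (intro mult_right_mono) (auto simp: \<delta>_def)
    then have \<delta>\<epsilon>: "\<delta> * (2 * (M + N + 1)) \<le> \<epsilon>" using M N by simp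
    obtain c where c: "c \<in> coherent_seqs A \<phi>" "eventually (\<lambda>r. gap r (a r) (c r) < \<delta>) sequentially"
      using approx[OF a \<delta>(1)] by auto
    obtain d where d: "d \<in> coherent_seqs A \<phi>" "eventually (\<lambda>r. gap r (b r) (d r) < \<delta>) sequentially"
      using approx[OF b \<delta>(1)] by auto
    show ?thesis
    proof (rule bexI[OF _ coherent_seqs_closed(2)[OF c(1) d(1)]])
      show "eventually (\<lambda>r. gap r (mult_seq a b r) (mult_seq c d r) < \<epsilon>) sequentially"
        using c(2) d(2)
      proof eventually_elim
        case (elim r)
        have "cnorm (A r) (d r) \<le> N + 1"
          using norm_le_gap[OF ccar[OF d(1)] car(2), of r] gap_sym[OF ccar[OF d(1)] car(2), of r] N(2)[of r] elim \<delta>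
          by linarith
        then have "cnorm (A r) (a r) * gap r (b r) (d r) + gap r (a r) (c r) * cnorm (A r) (d r)
            \<le> M * \<delta> + \<delta> * (N + 1)"
          using M N elim norm_nonneg car ccar[OF c(1)] ccar[OF d(1)] \<delta>
          by (intro add_mono mult_mono) auto
        also have "\<dots> < \<delta> * (2 * (M + N + 1))" using \<delta> M N by (simp add: algebra_simps add_pos_pos)
        finally show ?case
          using gap_mult[OF car(1) car(2) ccar[OF c(1)] ccar[OF d(1)], of r] \<delta>\<epsilon> by linarith
      qed
    qed
  qed
  then show "mult_seq a b \<in> limit_seqs A \<phi>"
    using bounded_seqs_closed[OF bd] unfolding limit_seqs_def by auto
qed

text \<open>Coherent sequences approximate the given one, and the connecting maps are contractive.  In this form
  the connecting maps enter the comparison of ranks at consecutive stages.\<close>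

lemma limit_seqs_asymptotically_coherent:
  assumes a: "a \<in> limit_seqs A \<phi>"
  shows "(\<lambda>r. gap (Suc r) (a (Suc r)) (\<phi> r (a r))) \<longlonglongrightarrow> 0"
proof (rule LIMSEQ_I)
  fix \<epsilon> :: real assume "\<epsilon> > 0"
  have approx: "\<forall>\<epsilon>>0. \<exists>c\<in>coherent_seqs A \<phi>. eventually (\<lambda>r. gap r (a r) (c r) < \<epsilon>) sequentially"
    using a unfolding limit_seqs_def by simp
  have "\<epsilon> / 2 > 0" using \<open>\<epsilon> > 0\<close> by simp
  then obtain c where c: "c \<in> coherent_seqs A \<phi>" "eventually (\<lambda>r. gap r (a r) (c r) < \<epsilon> / 2) sequentially"
    using approx by blast
  have ccar: "c r \<in> carrier (A r)" for r using limit_carrier[OF coherent_imp_limit[OF c(1)]] .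
  note car = limit_carrier[OF a]
  have "eventually (\<lambda>r. gap (Suc r) (a (Suc r)) (c (Suc r)) < \<epsilon> / 2) sequentially"
    using c(2) by (subst (asm) eventually_sequentially_Suc[symmetric])
  moreover have "eventually (\<lambda>r. c (Suc r) = \<phi> r (c r)) sequentially" using c(1) by (simp add: coherent_seqs_def)
  ultimately have "eventually (\<lambda>r. norm (gap (Suc r) (a (Suc r)) (\<phi> r (a r)) - 0) < \<epsilon>) sequentially"
    using c(2)
  proof eventually_elim
    case (elim r)
    have "gap (Suc r) (a (Suc r)) (\<phi> r (a r)) \<le> gap (Suc r) (a (Suc r)) (c (Suc r)) + gap (Suc r) (c (Suc r)) (\<phi> r (a r))"
      using car ccar hom_carrier by (intro gap_triangle) auto
    also have "gap (Suc r) (c (Suc r)) (\<phi> r (a r)) \<le> gap r (a r) (c r)"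
      using elim gap_hom[OF ccar car, of r] gap_sym[OF ccar car, of r] by simp
    finally have "gap (Suc r) (a (Suc r)) (\<phi> r (a r)) < \<epsilon>" using elim by linarith
    moreover have "0 \<le> gap (Suc r) (a (Suc r)) (\<phi> r (a r))" using car hom_carrier by (intro norm_nonneg) auto
    ultimately show ?case by simp
  qed
  then show "\<exists>no. \<forall>r\<ge>no. norm (gap (Suc r) (a (Suc r)) (\<phi> r (a r)) - 0) < \<epsilon>"
    by (simp add: eventually_sequentially)
qed

subsection \<open>Classes\<close>

lemma gap_tendsto_triangle:
  assumes "\<And>r. x r \<in> carrier (A r)" "\<And>r. y r \<in> carrier (A r)" "\<And>r. z r \<in> carrier (A r)"
    and "(\<lambda>r. gap r (x r) (y r)) \<longlonglongrightarrow> 0" "(\<lambda>r. gap r (y r) (z r)) \<longlonglongrightarrow> 0"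
  shows "(\<lambda>r. gap r (x r) (z r)) \<longlonglongrightarrow> 0"
proof (rule tendsto_sandwich[OF _ _ tendsto_const])
  show "(\<lambda>r. gap r (x r) (y r) + gap r (y r) (z r)) \<longlonglongrightarrow> 0"
    using tendsto_add[OF assms(4,5)] by simp
qed (use assms gap_triangle norm_nonneg in auto)

lemma limit_rel_equiv: "equiv (limit_seqs A \<phi>) (limit_rel A \<phi>)"
proof (rule equivI)
  show "limit_rel A \<phi> \<subseteq> limit_seqs A \<phi> \<times> limit_seqs A \<phi>" by (auto simp: limit_rel_def)
  show "refl_on (limit_seqs A \<phi>) (limit_rel A \<phi>)"
    by (auto simp: limit_rel_def refl_on_def gap_refl limit_carrier)
  show "sym (limit_rel A \<phi>)"
    by (rule symI) (auto simp: limit_rel_def gap_sym limit_carrier)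
  show "trans (limit_rel A \<phi>)"
  proof (rule transI)
    fix x y z assume "(x, y) \<in> limit_rel A \<phi>" "(y, z) \<in> limit_rel A \<phi>"
    then show "(x, z) \<in> limit_rel A \<phi>"
      using gap_tendsto_triangle[of x y z] limit_carrier[of x] limit_carrier[of y] limit_carrier[of z]
      by (simp add: limit_rel_def)
  qed
qed

lemma limit_class_eq_iff:
  "a \<in> limit_seqs A \<phi> \<Longrightarrow> b \<in> limit_seqs A \<phi> \<Longrightarrow>
    limit_class a = limit_class b \<longleftrightarrow> (\<lambda>r. gap r (a r) (b r)) \<longlonglongrightarrow> 0"
  using eq_equiv_class_iff[OF limit_rel_equiv, of a b] by (auto simp: limit_rel_def)

lemma limit_class_carrier: "a \<in> limit_seqs A \<phi> \<Longrightarrow> limit_class a \<in> carrier (direct_limit A \<phi>)"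
  by (simp add: direct_limit_def quotientI)

lemma direct_limit_carrierE:
  assumes "X \<in> carrier (direct_limit A \<phi>)"
  obtains a where "a \<in> limit_seqs A \<phi>" "X = limit_class a"
  using assms by (auto simp: direct_limit_def elim: quotientE)

lemma limit_class_add:
  assumes "a \<in> limit_seqs A \<phi>" "b \<in> limit_seqs A \<phi>"
  shows "limit_class a \<oplus>\<^bsub>direct_limit A \<phi>\<^esub> limit_class b = limit_class (add_seq a b)"
proof -
  have "congruent2 (limit_rel A \<phi>) (limit_rel A \<phi>) (\<lambda>a b. limit_class (add_seq a b))"
  proof (rule congruent2I'[OF])
    fix a a' b b' assume *: "(a, a') \<in> limit_rel A \<phi>" "(b, b') \<in> limit_rel A \<phi>"
    then have L: "a \<in> limit_seqs A \<phi>" "a' \<in> limit_seqs A \<phi>" "b \<in> limit_seqs A \<phi>" "b' \<in> limit_seqs A \<phi>"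
      and t: "(\<lambda>r. gap r (a r) (a' r)) \<longlonglongrightarrow> 0" "(\<lambda>r. gap r (b r) (b' r)) \<longlonglongrightarrow> 0"
      by (auto simp: limit_rel_def)
    have "(\<lambda>r. gap r (add_seq a b r) (add_seq a' b' r)) \<longlonglongrightarrow> 0"
    proof (rule tendsto_sandwich[OF _ _ tendsto_const])
      show "(\<lambda>r. gap r (a r) (a' r) + gap r (b r) (b' r)) \<longlonglongrightarrow> 0" using tendsto_add[OF t] by simp
    qed (use L limit_carrier gap_add norm_nonneg in auto)
    then show "limit_class (add_seq a b) = limit_class (add_seq a' b')"
      using L by (subst limit_class_eq_iff) (auto intro: limit_seqs_closed)
  qed
  then show ?thesis
    using UN_equiv_class2[OF limit_rel_equiv limit_rel_equiv _ assms] by (simp add: direct_limit_def)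
qed

lemma limit_class_mult:
  assumes "a \<in> limit_seqs A \<phi>" "b \<in> limit_seqs A \<phi>"
  shows "limit_class a \<otimes>\<^bsub>direct_limit A \<phi>\<^esub> limit_class b = limit_class (mult_seq a b)"
proof -
  have "congruent2 (limit_rel A \<phi>) (limit_rel A \<phi>) (\<lambda>a b. limit_class (mult_seq a b))"
  proof (rule congruent2I'[OF])
    fix a a' b b' assume *: "(a, a') \<in> limit_rel A \<phi>" "(b, b') \<in> limit_rel A \<phi>"
    then have L: "a \<in> limit_seqs A \<phi>" "a' \<in> limit_seqs A \<phi>" "b \<in> limit_seqs A \<phi>" "b' \<in> limit_seqs A \<phi>"
      and t: "(\<lambda>r. gap r (a r) (a' r)) \<longlonglongrightarrow> 0" "(\<lambda>r. gap r (b r) (b' r)) \<longlonglongrightarrow> 0"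
      by (auto simp: limit_rel_def)
    obtain M where M: "M \<ge> 1" "\<And>r. cnorm (A r) (a r) \<le> M" using limit_bounded[OF L(1)] by blast
    obtain N where N: "N \<ge> 1" "\<And>r. cnorm (A r) (b' r) \<le> N" using limit_bounded[OF L(4)] by blast
    have "(\<lambda>r. gap r (mult_seq a b r) (mult_seq a' b' r)) \<longlonglongrightarrow> 0"
    proof (rule tendsto_sandwich[OF _ _ tendsto_const])
      show "(\<lambda>r. M * gap r (b r) (b' r) + gap r (a r) (a' r) * N) \<longlonglongrightarrow> 0"
        using tendsto_add[OF tendsto_mult_left[OF t(2), of M] tendsto_mult_right[OF t(1), of N]] by simp
      show "\<forall>\<^sub>F r in sequentially. gap r (mult_seq a b r) (mult_seq a' b' r)
          \<le> M * gap r (b r) (b' r) + gap r (a r) (a' r) * N"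
      proof (intro always_eventually allI)
        fix r
        note c = limit_carrier[OF L(1)] limit_carrier[OF L(3)] limit_carrier[OF L(2)] limit_carrier[OF L(4)]
        have "cnorm (A r) (a r) * gap r (b r) (b' r) + gap r (a r) (a' r) * cnorm (A r) (b' r)
            \<le> M * gap r (b r) (b' r) + gap r (a r) (a' r) * N"
          using M N c norm_nonneg by (intro add_mono mult_mono) auto
        then show "gap r (mult_seq a b r) (mult_seq a' b' r)
            \<le> M * gap r (b r) (b' r) + gap r (a r) (a' r) * N"
          using gap_mult[OF c(1) c(2) c(3) c(4), of r] by linarith
      qed
    qed (use L limit_carrier norm_nonneg in auto)
    then show "limit_class (mult_seq a b) = limit_class (mult_seq a' b')"
      using L by (subst limit_class_eq_iff) (auto intro: limit_seqs_closed)
  qed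
  then show ?thesis
    using UN_equiv_class2[OF limit_rel_equiv limit_rel_equiv _ assms] by (simp add: direct_limit_def)
qed

lemma direct_limit_zero: "\<zero>\<^bsub>direct_limit A \<phi>\<^esub> = limit_class zero_seq"
  by (simp add: direct_limit_def)

lemma limit_class_zero_iff:
  assumes "a \<in> limit_seqs A \<phi>"
  shows "limit_class a = \<zero>\<^bsub>direct_limit A \<phi>\<^esub> \<longleftrightarrow> (\<lambda>r. cnorm (A r) (a r)) \<longlonglongrightarrow> 0"
proof -
  have "gap r (a r) \<zero>\<^bsub>A r\<^esub> = cnorm (A r) (a r)" for r
  proof -
    interpret ring "A r" by (rule ring)
    show ?thesis using limit_carrier[OF assms, of r] by (simp add: minus_eq)
  qed
  then show ?thesis unfolding direct_limit_zero using limit_class_eq_iff[OF assms zero_seq_limit] by simp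
qed

text \<open>Zero is thus determined by the addition, so additive maps between limits preserve it.\<close>

lemma direct_limit_add_idempotent:
  assumes "X \<in> carrier (direct_limit A \<phi>)" "X \<oplus>\<^bsub>direct_limit A \<phi>\<^esub> X = X"
  shows "X = \<zero>\<^bsub>direct_limit A \<phi>\<^esub>"
proof -
  obtain a where a: "a \<in> limit_seqs A \<phi>" "X = limit_class a" using direct_limit_carrierE[OF assms(1)] .
  have "limit_class (add_seq a a) = limit_class a" using assms(2) limit_class_add[OF a(1) a(1)] a(2) by simp
  then have "(\<lambda>r. gap r (add_seq a a r) (a r)) \<longlonglongrightarrow> 0"
    using limit_class_eq_iff[OF limit_seqs_closed(1)[OF a(1) a(1)] a(1)] by simp
  moreover have "gap r (add_seq a a r) (a r) = cnorm (A r) (a r)" for r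
  proof -
    interpret ring "A r" by (rule ring)
    have "(a r \<oplus>\<^bsub>A r\<^esub> a r) \<ominus>\<^bsub>A r\<^esub> a r = a r" using limit_carrier[OF a(1), of r] by algebra
    then show ?thesis by simp
  qed
  ultimately show ?thesis using limit_class_zero_iff[OF a(1)] a(2) by simp
qed

lemma direct_limit_zero_carrier: "\<zero>\<^bsub>direct_limit A \<phi>\<^esub> \<in> carrier (direct_limit A \<phi>)"
  unfolding direct_limit_zero by (rule limit_class_carrier[OF zero_seq_limit])

lemma direct_limit_zero_add: "\<zero>\<^bsub>direct_limit A \<phi>\<^esub> \<oplus>\<^bsub>direct_limit A \<phi>\<^esub> \<zero>\<^bsub>direct_limit A \<phi>\<^esub> = \<zero>\<^bsub>direct_limit A \<phi>\<^esub>"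
proof -
  have "add_seq zero_seq zero_seq = zero_seq"
  proof
    fix r
    interpret ring "A r" by (rule ring)
    show "\<zero>\<^bsub>A r\<^esub> \<oplus>\<^bsub>A r\<^esub> \<zero>\<^bsub>A r\<^esub> = \<zero>\<^bsub>A r\<^esub>" by simp
  qed
  then show ?thesis unfolding direct_limit_zero limit_class_add[OF zero_seq_limit zero_seq_limit] by simp
qed

subsection \<open>The canonical maps into the limit\<close>

primrec push :: "nat \<Rightarrow> 'a \<Rightarrow> nat \<Rightarrow> 'a" where
  "push t x 0 = (if t = 0 then x else \<zero>\<^bsub>A 0\<^esub>)"
| "push t x (Suc r) = (if Suc r < t then \<zero>\<^bsub>A (Suc r)\<^esub> else if Suc r = t then x else \<phi> r (push t x r))"

lemma push_carrier: "x \<in> carrier (A t) \<Longrightarrow> push t x r \<in> carrier (A r)"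
  by (induction r) (auto intro: hom_carrier)

lemma push_norm: "x \<in> carrier (A t) \<Longrightarrow> cnorm (A r) (push t x r) \<le> cnorm (A t) x"
proof (induction r)
  case (Suc r)
  then show ?case using hom_norm[OF push_carrier[OF Suc.prems], of r] norm_nonneg[of x t]
    by (auto simp: norm_zero)
qed (auto simp: norm_zero norm_nonneg)

lemma push_coherent: "x \<in> carrier (A t) \<Longrightarrow> push t x \<in> coherent_seqs A \<phi>"
proof -
  assume x: "x \<in> carrier (A t)"
  have "push t x (Suc r) = \<phi> r (push t x r)" if "r \<ge> t" for r using that by auto
  then have "eventually (\<lambda>r. push t x (Suc r) = \<phi> r (push t x r)) sequentially"
    unfolding eventually_sequentially by blast
  moreover have "push t x \<in> bounded_seqs A"
    unfolding bounded_seqs_iff using x push_carrier push_norm[OF x]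
    by (intro conjI exI[of _ "max 1 (cnorm (A t) x)"]) (auto simp: le_max_iff_disj)
  ultimately show ?thesis by (simp add: coherent_seqs_def)
qed

lemma push_add:
  assumes "x \<in> carrier (A t)" "y \<in> carrier (A t)"
  shows "push t (x \<oplus>\<^bsub>A t\<^esub> y) r = push t x r \<oplus>\<^bsub>A r\<^esub> push t y r"
proof (induction r)
  case 0
  interpret ring "A 0" by (rule ring)
  show ?case by simp
next
  case (Suc r)
  interpret ring "A (Suc r)" by (rule ring)
  show ?case using Suc hom_add[OF push_carrier push_carrier, OF assms] by auto
qed

lemma push_mult:
  assumes "x \<in> carrier (A t)" "y \<in> carrier (A t)"
  shows "push t (x \<otimes>\<^bsub>A t\<^esub> y) r = push t x r \<otimes>\<^bsub>A r\<^esub> push t y r"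
proof (induction r)
  case 0
  interpret ring "A 0" by (rule ring)
  show ?case by simp
next
  case (Suc r)
  interpret ring "A (Suc r)" by (rule ring)
  show ?case using Suc hom_mult[OF push_carrier push_carrier, OF assms] by auto
qed

lemma push_zero: "push t \<zero>\<^bsub>A t\<^esub> r = \<zero>\<^bsub>A r\<^esub>"
  by (induction r) (auto simp: hom_zero)

definition canonical :: "nat \<Rightarrow> 'a \<Rightarrow> (nat \<Rightarrow> 'a) set" where
  "canonical t x = limit_class (push t x)"

lemma push_limit: "x \<in> carrier (A t) \<Longrightarrow> push t x \<in> limit_seqs A \<phi>"
  by (rule coherent_imp_limit[OF push_coherent])

lemma multiple_canonical:
  assumes "multiple (A t) f n e"
  shows "multiple (direct_limit A \<phi>) (canonical t f) n (canonical t e)"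
  using assms
proof (rule multiple_map)
  show "canonical t x \<in> carrier (direct_limit A \<phi>)" if "x \<in> carrier (A t)" for x
    unfolding canonical_def by (rule limit_class_carrier[OF push_limit[OF that]])
  show "canonical t (x \<oplus>\<^bsub>A t\<^esub> y) = canonical t x \<oplus>\<^bsub>direct_limit A \<phi>\<^esub> canonical t y"
    if "x \<in> carrier (A t)" "y \<in> carrier (A t)" for x y
    unfolding canonical_def limit_class_add[OF push_limit[OF that(1)] push_limit[OF that(2)]]
      push_add[OF that, abs_def] ..
  show "canonical t (x \<otimes>\<^bsub>A t\<^esub> y) = canonical t x \<otimes>\<^bsub>direct_limit A \<phi>\<^esub> canonical t y"
    if "x \<in> carrier (A t)" "y \<in> carrier (A t)" for x y
    unfolding canonical_def limit_class_mult[OF push_limit[OF that(1)] push_limit[OF that(2)]]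
      push_mult[OF that, abs_def] ..
  show "canonical t \<zero>\<^bsub>A t\<^esub> = \<zero>\<^bsub>direct_limit A \<phi>\<^esub>"
    unfolding canonical_def direct_limit_zero push_zero[abs_def] ..
qed

lemma canonical_eqI:
  assumes x: "x \<in> carrier (A t)" and "t \<le> s"
  shows "canonical s (push t x s) = canonical t x"
proof -
  have eq: "push s (push t x s) r = push t x r" if "s \<le> r" for r
    using that \<open>t \<le> s\<close> by (induction r) (auto simp: le_Suc_eq)
  have "eventually (\<lambda>r. gap r (push s (push t x s) r) (push t x r) = 0) sequentially"
    unfolding eventually_sequentially using eq gap_refl push_carrier[OF x] by (intro exI[of _ s]) auto
  then have "(\<lambda>r. gap r (push s (push t x s) r) (push t x r)) \<longlonglongrightarrow> 0"
    by (rule tendsto_eventually)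
  then show ?thesis
    unfolding canonical_def by (subst limit_class_eq_iff) (auto intro: push_limit push_carrier x)
qed

end

lemma star_isomorphic_imp_divisible_infinitesimal:
  assumes A: "normed_ring_system A \<phi>" and B: "normed_ring_system B \<psi>"
    and "star_isomorphic (direct_limit A \<phi>) (direct_limit B \<psi>)"
    and "divisible_infinitesimal (direct_limit A \<phi>) p"
  shows "divisible_infinitesimal (direct_limit B \<psi>) p"
proof -
  obtain h where h: "star_hom (direct_limit A \<phi>) (direct_limit B \<psi>) h"
    "bij_betw h (carrier (direct_limit A \<phi>)) (carrier (direct_limit B \<psi>))"
    using assms(3) unfolding star_isomorphic_def by blast
  let ?z = "\<zero>\<^bsub>direct_limit A \<phi>\<^esub>"
  have z: "?z \<in> carrier (direct_limit A \<phi>)" using normed_ring_system.direct_limit_zero_carrier[OF A] .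
  have car: "h x \<in> carrier (direct_limit B \<psi>)" if "x \<in> carrier (direct_limit A \<phi>)" for x
    using h(1) that unfolding star_hom_def by blast
  have add: "h (x \<oplus>\<^bsub>direct_limit A \<phi>\<^esub> y) = h x \<oplus>\<^bsub>direct_limit B \<psi>\<^esub> h y"
    and mult: "h (x \<otimes>\<^bsub>direct_limit A \<phi>\<^esub> y) = h x \<otimes>\<^bsub>direct_limit B \<psi>\<^esub> h y"
    if "x \<in> carrier (direct_limit A \<phi>)" "y \<in> carrier (direct_limit A \<phi>)" for x y
    using h(1) that unfolding star_hom_def by blast+
  have "h ?z \<oplus>\<^bsub>direct_limit B \<psi>\<^esub> h ?z = h ?z"
    using add[OF z z] unfolding normed_ring_system.direct_limit_zero_add[OF A] by (rule sym)
  then have hz: "h ?z = \<zero>\<^bsub>direct_limit B \<psi>\<^esub>"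
    by (rule normed_ring_system.direct_limit_add_idempotent[OF B car[OF z]])
  show ?thesis
    using h(2) unfolding bij_betw_def
    by (intro divisible_infinitesimal_iso[OF assms(4) _ car add mult hz z]) blast+
qed

section \<open>The stages and the standard maps\<close>

lemma stage_simps:
  "carrier (stage n g r) = carrier_mat (g r * n) (g r * n) \<times> carrier_mat (g r * n) (g r * n)"
  "x \<oplus>\<^bsub>stage n g r\<^esub> y = (fst x + fst y, snd x + snd y)"
  "x \<otimes>\<^bsub>stage n g r\<^esub> y = (fst x * fst y, snd x * snd y)"
  "\<zero>\<^bsub>stage n g r\<^esub> = (0\<^sub>m (g r * n) (g r * n), 0\<^sub>m (g r * n) (g r * n))"
  "\<one>\<^bsub>stage n g r\<^esub> = (1\<^sub>m (g r * n), 1\<^sub>m (g r * n))"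
  "c \<odot>\<^bsub>stage n g r\<^esub> x = (c \<cdot>\<^sub>m fst x, c \<cdot>\<^sub>m snd x)"
  "star (stage n g r) x = (mat_adjoint (fst x), mat_adjoint (snd x))"
  "cnorm (stage n g r) x = max (mat_op_norm (fst x)) (mat_op_norm (snd x))"
  by (auto simp: stage_def direct_sum_def matrix_algebra_def split: prod.splits)

lemma ring_stage: "ring (stage n g r)"
proof -
  let ?R = "stage n g r" and ?k = "g r * n"
  show ?thesis
  proof (rule ringI)
    show "abelian_group ?R"
    proof (rule abelian_groupI)
      fix x assume "x \<in> carrier ?R"
      then show "\<exists>y\<in>carrier ?R. y \<oplus>\<^bsub>?R\<^esub> x = \<zero>\<^bsub>?R\<^esub>"
        by (intro bexI[of _ "(- fst x, - snd x)"])
           (auto simp: stage_simps uminus_l_inv_mat[of _ ?k ?k])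
    qed (auto simp: stage_simps assoc_add_mat[of _ ?k ?k] comm_add_mat[of _ ?k ?k])
    show "Group.monoid ?R"
      by (rule monoidI) (auto simp: stage_simps assoc_mult_mat[of _ ?k ?k _ ?k _ ?k])
  qed (auto simp: stage_simps add_mult_distrib_mat[of _ ?k ?k] mult_add_distrib_mat[of _ ?k ?k])
qed

lemma stage_uminus:
  assumes "x \<in> carrier (stage n g r)"
  shows "\<ominus>\<^bsub>stage n g r\<^esub> x = (- fst x, - snd x)"
proof -
  interpret ring "stage n g r" by (rule ring_stage)
  show ?thesis using assms
    by (intro minus_equality) (auto simp: stage_simps uminus_l_inv_mat[of _ "g r * n" "g r * n"])
qed

lemma stage_minus:
  assumes "x \<in> carrier (stage n g r)" "y \<in> carrier (stage n g r)"
  shows "x \<ominus>\<^bsub>stage n g r\<^esub> y = (fst x - fst y, snd x - snd y)"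
  unfolding a_minus_def stage_uminus[OF assms(2)] using assms
  by (auto simp: stage_simps minus_add_uminus_mat[of _ "g r * n" "g r * n"])

text \<open>The sequence of block types along the diagonal; block diagonal matrices are handled by induction
  over this word.\<close>

definition block_word :: "nat \<Rightarrow> nat \<Rightarrow> bool list" where
  "block_word q m = replicate q True @ replicate m False"

lemma standard_block_word:
  "standard_block x a b = diag_block_mat (map (\<lambda>i. if i then a else b) (block_word (x 1) (x 2)))"
  by (simp add: standard_block_def block_word_def)

lemma standard_block_norm_le:
  assumes "a \<in> carrier_mat k k" "b \<in> carrier_mat k k"
  shows "mat_op_norm (standard_block x a b) \<le> max (mat_op_norm a) (mat_op_norm b)"
  unfolding standard_block_word
  by (rule blocks_norm_le[of _ k]) (use assms mat_op_norm_nonneg[OF assms(1)] in auto)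

lemma standard_block_carrier:
  assumes "a \<in> carrier_mat k k" "b \<in> carrier_mat k k"
  shows "standard_block x a b \<in> carrier_mat ((x 1 + x 2) * k) ((x 1 + x 2) * k)"
  using blocks_carrier[of "\<lambda>i. if i then a else b" k "block_word (x 1) (x 2)"] assms
  by (simp add: standard_block_word block_word_def)

lemma near_rank_standard_block:
  assumes "near_idempotent C k a" "near_idempotent C k b" "C \<ge> 1"
  shows "near_rank (standard_block x a b) = x 1 * near_rank a + x 2 * near_rank b"
proof -
  have "near_rank (standard_block x a b) = (\<Sum>i\<leftarrow>block_word (x 1) (x 2). near_rank (if i then a else b))"
    unfolding standard_block_word
    using assms by (intro near_rank_blocks[of _ k _ C]) (auto simp: near_idempotent_def)
  also have "\<dots> = x 1 * near_rank a + x 2 * near_rank b"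
    by (simp add: block_word_def sum_list_replicate map_replicate)
  finally show ?thesis .
qed

lemma standard_block_hom:
  assumes "a \<in> carrier_mat k k" "b \<in> carrier_mat k k" "a' \<in> carrier_mat k k" "b' \<in> carrier_mat k k"
  shows "standard_block x (a * a') (b * b') = standard_block x a b * standard_block x a' b'"
    and "standard_block x (a + a') (b + b') = standard_block x a b + standard_block x a' b'"
    and "standard_block x (c \<cdot>\<^sub>m a) (c \<cdot>\<^sub>m b) = c \<cdot>\<^sub>m standard_block x a b"
    and "standard_block x (mat_adjoint a) (mat_adjoint b) = mat_adjoint (standard_block x a b)"
proof -
  let ?F = "\<lambda>i. if i then a else b" and ?G = "\<lambda>i. if i then a' else b'"
  have F: "\<And>i. ?F i \<in> carrier_mat k k" and G: "\<And>i. ?G i \<in> carrier_mat k k" using assms by auto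
  have "(\<lambda>i. if i then a * a' else b * b') = (\<lambda>i. ?F i * ?G i)"
    "(\<lambda>i. if i then a + a' else b + b') = (\<lambda>i. ?F i + ?G i)"
    "(\<lambda>i. if i then c \<cdot>\<^sub>m a else c \<cdot>\<^sub>m b) = (\<lambda>i. c \<cdot>\<^sub>m ?F i)"
    "(\<lambda>i. if i then mat_adjoint a else mat_adjoint b) = (\<lambda>i. mat_adjoint (?F i))" by auto
  then show "standard_block x (a * a') (b * b') = standard_block x a b * standard_block x a' b'"
    "standard_block x (a + a') (b + b') = standard_block x a b + standard_block x a' b'"
    "standard_block x (c \<cdot>\<^sub>m a) (c \<cdot>\<^sub>m b) = c \<cdot>\<^sub>m standard_block x a b"
    "standard_block x (mat_adjoint a) (mat_adjoint b) = mat_adjoint (standard_block x a b)"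
    unfolding standard_block_word
    by (simp_all only: blocks_mult[OF F G] blocks_add[OF F G] blocks_smult[OF F] blocks_adjoint[OF F])
qed

lemma standard_block_one: "standard_block x (1\<^sub>m k) (1\<^sub>m k) = 1\<^sub>m ((x 1 + x 2) * k)"
  using blocks_one[of k "block_word (x 1) (x 2)"] by (simp add: standard_block_word block_word_def)

lemma normed_ring_system_ensemble:
  assumes "\<phi> \<in> ensemble n g"
  shows "normed_ring_system (stage n g) \<phi>"
proof (rule normed_ring_system.intro)
  fix r
  let ?k = "g r * n"
  have \<phi>: "standard_hom n g r (\<phi> r)" using assms by (simp add: ensemble_def)
  then have hom: "star_hom (stage n g r) (stage n g (Suc r)) (\<phi> r)"
    by (simp add: standard_hom_def unital_star_hom_def)
  obtain x :: "nat \<Rightarrow> nat \<Rightarrow> nat" where x: "\<forall>(a, b)\<in>carrier (stage n g r).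
      \<phi> r (a, b) = (standard_block (x 1) a b, standard_block (x 2) a b)"
    using \<phi> unfolding standard_hom_def by blast
  show "ring (stage n g r)" by (rule ring_stage)
  fix u assume u: "u \<in> carrier (stage n g r)"
  then have u': "fst u \<in> carrier_mat ?k ?k" "snd u \<in> carrier_mat ?k ?k" by (auto simp: stage_simps)
  show "0 \<le> cnorm (stage n g r) u" using mat_op_norm_nonneg[OF u'(1)] by (simp add: stage_simps le_max_iff_disj)
  show "cnorm (stage n g r) (\<ominus>\<^bsub>stage n g r\<^esub> u) = cnorm (stage n g r) u"
    using u' by (simp add: stage_uminus[OF u] stage_simps mat_op_norm_uminus[of _ ?k ?k])
  show "\<phi> r u \<in> carrier (stage n g (Suc r))" using hom u by (auto simp: star_hom_def)
  have "\<phi> r u = (standard_block (x 1) (fst u) (snd u), standard_block (x 2) (fst u) (snd u))"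
    using x u by (cases u) auto
  then show "cnorm (stage n g (Suc r)) (\<phi> r u) \<le> cnorm (stage n g r) u"
    using standard_block_norm_le[OF u'] by (simp add: stage_simps)
  fix v assume v: "v \<in> carrier (stage n g r)"
  then have v': "fst v \<in> carrier_mat ?k ?k" "snd v \<in> carrier_mat ?k ?k" by (auto simp: stage_simps)
  show "\<phi> r (u \<oplus>\<^bsub>stage n g r\<^esub> v) = \<phi> r u \<oplus>\<^bsub>stage n g (Suc r)\<^esub> \<phi> r v"
    "\<phi> r (u \<otimes>\<^bsub>stage n g r\<^esub> v) = \<phi> r u \<otimes>\<^bsub>stage n g (Suc r)\<^esub> \<phi> r v"
    using hom u v unfolding star_hom_def by blast+
  show "cnorm (stage n g r) (u \<oplus>\<^bsub>stage n g r\<^esub> v) \<le> cnorm (stage n g r) u + cnorm (stage n g r) v"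
    using mat_op_norm_triangle[OF u'(1) v'(1)] mat_op_norm_triangle[OF u'(2) v'(2)] by (auto simp: stage_simps)
  have m: "mat_op_norm (a * b) \<le> max p q * max s t"
    if "a \<in> carrier_mat ?k ?k" "b \<in> carrier_mat ?k ?k" "mat_op_norm a \<le> max p q" "mat_op_norm b \<le> max s t" for a b p q s t
    using that order_trans[OF mat_op_norm_mult[OF that(1,2)]] mat_op_norm_nonneg[OF that(1)] mat_op_norm_nonneg[OF that(2)]
    by (meson mult_mono order_trans)
  show "cnorm (stage n g r) (u \<otimes>\<^bsub>stage n g r\<^esub> v) \<le> cnorm (stage n g r) u * cnorm (stage n g r) v"
    unfolding stage_simps fst_conv snd_conv using u' v' by (intro max.boundedI m) auto
next
  show "cnorm (stage n g r) \<zero>\<^bsub>stage n g r\<^esub> = 0" for r by (simp add: stage_simps)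
qed

section \<open>Triangular members of the ensemble\<close>

text \<open>The first summand receives only copies of the first summand.  The sequences that vanish in the first
  summand thus form an ideal, in which the second summands are embedded with multiplicity \<open>m r\<close>.\<close>

definition triangular_mult :: "(nat \<Rightarrow> nat) \<Rightarrow> (nat \<Rightarrow> nat) \<Rightarrow> nat \<Rightarrow> nat \<Rightarrow> nat \<Rightarrow> nat" where
  "triangular_mult g m r j i =
     (if j = 1 then (if i = 1 then growth_ratio g r else 0)
      else (if i = 1 then growth_ratio g r - m r else m r))"

definition triangular ::
  "nat \<Rightarrow> (nat \<Rightarrow> nat) \<Rightarrow> (nat \<Rightarrow> nat) \<Rightarrow> nat \<Rightarrow> complex mat \<times> complex mat \<Rightarrow> complex mat \<times> complex mat"
  where
  "triangular n g m r = (\<lambda>u\<in>carrier (stage n g r).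
     (standard_block (triangular_mult g m r 1) (fst u) (snd u),
      standard_block (triangular_mult g m r 2) (fst u) (snd u)))"

lemma growth_ratio_mult: "growth_sequence g \<Longrightarrow> growth_ratio g r * g r = g (Suc r)"
  by (auto simp: growth_sequence_def growth_ratio_def)

lemma triangular_in_ensemble:
  assumes g: "growth_sequence g" and m: "\<And>r. m r \<le> growth_ratio g r"
  shows "triangular n g m \<in> ensemble n g"
proof -
  have "standard_hom n g r (triangular n g m r)" for r
    unfolding standard_hom_def
  proof (intro conjI)
    let ?R = "stage n g r" and ?S = "stage n g (Suc r)" and ?k = "g r * n"
    let ?f = "triangular n g m r"
    show "?f \<in> extensional (carrier ?R)" by (simp add: triangular_def)
    show "\<exists>x :: nat \<Rightarrow> nat \<Rightarrow> nat. \<forall>(a, b)\<in>carrier ?R. ?f (a, b) = (standard_block (x 1) a b, standard_block (x 2) a b)"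
      by (intro exI[of _ "triangular_mult g m r"]) (auto simp: triangular_def)
    have rows: "triangular_mult g m r j 1 + triangular_mult g m r j 2 = growth_ratio g r" for j
      using m[of r] by (auto simp: triangular_mult_def)
    have size: "growth_ratio g r * ?k = g (Suc r) * n"
      using growth_ratio_mult[OF g, of r] by (simp flip: mult.assoc)
    have comp: "u \<in> carrier ?R \<Longrightarrow> fst u \<in> carrier_mat ?k ?k" "u \<in> carrier ?R \<Longrightarrow> snd u \<in> carrier_mat ?k ?k" for u
      by (auto simp: stage_simps)
    have car: "standard_block (triangular_mult g m r j) (fst u) (snd u) \<in> carrier_mat (g (Suc r) * n) (g (Suc r) * n)"
      if "u \<in> carrier ?R" for u j
      using standard_block_carrier[OF comp(1)[OF that] comp(2)[OF that], of "triangular_mult g m r j"]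
      unfolding rows size .
    interpret R: ring ?R by (rule ring_stage)
    have closed: "u \<in> carrier ?R \<Longrightarrow> c \<odot>\<^bsub>?R\<^esub> u \<in> carrier ?R" "u \<in> carrier ?R \<Longrightarrow> star ?R u \<in> carrier ?R" for u c
      by (auto simp: stage_simps)
    have one: "standard_block (triangular_mult g m r j) (1\<^sub>m ?k) (1\<^sub>m ?k) = 1\<^sub>m (g (Suc r) * n)" for j
      using standard_block_one[of "triangular_mult g m r j" ?k] unfolding rows size .
    have app: "?f u = (standard_block (triangular_mult g m r 1) (fst u) (snd u),
      standard_block (triangular_mult g m r 2) (fst u) (snd u))" if "u \<in> carrier ?R" for u
      using that by (simp add: triangular_def)
    show "unital_star_hom ?R ?S ?f"
      unfolding unital_star_hom_def star_hom_def
    proof (intro conjI ballI allI funcsetI)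
      show "?f u \<in> carrier ?S" if "u \<in> carrier ?R" for u
        using car[OF that] by (simp add: app[OF that] stage_simps)
      show "?f (u \<oplus>\<^bsub>?R\<^esub> v) = ?f u \<oplus>\<^bsub>?S\<^esub> ?f v" if "u \<in> carrier ?R" "v \<in> carrier ?R" for u v
        using that by (simp add: app)
          (simp add: stage_simps standard_block_hom(2)[OF comp(1)[OF that(1)] comp(2)[OF that(1)] comp(1)[OF that(2)] comp(2)[OF that(2)]])
      show "?f (u \<otimes>\<^bsub>?R\<^esub> v) = ?f u \<otimes>\<^bsub>?S\<^esub> ?f v" if "u \<in> carrier ?R" "v \<in> carrier ?R" for u v
        using that by (simp add: app)
          (simp add: stage_simps standard_block_hom(1)[OF comp(1)[OF that(1)] comp(2)[OF that(1)] comp(1)[OF that(2)] comp(2)[OF that(2)]])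
      show "?f (c \<odot>\<^bsub>?R\<^esub> u) = c \<odot>\<^bsub>?S\<^esub> ?f u" if "u \<in> carrier ?R" for u c
        using that closed[OF that] by (simp add: app)
          (simp add: stage_simps standard_block_hom(3)[OF comp(1)[OF that] comp(2)[OF that] comp(1)[OF that] comp(2)[OF that]])
      show "?f (star ?R u) = star ?S (?f u)" if "u \<in> carrier ?R" for u
        using that closed[OF that] by (simp add: app)
          (simp add: stage_simps standard_block_hom(4)[OF comp(1)[OF that] comp(2)[OF that] comp(1)[OF that] comp(2)[OF that]])
      show "?f \<one>\<^bsub>?R\<^esub> = \<one>\<^bsub>?S\<^esub>" by (simp add: app) (simp add: stage_simps one)
    qed
  qed
  then show ?thesis by (simp add: ensemble_def)
qed

section \<open>Ranks of idempotents of the limit\<close>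

definition component :: "bool \<Rightarrow> complex mat \<times> complex mat \<Rightarrow> complex mat" where
  "component c u = (if c then fst u else snd u)"

locale ensemble_member =
  fixes n :: nat and g :: "nat \<Rightarrow> nat" and \<phi> :: "nat \<Rightarrow> complex mat \<times> complex mat \<Rightarrow> complex mat \<times> complex mat"
  assumes member: "\<phi> \<in> ensemble n g"
begin

sublocale normed_ring_system "stage n g" \<phi>
  by (rule normed_ring_system_ensemble[OF member])

abbreviation limit :: "(nat \<Rightarrow> complex mat \<times> complex mat) set star_algebra" where
  "limit \<equiv> direct_limit (stage n g) \<phi>"

abbreviation sequences :: "(nat \<Rightarrow> complex mat \<times> complex mat) set" where
  "sequences \<equiv> limit_seqs (stage n g) \<phi>"

lemma component_carrier: "u \<in> carrier (stage n g r) \<Longrightarrow> component c u \<in> carrier_mat (g r * n) (g r * n)"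
  by (auto simp: component_def stage_simps)

lemma component_norm_le: "mat_op_norm (component c u) \<le> cnorm (stage n g r) u"
  by (auto simp: component_def stage_simps)

lemma component_mult: "component c (u \<otimes>\<^bsub>stage n g r\<^esub> v) = component c u * component c v"
  by (auto simp: component_def stage_simps)

lemma component_add: "component c (u \<oplus>\<^bsub>stage n g r\<^esub> v) = component c u + component c v"
  by (auto simp: component_def stage_simps)

lemma component_gap:
  assumes "u \<in> carrier (stage n g r)" "v \<in> carrier (stage n g r)"
  shows "mat_op_norm (component c u - component c v) \<le> gap r u v"
  using component_norm_le[of c "u \<ominus>\<^bsub>stage n g r\<^esub> v" r] unfolding stage_minus[OF assms]
  by (auto simp: component_def)

lemma eventually_near_idempotent:
  assumes a: "a \<in> sequences" "idempotent_elt limit (limit_class a)"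
    and C: "C \<ge> 1" "\<And>r. cnorm (stage n g r) (a r) \<le> C" and \<delta>: "\<delta> > 0"
  shows "eventually (\<lambda>r. \<forall>c. near_idempotent C (g r * n) (component c (a r)) \<and>
    mat_op_norm (component c (a r) * component c (a r) - component c (a r)) < \<delta>) sequentially"
proof -
  have "(\<lambda>r. gap r (mult_seq a a r) (a r)) \<longlonglongrightarrow> 0"
    using a(2) limit_class_eq_iff[OF limit_seqs_closed(2)[OF a(1) a(1)] a(1)]
    by (simp add: idempotent_elt_def limit_class_mult[OF a(1) a(1)])
  moreover have "min \<delta> (1 / (64 * C\<^sup>2)) > 0" using C \<delta> by auto
  ultimately have "eventually (\<lambda>r. gap r (mult_seq a a r) (a r) < min \<delta> (1 / (64 * C\<^sup>2))) sequentially"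
    by (rule order_tendstoD(2))
  then show ?thesis
  proof eventually_elim
    case (elim r)
    have car: "a r \<in> carrier (stage n g r)" by (rule limit_carrier[OF a(1)])
    show ?case
    proof
      fix c
      have "mat_op_norm (component c (a r) * component c (a r) - component c (a r)) < min \<delta> (1 / (64 * C\<^sup>2))"
        using component_gap[of "a r \<otimes>\<^bsub>stage n g r\<^esub> a r" r "a r" c] car elim unfolding component_mult by auto
      then show "near_idempotent C (g r * n) (component c (a r)) \<and>
          mat_op_norm (component c (a r) * component c (a r) - component c (a r)) < \<delta>"
        using component_carrier[OF car] component_norm_le[of c "a r" r] C(2)[of r]
        unfolding near_idempotent_def by auto
    qed
  qed
qed

lemma near_rank_equivalent:
  assumes a: "a \<in> sequences" "idempotent_elt limit (limit_class a)"
    and b: "b \<in> sequences" "idempotent_elt limit (limit_class b)"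
    and eq: "equivalent_elts limit (limit_class a) (limit_class b)"
  shows "eventually (\<lambda>r. \<forall>c. near_rank (component c (a r)) = near_rank (component c (b r))) sequentially"
proof -
  obtain X Y where XY: "X \<in> carrier limit" "Y \<in> carrier limit"
    "X \<otimes>\<^bsub>limit\<^esub> Y = limit_class a" "Y \<otimes>\<^bsub>limit\<^esub> X = limit_class b"
    using eq unfolding equivalent_elts_def by blast
  obtain x where x: "x \<in> sequences" "X = limit_class x" using direct_limit_carrierE[OF XY(1)] .
  obtain y where y: "y \<in> sequences" "Y = limit_class y" using direct_limit_carrierE[OF XY(2)] .
  obtain A B M N where bd: "A \<ge> 1" "\<And>r. cnorm (stage n g r) (a r) \<le> A" "B \<ge> 1" "\<And>r. cnorm (stage n g r) (b r) \<le> B"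
    "M \<ge> 1" "\<And>r. cnorm (stage n g r) (x r) \<le> M" "N \<ge> 1" "\<And>r. cnorm (stage n g r) (y r) \<le> N"
    using limit_bounded[OF a(1)] limit_bounded[OF b(1)] limit_bounded[OF x(1)] limit_bounded[OF y(1)] by blast
  define C where "C = A + B + M + N"
  have C: "C \<ge> 1" "A \<le> C" "B \<le> C" "M \<le> C" "N \<le> C" using bd by (auto simp: C_def)
  have pos: "0 < 1 / (64 * C\<^sup>2)" using C by auto
  have "(\<lambda>r. gap r (mult_seq x y r) (a r)) \<longlonglongrightarrow> 0"
    using XY(3) limit_class_eq_iff[OF limit_seqs_closed(2)[OF x(1) y(1)] a(1)]
    by (simp add: x y limit_class_mult[OF x(1) y(1)])
  then have 1: "eventually (\<lambda>r. gap r (mult_seq x y r) (a r) < 1 / (64 * C\<^sup>2)) sequentially"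
    using pos by (rule order_tendstoD(2))
  have "(\<lambda>r. gap r (mult_seq y x r) (b r)) \<longlonglongrightarrow> 0"
    using XY(4) limit_class_eq_iff[OF limit_seqs_closed(2)[OF y(1) x(1)] b(1)]
    by (simp add: x y limit_class_mult[OF y(1) x(1)])
  then have 2: "eventually (\<lambda>r. gap r (mult_seq y x r) (b r) < 1 / (64 * C\<^sup>2)) sequentially"
    using pos by (rule order_tendstoD(2))
  have 3: "eventually (\<lambda>r. \<forall>c. near_idempotent C (g r * n) (component c (a r)) \<and>
    mat_op_norm (component c (a r) * component c (a r) - component c (a r)) < 1) sequentially"
    using order_trans[OF bd(2) C(2)] by (intro eventually_near_idempotent[OF a C(1)]) auto
  have 4: "eventually (\<lambda>r. \<forall>c. near_idempotent C (g r * n) (component c (b r)) \<and>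
    mat_op_norm (component c (b r) * component c (b r) - component c (b r)) < 1) sequentially"
    using order_trans[OF bd(4) C(3)] by (intro eventually_near_idempotent[OF b C(1)]) auto
  show ?thesis using 1 2 3 4
  proof eventually_elim
    case (elim r)
    have car: "x r \<in> carrier (stage n g r)" "y r \<in> carrier (stage n g r)"
      "a r \<in> carrier (stage n g r)" "b r \<in> carrier (stage n g r)"
      using limit_carrier x(1) y(1) a(1) b(1) by auto
    show ?case
    proof
      fix c
      show "near_rank (component c (a r)) = near_rank (component c (b r))"
      proof (rule near_rank_eq_if_equivalent[OF _ _ C(1), of "g r * n" _ "g r * n" _ "component c (x r)" "component c (y r)"])
        show "mat_op_norm (component c (x r)) \<le> C" "mat_op_norm (component c (y r)) \<le> C"
          using component_norm_le[of c "x r" r] component_norm_le[of c "y r" r] bd(6)[of r] bd(8)[of r] C by linarith+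
        show "mat_op_norm (component c (x r) * component c (y r) - component c (a r)) < 1 / (64 * C\<^sup>2)"
          using component_gap[of "x r \<otimes>\<^bsub>stage n g r\<^esub> y r" r "a r" c] car elim unfolding component_mult by auto
        show "mat_op_norm (component c (y r) * component c (x r) - component c (b r)) < 1 / (64 * C\<^sup>2)"
          using component_gap[of "y r \<otimes>\<^bsub>stage n g r\<^esub> x r" r "b r" c] car elim unfolding component_mult by auto
      qed (use elim car component_carrier in auto)
    qed
  qed
qed

lemma idempotent_self_equivalent: "idempotent_elt R e \<Longrightarrow> equivalent_elts R e e"
  unfolding idempotent_elt_def equivalent_elts_def by blast

text \<open>Products that vanish in the limit are small at late stages, which is what additivity of the rank
  requires.\<close>

lemma near_rank_add:
  assumes a: "a \<in> sequences" "idempotent_elt limit (limit_class a)"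
    and b: "b \<in> sequences" "idempotent_elt limit (limit_class b)"
    and ab: "limit_class a \<otimes>\<^bsub>limit\<^esub> limit_class b = \<zero>\<^bsub>limit\<^esub>"
    and ba: "limit_class b \<otimes>\<^bsub>limit\<^esub> limit_class a = \<zero>\<^bsub>limit\<^esub>"
  shows "eventually (\<lambda>r. \<forall>c. near_rank (component c (a r \<oplus>\<^bsub>stage n g r\<^esub> b r))
    = near_rank (component c (a r)) + near_rank (component c (b r))) sequentially"
proof -
  obtain A B where bd: "A \<ge> 1" "\<And>r. cnorm (stage n g r) (a r) \<le> A" "B \<ge> 1" "\<And>r. cnorm (stage n g r) (b r) \<le> B"
    using limit_bounded[OF a(1)] limit_bounded[OF b(1)] by blast
  define C where "C = A + B"
  have C: "C \<ge> 1" "A \<le> C" "B \<le> C" using bd by (auto simp: C_def)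
  have pos: "0 < 1 / (64 * C\<^sup>2)" using C by auto
  have 1: "eventually (\<lambda>r. cnorm (stage n g r) (mult_seq a b r) < 1 / (64 * C\<^sup>2)) sequentially"
    using ab limit_class_zero_iff[OF limit_seqs_closed(2)[OF a(1) b(1)]] pos
    by (intro order_tendstoD(2)) (auto simp: limit_class_mult[OF a(1) b(1)])
  have 2: "eventually (\<lambda>r. cnorm (stage n g r) (mult_seq b a r) < 1 / (64 * C\<^sup>2)) sequentially"
    using ba limit_class_zero_iff[OF limit_seqs_closed(2)[OF b(1) a(1)]] pos
    by (intro order_tendstoD(2)) (auto simp: limit_class_mult[OF b(1) a(1)])
  have 3: "eventually (\<lambda>r. \<forall>c. near_idempotent C (g r * n) (component c (a r)) \<and>
    mat_op_norm (component c (a r) * component c (a r) - component c (a r)) < 1) sequentially"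
    using order_trans[OF bd(2) C(2)] by (intro eventually_near_idempotent[OF a C(1)]) auto
  have 4: "eventually (\<lambda>r. \<forall>c. near_idempotent C (g r * n) (component c (b r)) \<and>
    mat_op_norm (component c (b r) * component c (b r) - component c (b r)) < 1) sequentially"
    using order_trans[OF bd(4) C(3)] by (intro eventually_near_idempotent[OF b C(1)]) auto
  show ?thesis using 1 2 3 4
  proof eventually_elim
    case (elim r)
    show ?case
    proof
      fix c
      have "mat_op_norm (component c (a r) * component c (b r)) < 1 / (64 * C\<^sup>2)"
        "mat_op_norm (component c (b r) * component c (a r)) < 1 / (64 * C\<^sup>2)"
        using component_norm_le[of c "a r \<otimes>\<^bsub>stage n g r\<^esub> b r" r] component_norm_le[of c "b r \<otimes>\<^bsub>stage n g r\<^esub> a r" r] elim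
        unfolding component_mult by linarith+
      then show "near_rank (component c (a r \<oplus>\<^bsub>stage n g r\<^esub> b r))
          = near_rank (component c (a r)) + near_rank (component c (b r))"
        unfolding component_add using elim C(1)
        by (intro antisym near_rank_subadditive[of C "g r * n"] near_rank_superadditive[of C "g r * n"]) auto
    qed
  qed
qed

text \<open>Each relation between classes becomes an approximate relation at all late stages, and the rank
  turns it into an exact relation between integers.\<close>

lemma near_rank_multiple:
  assumes "multiple limit (limit_class f) N E" and f: "f \<in> sequences"
    and e: "e \<in> sequences" "E = limit_class e"
  shows "eventually (\<lambda>r. \<forall>c. near_rank (component c (e r)) = N * near_rank (component c (f r))) sequentially"
  using assms(1) e
proof (induction arbitrary: e rule: multiple.induct)
  case (one E)
  then show ?case using near_rank_equivalent[of e f] f by simp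
next
  case (add N E E')
  have idE: "idempotent_elt limit E" and idf: "idempotent_elt limit (limit_class f)"
    using multiple_idempotent[OF add(1)] by auto
  obtain a where a: "a \<in> sequences" "E = limit_class a"
    using idE direct_limit_carrierE[of E] by (auto simp: idempotent_elt_def)
  obtain b where b: "b \<in> sequences" "E' = limit_class b"
    using add(2) direct_limit_carrierE[of E'] by (auto simp: idempotent_elt_def)
  have sum: "limit_class (add_seq b a) = limit_class e"
    using add.prems(2) limit_class_add[OF b(1) a(1)] by (simp add: a b)
  have ba: "add_seq b a \<in> sequences" using limit_seqs_closed(1)[OF b(1) a(1)] .
  have ide: "idempotent_elt limit (limit_class e)" using add(6) add.prems(2) by simp
  have 1: "eventually (\<lambda>r. \<forall>c. near_rank (component c (e r)) = near_rank (component c (add_seq b a r))) sequentially"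
    using near_rank_equivalent[OF add.prems(1) ide ba] idempotent_self_equivalent[OF ide] ide unfolding sum by blast
  have 2: "eventually (\<lambda>r. \<forall>c. near_rank (component c (add_seq b a r))
      = near_rank (component c (b r)) + near_rank (component c (a r))) sequentially"
    using near_rank_add[OF b(1) _ a(1)] add(2,4,5) idE unfolding a b by blast
  have 3: "eventually (\<lambda>r. \<forall>c. near_rank (component c (b r)) = near_rank (component c (f r))) sequentially"
    using near_rank_equivalent[OF b(1) _ f idf] add(2,3) unfolding b by blast
  have 4: "eventually (\<lambda>r. \<forall>c. near_rank (component c (a r)) = N * near_rank (component c (f r))) sequentially"
    using add.IH[OF a] .
  show ?case using 1 2 3 4 by eventually_elim simp
qed

text \<open>\<open>a (Suc r)\<close> and \<open>\<phi> r (a r)\<close> are close near idempotents.  Close near idempotents are approximately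
  equivalent, as witnessed by \<open>x = y = a (Suc r)\<close>.\<close>

lemma near_rank_step:
  assumes a: "a \<in> sequences" "idempotent_elt limit (limit_class a)"
  shows "eventually (\<lambda>r. \<forall>c. near_rank (component c (a (Suc r))) = near_rank (component c (\<phi> r (a r)))) sequentially"
proof -
  obtain C where C: "C \<ge> 1" "\<And>r. cnorm (stage n g r) (a r) \<le> C" using limit_bounded[OF a(1)] by blast
  \<comment> \<open>Two errors of this size add up to the tolerance for near idempotents.\<close>
  have pos: "0 < 1 / (128 * C\<^sup>2)" using C by auto
  have 1: "eventually (\<lambda>r. gap (Suc r) (a (Suc r)) (\<phi> r (a r)) < 1 / (128 * C\<^sup>2)) sequentially"
    using limit_seqs_asymptotically_coherent[OF a(1)] pos by (rule order_tendstoD(2))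
  have 2: "eventually (\<lambda>r. \<forall>c. near_idempotent C (g r * n) (component c (a r)) \<and>
    mat_op_norm (component c (a r) * component c (a r) - component c (a r)) < 1 / (128 * C\<^sup>2)) sequentially"
    by (rule eventually_near_idempotent[OF a C pos])
  have 3: "eventually (\<lambda>r. \<forall>c. near_idempotent C (g (Suc r) * n) (component c (a (Suc r))) \<and>
    mat_op_norm (component c (a (Suc r)) * component c (a (Suc r)) - component c (a (Suc r))) < 1 / (128 * C\<^sup>2)) sequentially"
    using 2 by (subst (asm) eventually_sequentially_Suc[symmetric])
  have "(\<lambda>r. gap r (mult_seq a a r) (a r)) \<longlonglongrightarrow> 0"
    using a(2) limit_class_eq_iff[OF limit_seqs_closed(2)[OF a(1) a(1)] a(1)]
    by (simp add: idempotent_elt_def limit_class_mult[OF a(1) a(1)])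
  moreover have "0 < 1 / (64 * C\<^sup>2)" using C by auto
  ultimately have 4: "eventually (\<lambda>r. gap r (mult_seq a a r) (a r) < 1 / (64 * C\<^sup>2)) sequentially"
    by (rule order_tendstoD(2))
  show ?thesis using 1 3 4
  proof eventually_elim
    case (elim r)
    have car: "a (Suc r) \<in> carrier (stage n g (Suc r))" "a r \<in> carrier (stage n g r)"
      using limit_carrier[OF a(1)] by auto
    then have \<phi>car: "\<phi> r (a r) \<in> carrier (stage n g (Suc r))" by (intro hom_carrier)
    show ?case
    proof
      fix c
      let ?k = "g (Suc r) * n"
      let ?e = "component c (a (Suc r))" and ?f = "component c (\<phi> r (a r))"
      have ef: "?e \<in> carrier_mat ?k ?k" "?f \<in> carrier_mat ?k ?k" using component_carrier car \<phi>car by auto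
      have e: "near_idempotent C ?k ?e" "mat_op_norm (?e * ?e - ?e) < 1 / (128 * C\<^sup>2)" using elim by auto
      have gap: "mat_op_norm (?e - ?f) < 1 / (128 * C\<^sup>2)"
        using component_gap[OF car(1) \<phi>car, of c] elim by linarith
      have "gap (Suc r) (\<phi> r (a r \<otimes>\<^bsub>stage n g r\<^esub> a r)) (\<phi> r (a r)) < 1 / (64 * C\<^sup>2)"
        using gap_hom[of "a r \<otimes>\<^bsub>stage n g r\<^esub> a r" r "a r"] car elim by auto
      then have "mat_op_norm (?f * ?f - ?f) < 1 / (64 * C\<^sup>2)"
        using component_gap[of "\<phi> r (a r) \<otimes>\<^bsub>stage n g (Suc r)\<^esub> \<phi> r (a r)" "Suc r" "\<phi> r (a r)" c] \<phi>car car
        unfolding component_mult by (auto simp: hom_mult)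
      moreover have "mat_op_norm ?f \<le> C"
        using component_norm_le[of c "\<phi> r (a r)" "Suc r"] hom_norm[OF car(2)] C(2)[of r] by linarith
      ultimately have f: "near_idempotent C ?k ?f" using ef by (simp add: near_idempotent_def)
      have "?e * ?e - ?f = (?e * ?e - ?e) + (?e - ?f)" using ef by (intro eq_matI) auto
      then have "mat_op_norm (?e * ?e - ?f) \<le> mat_op_norm (?e * ?e - ?e) + mat_op_norm (?e - ?f)"
        using mat_op_norm_triangle[OF minus_carrier_mat[OF ef(1)] minus_carrier_mat[OF ef(2)], of "?e * ?e" ?e]
        by simp
      also have "\<dots> < 1 / (128 * C\<^sup>2) + 1 / (128 * C\<^sup>2)" using e(2) gap by (rule add_strict_mono)
      finally have "mat_op_norm (?e * ?e - ?f) < 1 / (64 * C\<^sup>2)" by simp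
      then show "near_rank ?e = near_rank ?f"
        using e f C ef by (intro near_rank_eq_if_equivalent[OF e(1) f C(1), of ?e ?e])
          (auto simp: near_idempotent_def)
    qed
  qed
qed

text \<open>Rank zero bounds the norm by 1/4, and then \<open>\<parallel>a\<parallel> \<le> \<parallel>a\<parallel>\<^sup>2 + \<parallel>a\<^sup>2 - a\<parallel>\<close> forces the norms to tend to zero along with
  the defect of idempotence.\<close>

lemma near_rank_zero_imp_zero:
  assumes a: "a \<in> sequences" "idempotent_elt limit (limit_class a)"
    and 0: "eventually (\<lambda>r. \<forall>c. near_rank (component c (a r)) = 0) sequentially"
  shows "limit_class a = \<zero>\<^bsub>limit\<^esub>"
proof -
  obtain C where C: "C \<ge> 1" "\<And>r. cnorm (stage n g r) (a r) \<le> C" using limit_bounded[OF a(1)] by blast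
  have t: "(\<lambda>r. gap r (mult_seq a a r) (a r)) \<longlonglongrightarrow> 0"
    using a(2) limit_class_eq_iff[OF limit_seqs_closed(2)[OF a(1) a(1)] a(1)]
    by (simp add: idempotent_elt_def limit_class_mult[OF a(1) a(1)])
  have "eventually (\<lambda>r. \<forall>c. near_idempotent C (g r * n) (component c (a r)) \<and>
    mat_op_norm (component c (a r) * component c (a r) - component c (a r)) < 1) sequentially"
    using C by (intro eventually_near_idempotent[OF a]) auto
  then have le: "eventually (\<lambda>r. cnorm (stage n g r) (a r) \<le> 2 * gap r (mult_seq a a r) (a r)) sequentially"
    using 0
  proof eventually_elim
    case (elim r)
    have car: "a r \<in> carrier (stage n g r)" by (rule limit_carrier[OF a(1)])
    have "mat_op_norm (component c (a r)) \<le> 1/4" for c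
      using elim C by (intro near_rank_0_norm_le[of C "g r * n"]) auto
    from this[of True] this[of False] have q: "cnorm (stage n g r) (a r) \<le> 1/4"
      by (simp add: component_def stage_simps)
    have "cnorm (stage n g r) (a r) \<le> cnorm (stage n g r) (mult_seq a a r) + gap r (a r) (mult_seq a a r)"
      using car by (intro norm_le_gap) auto
    also have "gap r (a r) (mult_seq a a r) = gap r (mult_seq a a r) (a r)" using car by (intro gap_sym) auto
    also have "cnorm (stage n g r) (mult_seq a a r) \<le> cnorm (stage n g r) (a r) * cnorm (stage n g r) (a r)"
      using car by (intro norm_mult) auto
    also have "\<dots> \<le> 1/4 * cnorm (stage n g r) (a r)"
      using q norm_nonneg[OF car] by (intro mult_right_mono) auto
    finally show ?case using norm_nonneg[of "mult_seq a a r \<ominus>\<^bsub>stage n g r\<^esub> a r" r] car by simp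
  qed
  have "(\<lambda>r. cnorm (stage n g r) (a r)) \<longlonglongrightarrow> 0"
  proof (rule tendsto_sandwich[OF _ le tendsto_const])
    show "(\<lambda>r. 2 * gap r (mult_seq a a r) (a r)) \<longlonglongrightarrow> 0" using tendsto_mult_left[OF t, of 2] by simp
  qed (use norm_nonneg limit_carrier[OF a(1)] in auto)
  then show ?thesis using limit_class_zero_iff[OF a(1)] by simp
qed

end

section \<open>Diagonal projections\<close>

definition diag_proj :: "nat \<Rightarrow> nat set \<Rightarrow> complex mat" where
  "diag_proj k I = mat k k (\<lambda>(i, j). if i = j \<and> i \<in> I then 1 else 0)"

lemma diag_proj_carrier [simp, intro]: "diag_proj k I \<in> carrier_mat k k"
  by (simp add: diag_proj_def)

lemma sum_indicator_product:
  "finite S \<Longrightarrow> (\<Sum>j\<in>S. (if j = s \<and> P then 1 else 0) * (if j = t \<and> Q then 1 else (0 :: complex)))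
    = (if s \<in> S \<and> s = t \<and> P \<and> Q then 1 else 0)"
proof -
  assume "finite S"
  have "(\<Sum>j\<in>S. (if j = s \<and> P then 1 else 0) * (if j = t \<and> Q then 1 else (0 :: complex)))
      = (\<Sum>j\<in>S. if j = s then (if s = t \<and> P \<and> Q then 1 else 0) else 0)"
    by (intro sum.cong) auto
  then show ?thesis using \<open>finite S\<close> by (simp add: sum.delta)
qed

lemma diag_proj_mult: "diag_proj k I * diag_proj k J = diag_proj k (I \<inter> J)"
proof (rule eq_matI)
  fix i j assume "i < dim_row (diag_proj k (I \<inter> J))" "j < dim_col (diag_proj k (I \<inter> J))"
  then have ij: "i < k" "j < k" by (auto simp: diag_proj_def)
  have "(diag_proj k I * diag_proj k J) $$ (i, j)
      = (\<Sum>l<k. (if l = i \<and> i \<in> I then 1 else 0) * (if l = j \<and> j \<in> J then 1 else 0))"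
    using ij by (auto simp: diag_proj_def scalar_prod_def lessThan_atLeast0 intro!: sum.cong)
  also have "\<dots> = (if i = j \<and> i \<in> I \<and> j \<in> J then 1 else 0)"
    using ij by (subst sum_indicator_product) auto
  finally show "(diag_proj k I * diag_proj k J) $$ (i, j) = diag_proj k (I \<inter> J) $$ (i, j)"
    using ij by (auto simp: diag_proj_def)
qed (auto simp: diag_proj_def)

lemma diag_proj_add: "I \<inter> J = {} \<Longrightarrow> diag_proj k I + diag_proj k J = diag_proj k (I \<union> J)"
  by (intro eq_matI) (auto simp: diag_proj_def)

lemma diag_proj_empty: "diag_proj k {} = 0\<^sub>m k k"
  by (intro eq_matI) (auto simp: diag_proj_def)

lemma diag_proj_full: "diag_proj k {..<k} = 1\<^sub>m k"
  by (intro eq_matI) (auto simp: diag_proj_def)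

lemma diag_proj_norm_ge:
  assumes "I \<subseteq> {..<k}" "I \<noteq> {}"
  shows "1 \<le> mat_op_norm (diag_proj k I)"
proof -
  obtain i where i: "i \<in> I" "i < k" using assms by auto
  let ?v = "unit_vec k i :: complex vec"
  have eq: "diag_proj k I *\<^sub>v ?v = ?v"
    using i by (intro eq_vecI) (auto simp: diag_proj_def scalar_prod_def unit_vec_def if_distrib sum.delta cong: if_cong)
  have "(vec_l2_norm ?v)\<^sup>2 = (\<Sum>j<k. (cmod (?v $ j))\<^sup>2)"
    by (rule vec_l2_norm_power2) simp
  also have "\<dots> = (\<Sum>j<k. if j = i then 1 else 0)"
    by (intro sum.cong) (auto simp: unit_vec_def)
  finally have "(vec_l2_norm ?v)\<^sup>2 = (\<Sum>j<k. if j = i then 1 else 0)" .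
  then have "(vec_l2_norm ?v)\<^sup>2 = 1\<^sup>2" using i by simp
  then have "vec_l2_norm ?v = 1" by (rule power2_eq_imp_eq) auto
  then show ?thesis using mat_op_norm_mult_vec_le[of "diag_proj k I" k k ?v] eq by simp
qed

text \<open>The partial permutation matrices of a bijection between the two index sets are witnesses.\<close>

lemma diag_proj_equivalent:
  assumes "I \<subseteq> {..<k}" "J \<subseteq> {..<k}" "card I = card J"
  shows "\<exists>x\<in>carrier_mat k k. \<exists>y\<in>carrier_mat k k. x * y = diag_proj k I \<and> y * x = diag_proj k J"
proof -
  have fin: "finite I" "finite J" using assms finite_subset by auto
  obtain \<sigma> where \<sigma>: "bij_betw \<sigma> I J" using finite_same_card_bij[OF fin assms(3)] by blast
  define \<tau> where "\<tau> = inv_into I \<sigma>"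
  have \<tau>: "i \<in> I \<Longrightarrow> \<tau> (\<sigma> i) = i" "j \<in> J \<Longrightarrow> \<sigma> (\<tau> j) = j" "i \<in> I \<Longrightarrow> \<sigma> i \<in> J" "j \<in> J \<Longrightarrow> \<tau> j \<in> I" for i j
    using \<sigma> by (auto simp: \<tau>_def bij_betw_inv_into_left bij_betw_inv_into_right bij_betw_apply
      intro: bij_betw_apply[OF bij_betw_inv_into])
  let ?x = "mat k k (\<lambda>(i, j). if j = \<sigma> i \<and> i \<in> I then 1 else 0) :: complex mat"
  let ?y = "mat k k (\<lambda>(j, i). if j = \<sigma> i \<and> i \<in> I then 1 else 0) :: complex mat"
  have "?x * ?y = diag_proj k I"
  proof (rule eq_matI)
    fix i j assume "i < dim_row (diag_proj k I)" "j < dim_col (diag_proj k I)"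
    then have ij: "i < k" "j < k" by (auto simp: diag_proj_def)
    have "(?x * ?y) $$ (i, j) = (\<Sum>l<k. (if l = \<sigma> i \<and> i \<in> I then 1 else 0) * (if l = \<sigma> j \<and> j \<in> I then 1 else 0))"
      using ij by (auto simp: scalar_prod_def lessThan_atLeast0 intro!: sum.cong)
    also have "\<dots> = (if \<sigma> i < k \<and> \<sigma> i = \<sigma> j \<and> i \<in> I \<and> j \<in> I then 1 else 0)"
      by (subst sum_indicator_product) auto
    also have "\<dots> = diag_proj k I $$ (i, j)"
    proof -
      have "(\<sigma> i < k \<and> \<sigma> i = \<sigma> j \<and> i \<in> I \<and> j \<in> I) \<longleftrightarrow> i = j \<and> i \<in> I"
        using \<tau>(1,3) assms(2) by (metis lessThan_iff subsetD)
      then show ?thesis using ij by (simp add: diag_proj_def)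
    qed
    finally show "(?x * ?y) $$ (i, j) = diag_proj k I $$ (i, j)" .
  qed (auto simp: diag_proj_def)
  moreover have "?y * ?x = diag_proj k J"
  proof (rule eq_matI)
    fix i j assume "i < dim_row (diag_proj k J)" "j < dim_col (diag_proj k J)"
    then have ij: "i < k" "j < k" by (auto simp: diag_proj_def)
    have "(?y * ?x) $$ (i, j) = (\<Sum>l<k. (if i = \<sigma> l \<and> l \<in> I then 1 else 0) * (if j = \<sigma> l \<and> l \<in> I then 1 else 0))"
      using ij by (auto simp: scalar_prod_def lessThan_atLeast0 intro!: sum.cong)
    also have "\<dots> = (\<Sum>l<k. (if l = \<tau> i \<and> i \<in> J then 1 else 0) * (if l = \<tau> j \<and> j \<in> J then 1 else 0))"
      using \<tau> by (intro sum.cong refl arg_cong2[of _ _ _ _ "(*)"] if_cong) metis+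
    also have "\<dots> = (if \<tau> i < k \<and> \<tau> i = \<tau> j \<and> i \<in> J \<and> j \<in> J then 1 else 0)"
      by (subst sum_indicator_product) auto
    also have "\<dots> = diag_proj k J $$ (i, j)"
    proof -
      have "(\<tau> i < k \<and> \<tau> i = \<tau> j \<and> i \<in> J \<and> j \<in> J) \<longleftrightarrow> i = j \<and> i \<in> J"
        using \<tau>(2,4) assms(1) by (metis lessThan_iff subsetD)
      then show ?thesis using ij by (simp add: diag_proj_def)
    qed
    finally show "(?y * ?x) $$ (i, j) = diag_proj k J $$ (i, j)" .
  qed (auto simp: diag_proj_def)
  ultimately show ?thesis by (intro bexI[of _ ?x] bexI[of _ ?y]) auto
qed

lemma block2_diag_proj:
  assumes "I \<subseteq> {..<k}"
  shows "block2 (diag_proj k I) (diag_proj l J) = diag_proj (k + l) (I \<union> (+) k ` J)"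
proof -
  have img: "j \<in> (+) k ` J \<longleftrightarrow> k \<le> j \<and> j - k \<in> J" for j
    by (auto intro: image_eqI[of _ _ "j - k"])
  show ?thesis
    using assms by (intro eq_matI) (auto simp: block2_def diag_proj_def img)
qed

lemma blocks_diag_proj:
  assumes "\<And>i. I i \<subseteq> {..<k}"
  shows "\<exists>K\<subseteq>{..<length w * k}. card K = (\<Sum>i\<leftarrow>w. card (I i)) \<and>
    diag_block_mat (map (\<lambda>i. diag_proj k (I i)) w) = diag_proj (length w * k) K"
proof (induction w)
  case Nil
  show ?case by (auto simp: diag_proj_empty)
next
  case (Cons i w)
  then obtain K where K: "K \<subseteq> {..<length w * k}" "card K = (\<Sum>i\<leftarrow>w. card (I i))"
    "diag_block_mat (map (\<lambda>i. diag_proj k (I i)) w) = diag_proj (length w * k) K" by blast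
  have "diag_block_mat (map (\<lambda>i. diag_proj k (I i)) (i # w)) = diag_proj (k + length w * k) (I i \<union> (+) k ` K)"
    unfolding list.map diag_block_mat_Cons K(3) by (rule block2_diag_proj[OF assms])
  moreover have "card (I i \<union> (+) k ` K) = card (I i) + card K"
  proof -
    have "finite (I i)" "finite K" using assms[of i] K(1) finite_subset by auto
    moreover have "I i \<inter> (+) k ` K = {}" using assms[of i] by auto
    ultimately show ?thesis by (simp add: card_Un_disjoint card_image)
  qed
  moreover have "I i \<union> (+) k ` K \<subseteq> {..<k + length w * k}" using assms[of i] K(1) by fastforce
  ultimately show ?case using K(2) by (intro exI[of _ "I i \<union> (+) k ` K"]) simp
qed

lemma multiple_diag_proj:
  assumes "I \<subseteq> {..<g r * n}" "J \<subseteq> {..<g r * n}" "card I = N * card J" "N \<ge> 1"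
  shows "multiple (stage n g r) (0\<^sub>m (g r * n) (g r * n), diag_proj (g r * n) J) N
    (0\<^sub>m (g r * n) (g r * n), diag_proj (g r * n) I)"
proof -
  let ?k = "g r * n"
  let ?e = "\<lambda>I. (0\<^sub>m ?k ?k, diag_proj ?k I)"
  have id: "idempotent_elt (stage n g r) (?e I)" for I
    by (auto simp: idempotent_elt_def stage_simps diag_proj_mult)
  have eq: "equivalent_elts (stage n g r) (?e I) (?e J)"
    if IJ: "I \<subseteq> {..<?k}" "J \<subseteq> {..<?k}" "card I = card J" for I J
  proof -
    obtain x y where "x \<in> carrier_mat ?k ?k" "y \<in> carrier_mat ?k ?k"
      "x * y = diag_proj ?k I" "y * x = diag_proj ?k J"
      using diag_proj_equivalent[OF IJ] by blast
    then show ?thesis unfolding equivalent_elts_def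
      by (intro bexI[of _ "(0\<^sub>m ?k ?k, x)"] bexI[of _ "(0\<^sub>m ?k ?k, y)"]) (auto simp: stage_simps)
  qed
  show ?thesis using assms(4,1,3)
  proof (induction N arbitrary: I rule: dec_induct)
    case base
    then show ?case using multiple.one[OF id id eq[OF _ assms(2)], of I] by simp
  next
    case (step N)
    have "card J \<le> card I" using step.prems(2) by simp
    then obtain I1 where I1: "I1 \<subseteq> I" "card I1 = card J" by (rule obtain_subset_with_card_n)
    have fin: "finite I" by (rule finite_subset[OF step.prems(1)]) simp
    have card: "card (I - I1) = N * card J"
      using step.prems(2) card_Diff_subset[OF finite_subset[OF I1(1) fin] I1(1)] I1(2) by simp
    have "multiple (stage n g r) (?e J) N (?e (I - I1))"
      using step.prems(1) by (intro step.IH card) auto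
    moreover have "?e I1 \<otimes>\<^bsub>stage n g r\<^esub> ?e (I - I1) = \<zero>\<^bsub>stage n g r\<^esub>"
      "?e (I - I1) \<otimes>\<^bsub>stage n g r\<^esub> ?e I1 = \<zero>\<^bsub>stage n g r\<^esub>"
      by (simp_all add: stage_simps diag_proj_mult diag_proj_empty Int_commute[of "I - I1"])
    moreover have sum: "?e I1 \<oplus>\<^bsub>stage n g r\<^esub> ?e (I - I1) = ?e I"
      using I1(1) by (auto simp: stage_simps diag_proj_add Un_absorb1)
    moreover have "equivalent_elts (stage n g r) (?e I1) (?e J)"
      using I1 step.prems(1) assms(2) by (intro eq) auto
    ultimately have "multiple (stage n g r) (?e J) (Suc N) (?e I1 \<oplus>\<^bsub>stage n g r\<^esub> ?e (I - I1))"
      using id by (intro multiple.add) simp_all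
    then show ?case unfolding sum .
  qed
qed

section \<open>Recovering a set of primes from the limit algebra\<close>

text \<open>The first component of \<open>prod_decode\<close> takes every value infinitely often, so each element of \<open>S\<close> is
  proposed infinitely often.  The bound by half of the ratio makes the ideal infinitesimal.\<close>

definition multiplicity_choice :: "(nat \<Rightarrow> nat) \<Rightarrow> nat set \<Rightarrow> nat \<Rightarrow> nat" where
  "multiplicity_choice g S r =
     (let p = fst (prod_decode r) in if p \<in> S \<and> 2 * p \<le> growth_ratio g r then p else 1)"

lemma growth_sequence_pos: "growth_sequence g \<Longrightarrow> 0 < g r"
proof -
  assume "growth_sequence g"
  then have "g 0 = 1" "strict_mono g" by (auto simp: growth_sequence_def)
  then have "g 0 \<le> g r" using monoD[OF strict_mono_mono, of g 0 r] by simp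
  then show ?thesis using \<open>g 0 = 1\<close> by simp
qed

lemma growth_ratio_ge_2: "growth_sequence g \<Longrightarrow> 2 \<le> growth_ratio g r"
proof -
  assume g: "growth_sequence g"
  then have "g r < g (Suc r)" by (auto simp: growth_sequence_def strict_mono_Suc_iff)
  then have "growth_ratio g r * g r > 1 * g r" using growth_ratio_mult[OF g, of r] by simp
  then show ?thesis by (metis Suc_1 Suc_leI mult_less_cancel2 One_nat_def)
qed

lemma eventually_growth_ratio_ge:
  assumes "growth_sequence g"
  shows "eventually (\<lambda>r. b \<le> growth_ratio g r) sequentially"
proof -
  have "(\<lambda>r. 1 / (real (growth_ratio g r))\<^sup>2) \<longlonglongrightarrow> 0"
    using assms by (intro summable_LIMSEQ_zero) (simp add: growth_sequence_def)
  moreover have "0 < 1 / (real (b + 1))\<^sup>2" by simp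
  ultimately have "eventually (\<lambda>r. 1 / (real (growth_ratio g r))\<^sup>2 < 1 / (real (b + 1))\<^sup>2) sequentially"
    by (rule order_tendstoD(2))
  then show ?thesis
  proof eventually_elim
    case (elim r)
    have pos: "0 < real (growth_ratio g r)" using growth_ratio_ge_2[OF assms, of r] by simp
    have "(real (b + 1))\<^sup>2 < (real (growth_ratio g r))\<^sup>2"
      using elim pos by (simp add: divide_less_eq field_simps)
    then have "real (b + 1) < real (growth_ratio g r)" by (rule power2_less_imp_less) simp
    then show ?case by linarith
  qed
qed

lemma multiplicity_choice_le: "growth_sequence g \<Longrightarrow> 2 * multiplicity_choice g S r \<le> growth_ratio g r"
  using growth_ratio_ge_2[of g r] by (auto simp: multiplicity_choice_def Let_def)

lemma multiplicity_choice_cases: "multiplicity_choice g S r = 1 \<or> multiplicity_choice g S r \<in> S"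
  by (auto simp: multiplicity_choice_def Let_def)

lemma multiplicity_choice_infinitely_often:
  assumes "growth_sequence g" "p \<in> S"
  shows "\<exists>r\<ge>t. multiplicity_choice g S r = p"
proof -
  obtain s where s: "\<And>r. r \<ge> s \<Longrightarrow> 2 * p \<le> growth_ratio g r"
    using eventually_growth_ratio_ge[OF assms(1), of "2 * p"] by (auto simp: eventually_sequentially)
  let ?r = "prod_encode (p, max s t)"
  have "max s t \<le> ?r" using le_prod_encode_2 by simp
  then have "s \<le> ?r" "t \<le> ?r" by auto
  then show ?thesis using s[of ?r] assms(2) by (intro exI[of _ ?r]) (simp add: multiplicity_choice_def)
qed

lemma prime_power_dvd_prod_multiplicity:
  assumes "growth_sequence g" "p \<in> S"
  shows "\<exists>t. p ^ k dvd (\<Prod>r<t. multiplicity_choice g S r)"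
proof (induction k)
  case (Suc k)
  then obtain t where t: "p ^ k dvd (\<Prod>r<t. multiplicity_choice g S r)" by blast
  obtain s where s: "s \<ge> t" "multiplicity_choice g S s = p"
    using multiplicity_choice_infinitely_often[OF assms] by blast
  have "(\<Prod>r<t. multiplicity_choice g S r) dvd (\<Prod>r<s. multiplicity_choice g S r)"
    using s by (intro prod_dvd_prod_subset) auto
  then have "p ^ k * p dvd (\<Prod>r<Suc s. multiplicity_choice g S r)"
    using t s by (auto intro!: mult_dvd_mono intro: dvd_trans)
  then have "p ^ Suc k dvd (\<Prod>r<Suc s. multiplicity_choice g S r)" by (simp only: power_Suc2)
  then show ?case by blast
qed auto

context
  fixes n :: nat and g :: "nat \<Rightarrow> nat" and S :: "nat set"
  assumes n: "n \<ge> 1" and g: "growth_sequence g" and S: "S \<subseteq> {p. prime p}"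
begin

abbreviation mu :: "nat \<Rightarrow> nat" where "mu \<equiv> multiplicity_choice g S"

lemma choice_pos: "0 < mu r"
  using multiplicity_choice_cases[of g S r] S prime_gt_0_nat by auto

lemma choice_in_ensemble: "triangular n g mu \<in> ensemble n g"
  using multiplicity_choice_le[OF g, of S]
  by (intro triangular_in_ensemble[OF g]) (metis add_leD1 mult_2)

interpretation ensemble_member n g "triangular n g mu"
  by unfold_locales (rule choice_in_ensemble)

text \<open>At stage \<open>t\<close> the unit of the second summand of the first stage has rank \<open>n \<Prod>m\<close> in a matrix
  algebra of size \<open>g t * n\<close>; at least \<open>2 ^ t\<close> copies of it fit.\<close>

lemma prod_choice_le: "2 ^ t * (\<Prod>r<t. mu r) \<le> g t"
proof (induction t)
  case 0
  then show ?case using g by (simp add: growth_sequence_def)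
next
  case (Suc t)
  have "2 ^ Suc t * (\<Prod>r<Suc t. mu r) = (2 * mu t) * (2 ^ t * (\<Prod>r<t. mu r))" by simp
  also have "\<dots> \<le> growth_ratio g t * g t" using Suc multiplicity_choice_le[OF g] by (intro mult_mono) auto
  finally show ?case using growth_ratio_mult[OF g] by simp
qed

lemma push_unit:
  "\<exists>I\<subseteq>{..<g t * n}. card I = n * (\<Prod>r<t. mu r) \<and>
    push 0 (0\<^sub>m (g 0 * n) (g 0 * n), 1\<^sub>m (g 0 * n)) t = (0\<^sub>m (g t * n) (g t * n), diag_proj (g t * n) I)"
proof (induction t)
  case 0
  have "g 0 = 1" using g by (simp add: growth_sequence_def)
  then show ?case by (intro exI[of _ "{..<g 0 * n}"]) (simp add: diag_proj_full)
next
  case (Suc t)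
  let ?k = "g t * n" and ?l = "g (Suc t) * n"
  from Suc obtain I where I: "I \<subseteq> {..<?k}" "card I = n * (\<Prod>r<t. mu r)"
    "push 0 (0\<^sub>m (g 0 * n) (g 0 * n), 1\<^sub>m (g 0 * n)) t = (0\<^sub>m ?k ?k, diag_proj ?k I)" by blast
  have \<gamma>: "growth_ratio g t * ?k = ?l" using growth_ratio_mult[OF g, of t] by (simp flip: mult.assoc)
  have mu\<gamma>: "mu t \<le> growth_ratio g t" using multiplicity_choice_le[OF g, of S t] by simp
  let ?q = "growth_ratio g t - mu t"
  have 1: "standard_block (triangular_mult g mu t 1) (0\<^sub>m ?k ?k) (diag_proj ?k I) = 0\<^sub>m ?l ?l"
  proof -
    have "standard_block (triangular_mult g mu t 1) (0\<^sub>m ?k ?k) (diag_proj ?k I)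
        = diag_block_mat (map (\<lambda>i. 0\<^sub>m ?k ?k) (replicate (growth_ratio g t) True))"
      by (simp add: standard_block_def triangular_mult_def map_replicate)
    also have "\<dots> = 0\<^sub>m ?l ?l" unfolding blocks_zero by (simp add: \<gamma>)
    finally show ?thesis .
  qed
  let ?w = "block_word ?q (mu t)"
  have "(\<lambda>i. if i then 0\<^sub>m ?k ?k else diag_proj ?k I) = (\<lambda>i. diag_proj ?k (if i then {} else I))"
    by (auto simp: diag_proj_empty)
  then have sb: "standard_block (triangular_mult g mu t 2) (0\<^sub>m ?k ?k) (diag_proj ?k I)
      = diag_block_mat (map (\<lambda>i. diag_proj ?k (if i then {} else I)) ?w)"
    unfolding standard_block_word by (simp add: triangular_mult_def)
  have sub: "(if i then {} else I) \<subseteq> {..<?k}" for i using I(1) by simp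
  obtain K where K: "K \<subseteq> {..<length ?w * ?k}" "card K = (\<Sum>i\<leftarrow>?w. card (if i then {} else I))"
    "diag_block_mat (map (\<lambda>i. diag_proj ?k (if i then {} else I)) ?w) = diag_proj (length ?w * ?k) K"
    using blocks_diag_proj[of "\<lambda>i. if i then {} else I" ?k ?w, OF sub] by blast
  have len: "length ?w * ?k = ?l" using mu\<gamma> \<gamma> by (simp add: block_word_def)
  have "card K = mu t * card I" unfolding K(2) by (simp add: block_word_def sum_list_replicate map_replicate)
  then have "card K = n * (\<Prod>r<Suc t. mu r)" using I(2) by simp
  moreover have "push 0 (0\<^sub>m (g 0 * n) (g 0 * n), 1\<^sub>m (g 0 * n)) (Suc t) = (0\<^sub>m ?l ?l, diag_proj ?l K)"
    using I(3) 1 sb K(3) len by (simp add: triangular_def stage_simps)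
  ultimately show ?case using K(1) len by metis
qed

text \<open>The witness is the unit of the second summand of the first stage.  At stage \<open>t\<close> it is a diagonal
  projection whose rank is at most \<open>2 ^ (- t)\<close> times the matrix size and, for large \<open>t\<close>, divisible by
  any prescribed power of \<open>p\<close>; the required idempotents are diagonal projections at that stage.\<close>

lemma divisible_infinitesimal_if_in:
  assumes p: "p \<in> S"
  shows "divisible_infinitesimal limit p"
proof -
  let ?u = "(0\<^sub>m (g 0 * n) (g 0 * n), 1\<^sub>m (g 0 * n)) :: complex mat \<times> complex mat"
  let ?e = "canonical 0 ?u"
  have u: "?u \<in> carrier (stage n g 0)" by (simp add: stage_simps)
  have at_stage: "\<exists>I\<subseteq>{..<g t * n}. card I = n * (\<Prod>r<t. mu r) \<and>
      ?e = canonical t (0\<^sub>m (g t * n) (g t * n), diag_proj (g t * n) I) \<and>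
      push 0 ?u t = (0\<^sub>m (g t * n) (g t * n), diag_proj (g t * n) I)" for t
    using push_unit[of t] canonical_eqI[OF u, of t] by auto
  have p0: "p > 0" using S p prime_gt_0_nat by auto
  have div: "\<exists>f. multiple limit f (p ^ k) ?e" for k
  proof -
    obtain t where t: "p ^ k dvd (\<Prod>r<t. mu r)" using prime_power_dvd_prod_multiplicity[OF g p] by blast
    obtain I where I: "I \<subseteq> {..<g t * n}" "card I = n * (\<Prod>r<t. mu r)"
      "?e = canonical t (0\<^sub>m (g t * n) (g t * n), diag_proj (g t * n) I)" using at_stage by blast
    have dvd: "p ^ k dvd card I" using t I(2) by simp
    obtain J where J: "J \<subseteq> I" "card J = card I div p ^ k"
      by (rule obtain_subset_with_card_n[OF div_le_dividend[of "card I" "p ^ k"]])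
    have "multiple (stage n g t) (0\<^sub>m (g t * n) (g t * n), diag_proj (g t * n) J) (p ^ k)
        (0\<^sub>m (g t * n) (g t * n), diag_proj (g t * n) I)"
      using I(1) J dvd p0 by (intro multiple_diag_proj) auto
    from multiple_canonical[OF this] show ?thesis unfolding I(3)[symmetric] by blast
  qed
  have inf: "\<exists>d. multiple limit ?e N d" if N: "N \<ge> 1" for N
  proof -
    obtain I where I: "I \<subseteq> {..<g N * n}" "card I = n * (\<Prod>r<N. mu r)"
      "?e = canonical N (0\<^sub>m (g N * n) (g N * n), diag_proj (g N * n) I)" using at_stage by blast
    have "N * (\<Prod>r<N. mu r) \<le> 2 ^ N * (\<Prod>r<N. mu r)" by (intro mult_right_mono) auto
    also have "\<dots> \<le> g N" by (rule prod_choice_le)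
    finally have "N * card I \<le> card {..<g N * n}" unfolding I(2) by (simp add: ac_simps)
    then obtain K where K: "K \<subseteq> {..<g N * n}" "card K = N * card I"
      by (rule obtain_subset_with_card_n)
    have "multiple (stage n g N) (0\<^sub>m (g N * n) (g N * n), diag_proj (g N * n) I) N
        (0\<^sub>m (g N * n) (g N * n), diag_proj (g N * n) K)"
      using K I N by (intro multiple_diag_proj) auto
    from multiple_canonical[OF this] show ?thesis unfolding I(3)[symmetric] by blast
  qed
  have "?e \<noteq> \<zero>\<^bsub>limit\<^esub>"
  proof
    assume "?e = \<zero>\<^bsub>limit\<^esub>"
    then have t: "(\<lambda>r. cnorm (stage n g r) (push 0 ?u r)) \<longlonglongrightarrow> 0"
      using limit_class_zero_iff[OF push_limit[OF u]] by (simp add: canonical_def)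
    have ge: "1 \<le> cnorm (stage n g r) (push 0 ?u r)" for r
    proof -
      obtain I where I: "I \<subseteq> {..<g r * n}" "card I = n * (\<Prod>r<r. mu r)"
        "push 0 ?u r = (0\<^sub>m (g r * n) (g r * n), diag_proj (g r * n) I)" using at_stage by blast
      have "card I \<noteq> 0" using I(2) n choice_pos by (simp add: less_not_refl3)
      then have "I \<noteq> {}" by auto
      then show ?thesis unfolding I(3) using diag_proj_norm_ge[OF I(1)] by (simp add: stage_simps le_max_iff_disj)
    qed
    have "(1 :: real) \<le> 0" by (rule LIMSEQ_le_const[OF t]) (use ge in auto)
    then show False by simp
  qed
  moreover have "idempotent_elt limit ?e"
  proof -
    obtain f where f: "multiple limit f (p ^ 0) ?e" using div by blast
    show ?thesis using multiple_idempotent[OF f] by (rule conjunct1)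
  qed
  ultimately show ?thesis unfolding divisible_infinitesimal_def using div inf by blast
qed

text \<open>Let \<open>\<rho> True r\<close> and \<open>\<rho> False r\<close> be the ranks of the two components of \<open>e\<close> at a late stage \<open>r\<close>.
  The first grows as fast as the matrix size, so it must vanish if many copies of \<open>e\<close> fit.  The second
  then is multiplied by \<open>mu r\<close> at each step, which is prime to \<open>p\<close> if \<open>p \<notin> S\<close>; a power of \<open>p\<close> that divides
  the rank at a late stage already divides it at the starting stage.  Thus all powers of \<open>p\<close> divide
  one and the same integer, and this integer is zero.\<close>

lemma in_if_divisible_infinitesimal:
  assumes p: "prime p" and div: "divisible_infinitesimal limit p"
  shows "p \<in> S"
proof (rule ccontr)
  assume pS: "p \<notin> S"
  obtain E where E: "idempotent_elt limit E" "E \<noteq> \<zero>\<^bsub>limit\<^esub>" "\<forall>N\<ge>1. \<exists>D. multiple limit E N D"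
    "\<forall>k. \<exists>F. multiple limit F (p ^ k) E" using div unfolding divisible_infinitesimal_def by blast
  obtain e where e: "e \<in> sequences" "E = limit_class e"
    using E(1) direct_limit_carrierE[of E] by (auto simp: idempotent_elt_def)
  have id: "idempotent_elt limit (limit_class e)" using E(1) e(2) by simp
  define \<rho> where "\<rho> c r = near_rank (component c (e r))" for c r
  obtain C where C: "C \<ge> 1" "\<And>r. cnorm (stage n g r) (e r) \<le> C" using limit_bounded[OF e(1)] by blast
  have "eventually (\<lambda>r. \<forall>c. near_idempotent C (g r * n) (component c (e r)) \<and>
    mat_op_norm (component c (e r) * component c (e r) - component c (e r)) < 1) sequentially"
    using C by (intro eventually_near_idempotent[OF e(1) id]) auto
  then have "eventually (\<lambda>r. \<rho> True (Suc r) = growth_ratio g r * \<rho> True r \<and>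
      \<rho> False (Suc r) = (growth_ratio g r - mu r) * \<rho> True r + mu r * \<rho> False r) sequentially"
    using near_rank_step[OF e(1) id]
  proof eventually_elim
    case (elim r)
    have car: "e r \<in> carrier (stage n g r)" by (rule limit_carrier[OF e(1)])
    have "near_idempotent C (g r * n) (fst (e r))" "near_idempotent C (g r * n) (snd (e r))"
      using elim(1)[rule_format, of True] elim(1)[rule_format, of False] by (simp_all add: component_def)
    note rank = near_rank_standard_block[OF this C(1)]
    have "\<rho> True (Suc r) = near_rank (standard_block (triangular_mult g mu r 1) (fst (e r)) (snd (e r)))"
      "\<rho> False (Suc r) = near_rank (standard_block (triangular_mult g mu r 2) (fst (e r)) (snd (e r)))"
      using elim(2)[rule_format, of True] elim(2)[rule_format, of False] car
      by (simp_all add: \<rho>_def triangular_def component_def)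
    then show ?case unfolding rank by (simp add: triangular_mult_def \<rho>_def component_def)
  qed
  then obtain s where s: "\<And>r. r \<ge> s \<Longrightarrow> \<rho> True (Suc r) = growth_ratio g r * \<rho> True r"
    "\<And>r. r \<ge> s \<Longrightarrow> \<rho> False (Suc r) = (growth_ratio g r - mu r) * \<rho> True r + mu r * \<rho> False r"
    unfolding eventually_sequentially by blast
  have grow: "\<rho> True r * g s = \<rho> True s * g r" if "r \<ge> s" for r
    using that
  proof (induction r rule: dec_induct)
    case (step r)
    have "\<rho> True (Suc r) * g s = growth_ratio g r * (\<rho> True r * g s)" using s(1) step by simp
    also have "\<dots> = \<rho> True s * (growth_ratio g r * g r)" using step by simp
    finally show ?case using growth_ratio_mult[OF g] by simp
  qed simp
  have bound: "N * \<rho> True s \<le> n * g s" if N: "N \<ge> 1" for N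
  proof -
    obtain D where D: "multiple limit E N D" using E(3) N by blast
    obtain d where d: "d \<in> sequences" "D = limit_class d"
      using multiple_idempotent[OF D] direct_limit_carrierE[of D] by (auto simp: idempotent_elt_def)
    have "eventually (\<lambda>r. r \<ge> s \<and> (\<forall>c. near_rank (component c (d r)) = N * \<rho> c r)) sequentially"
      using near_rank_multiple[OF D[unfolded e(2)] e(1) d] eventually_ge_at_top[of s]
      by eventually_elim (simp add: \<rho>_def)
    then obtain r where r: "r \<ge> s" "near_rank (component True (d r)) = N * \<rho> True r"
      unfolding eventually_sequentially by blast
    have "N * \<rho> True r \<le> g r * n"
      using near_rank_le_dim[of "component True (d r)"] r(2) component_carrier[OF limit_carrier[OF d(1)], of True r]
      by simp
    then have "N * (\<rho> True r * g s) \<le> g r * n * g s" by (simp flip: mult.assoc)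
    then have "(N * \<rho> True s) * g r \<le> (n * g s) * g r" unfolding grow[OF r(1)] by (simp add: ac_simps)
    then show ?thesis using growth_sequence_pos[OF g, of r] by simp
  qed
  \<comment> \<open>\<open>N\<close> copies of \<open>e\<close> fit for every \<open>N\<close>; a single \<open>N\<close> beyond \<open>n * g s\<close> already rules out a positive rank.\<close>
  have "\<rho> True s = 0"
  proof (rule ccontr)
    assume "\<rho> True s \<noteq> 0"
    then have "(n * g s + 1) * 1 \<le> (n * g s + 1) * \<rho> True s" by (intro mult_le_mono2) simp
    then show False using bound[of "n * g s + 1"] by simp
  qed
  then have first: "\<rho> True r = 0" if "r \<ge> s" for r using grow[OF that] growth_sequence_pos[OF g, of s] by simp
  have coprime: "coprime (p ^ k) (mu r)" for k r
  proof -
    have "coprime p (mu r)"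
      using multiplicity_choice_cases[of g S r] S pS p by (metis coprime_1_right mem_Collect_eq primes_coprime subsetD)
    then show ?thesis by simp
  qed
  have dvd: "p ^ k dvd \<rho> False r" if "r \<ge> s" for r k
  proof -
    obtain F where F: "multiple limit F (p ^ k) E" using E(4) by blast
    obtain f where f: "f \<in> sequences" "F = limit_class f"
      using multiple_idempotent[OF F] direct_limit_carrierE[of F] by (auto simp: idempotent_elt_def)
    have "eventually (\<lambda>t. t \<ge> r \<and> (\<forall>c. \<rho> c t = p ^ k * near_rank (component c (f t)))) sequentially"
      using near_rank_multiple[OF F[unfolded f(2)] f(1) e] eventually_ge_at_top[of r]
      by eventually_elim (simp add: \<rho>_def)
    then obtain t where t: "t \<ge> r" "\<rho> False t = p ^ k * near_rank (component False (f t))"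
      unfolding eventually_sequentially by blast
    have "p ^ k dvd \<rho> False t \<Longrightarrow> p ^ k dvd \<rho> False r" using t(1)
    proof (induction t rule: dec_induct)
      case (step t)
      have "\<rho> False (Suc t) = mu t * \<rho> False t" using s(2) first step that by simp
      then show ?case using step coprime[of k t] by (simp add: coprime_dvd_mult_right_iff)
    qed
    then show ?thesis using t(2) by simp
  qed
  have "\<rho> False r = 0" if "r \<ge> s" for r
  proof (rule ccontr)
    assume "\<rho> False r \<noteq> 0"
    then have "p ^ \<rho> False r \<le> \<rho> False r" using dvd[OF that, of "\<rho> False r"] by (intro dvd_imp_le) auto
    moreover have "\<rho> False r < p ^ \<rho> False r" using prime_gt_1_nat[OF p] by (simp add: power_gt_expt)
    ultimately show False by simp
  qed
  then have "\<forall>c. \<rho> c r = 0" if "r \<ge> s" for r using first that by (metis (full_types))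
  then have "limit_class e = \<zero>\<^bsub>limit\<^esub>"
    by (intro near_rank_zero_imp_zero[OF e(1) id]) (auto simp: eventually_sequentially \<rho>_def)
  then show False using E(2) e(2) by simp
qed

lemma divisible_infinitesimal_iff:
  assumes "prime p"
  shows "divisible_infinitesimal (AF_algebra n g (triangular n g (multiplicity_choice g S))) p \<longleftrightarrow> p \<in> S"
  unfolding AF_algebra_def using divisible_infinitesimal_if_in in_if_divisible_infinitesimal[OF assms] by blast

end

lemma iso_rel_refl: "\<phi> \<in> ensemble n g \<Longrightarrow> (\<phi>, \<phi>) \<in> iso_rel n g"
  unfolding iso_rel_def star_isomorphic_def star_hom_def by (auto intro!: exI[of _ id])

lemma divisible_infinitesimal_iso_rel:
  assumes "(\<phi>, \<psi>) \<in> iso_rel n g" "divisible_infinitesimal (AF_algebra n g \<phi>) p"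
  shows "divisible_infinitesimal (AF_algebra n g \<psi>) p"
  using assms star_isomorphic_imp_divisible_infinitesimal[of "stage n g" \<phi> "stage n g" \<psi> p]
    normed_ring_system_ensemble[of \<phi>] normed_ring_system_ensemble[of \<psi>]
  by (auto simp: iso_rel_def AF_algebra_def)

lemma uncountable_Pow_primes: "uncountable (Pow {p :: nat. prime p})"
proof
  assume "countable (Pow {p :: nat. prime p})"
  then obtain h :: "nat set \<Rightarrow> nat" where h: "inj_on h (Pow {p. prime p})" by (rule countableE)
  obtain q :: "nat \<Rightarrow> nat" where q: "inj q" "range q \<subseteq> {p. prime p}"
    using infinite_countable_subset[OF primes_infinite] by blast
  have "inj (\<lambda>A. h (q ` A))"
  proof (rule injI)
    fix A B assume "h (q ` A) = h (q ` B)"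
    then have "q ` A = q ` B" using q(2) by (intro inj_onD[OF h]) auto
    then show "A = B" using q(1) by (simp add: inj_image_eq_iff)
  qed
  then have "surj (inv_into UNIV (\<lambda>A. h (q ` A)))" by (rule inj_imp_surj_inv)
  then show False using Cantors_theorem[of "UNIV :: nat set"] by auto
qed

theorem theorem7p1:
  fixes n :: nat and g :: "nat \<Rightarrow> nat"
  assumes "n \<ge> 1" and "growth_sequence g"
  shows "uncountable (ensemble n g // iso_rel n g)"
proof
  assume countable: "countable (ensemble n g // iso_rel n g)"
  let ?P = "Pow {p :: nat. prime p}"
  let ?\<phi> = "\<lambda>S. triangular n g (multiplicity_choice g S)"
  let ?c = "\<lambda>S. iso_rel n g `` {?\<phi> S}"
  have ens: "?\<phi> S \<in> ensemble n g" if "S \<in> ?P" for S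
    using choice_in_ensemble[OF assms, of S] that by simp
  have "S \<subseteq> T" if "S \<in> ?P" "T \<in> ?P" "?c S = ?c T" for S T
  proof
    fix p assume p: "p \<in> S"
    then have prime: "prime p" using that(1) by auto
    have "(?\<phi> S, ?\<phi> T) \<in> iso_rel n g" using iso_rel_refl[OF ens[OF that(2)]] that(3) by blast
    moreover have "divisible_infinitesimal (AF_algebra n g (?\<phi> S)) p"
      using divisible_infinitesimal_iff[OF assms, of S p] that(1) p prime by simp
    ultimately have "divisible_infinitesimal (AF_algebra n g (?\<phi> T)) p"
      by (rule divisible_infinitesimal_iso_rel)
    then show "p \<in> T" using divisible_infinitesimal_iff[OF assms, of T p] that(2) prime by simp
  qed
  then have "inj_on ?c ?P" by (intro inj_onI equalityI) metis+
  moreover have "?c ` ?P \<subseteq> ensemble n g // iso_rel n g" using ens by (auto intro: quotientI)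
  ultimately have "countable ?P"
    using countable countable_subset countable_image_inj_on by blast
  then show False using uncountable_Pow_primes by blast
qed

end
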